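(* Let $\beta>0$. As $\lambda\to\infty$ we have $$\frac1{\sqrt{\log\lambda}}\left(\mathrm{Sine}_\beta[0,\lambda]-\frac{\lambda}{2\pi}\right)\Rightarrow\mathcal N\left(0,\frac{2}{\beta\pi^2}\right)$$ in distribution, where $\mathcal N(0,s)$ is the normal distribution with mean $0$ and variance $s$.
   Context: $\mathrm{Sine}_\beta$ is the point process on $\mathbb R$ with counting function $\lambda\mapsto\frac1{2\pi}\lim_{t\to\infty}\alpha^\lambda(t)$, where $\alpha^\lambda$, $\lambda\in\mathbb R$, solves $d\alpha^\lambda=\lambda\frac\beta4e^{-\frac\beta4t}dt+\mathrm{Re}[(e^{-i\alpha^\lambda}-1)(d\mathcal B_1+i\,d\mathcal B_2)]$, $\alpha^\lambda(0)=0$, $t\in[0,\infty)$, with $\mathcal B_1,\mathcal B_2$ independent standard real Brownian motions common to all $\lambda$. (It is the bulk scaling limit of the Hermite $\beta$-ensembles, with intensity $1/(2\pi)$.) $\mathrm{Sine}_\beta[0,\lambda]$ denotes the number of its points in $[0,\lambda]$. *)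

theory Defs
  imports "HOL-Probability.Probability" "HOL-Probability.Stopping_Time"
begin

section \<open>Brownian motion with respect to a filtration\<close>

text \<open>Time is the half-line \<open>t \<ge> 0\<close>. Filtrations are indexed by all reals only because the
  library locale \<open>filtration\<close> is; their members at negative times are never used.\<close>

definition filtered_prob_space :: "'a measure \<Rightarrow> (real \<Rightarrow> 'a measure) \<Rightarrow> bool" where
  "filtered_prob_space M F \<longleftrightarrow>
     prob_space M \<and> filtration (space M) F \<and> (\<forall>t. subalgebra M (F t))"

definition adapted :: "(real \<Rightarrow> 'a measure) \<Rightarrow> (real \<Rightarrow> 'a \<Rightarrow> real) \<Rightarrow> bool" where
  "adapted F X \<longleftrightarrow> (\<forall>t\<ge>0. X t \<in> borel_measurable (F t))"

definition brownian_motion ::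
  "'a measure \<Rightarrow> (real \<Rightarrow> 'a measure) \<Rightarrow> (real \<Rightarrow> 'a \<Rightarrow> real) \<Rightarrow> bool" where
  "brownian_motion M F B \<longleftrightarrow>
     adapted F B \<and>
     (AE \<omega> in M. B 0 \<omega> = 0) \<and>
     (AE \<omega> in M. continuous_on {0..} (\<lambda>t. B t \<omega>)) \<and>
     (\<forall>s t. 0 \<le> s \<longrightarrow> s < t \<longrightarrow>
        distributed M lborel (\<lambda>\<omega>. B t \<omega> - B s \<omega>) (normal_density 0 (sqrt (t - s))) \<and>
        prob_space.indep_set M (sets (F s))
          (sets (vimage_algebra (space M) (\<lambda>\<omega>. B t \<omega> - B s \<omega>) borel)))"

text \<open>The last clause does not follow from the others: the two increments after time \<open>s\<close> could
  each be independent of \<open>F s\<close>, and of one another, without being jointly independent of it.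
  It is automatic when \<open>F\<close> is the (completed) filtration generated by the two motions.\<close>

definition independent_brownian_motions ::
  "'a measure \<Rightarrow> (real \<Rightarrow> 'a measure) \<Rightarrow> (real \<Rightarrow> 'a \<Rightarrow> real) \<Rightarrow> (real \<Rightarrow> 'a \<Rightarrow> real) \<Rightarrow> bool" where
  "independent_brownian_motions M F B\<^sub>1 B\<^sub>2 \<longleftrightarrow>
     brownian_motion M F B\<^sub>1 \<and> brownian_motion M F B\<^sub>2 \<and>
     prob_space.indep_var M
       (\<Pi>\<^sub>M t\<in>{0..}. borel) (\<lambda>\<omega>. \<lambda>t\<in>{0..}. B\<^sub>1 t \<omega>)
       (\<Pi>\<^sub>M t\<in>{0..}. borel) (\<lambda>\<omega>. \<lambda>t\<in>{0..}. B\<^sub>2 t \<omega>) \<and>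
     (\<forall>s t. 0 \<le> s \<longrightarrow> s < t \<longrightarrow>
        prob_space.indep_set M (sets (F s))
          (sets (vimage_algebra (space M)
             (\<lambda>\<omega>. (B\<^sub>1 t \<omega> - B\<^sub>1 s \<omega>, B\<^sub>2 t \<omega> - B\<^sub>2 s \<omega>)) (borel \<Otimes>\<^sub>M borel))))"


section \<open>The Ito integral\<close>

text \<open>An elementary process on \<open>[0, T]\<close> is given by times \<open>0 \<le> \<tau> 0 \<le> \<dots> \<le> \<tau> n \<le> T\<close> and bounded
  \<open>F (\<tau> k)\<close>-measurable values \<open>\<xi> k\<close> taken on \<open>[\<tau> k, \<tau> (k + 1))\<close>.\<close>

definition elementary ::
  "(real \<Rightarrow> 'a measure) \<Rightarrow> real \<Rightarrow> nat \<Rightarrow> (nat \<Rightarrow> real) \<Rightarrow> (nat \<Rightarrow> 'a \<Rightarrow> real) \<Rightarrow> bool" where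
  "elementary F T n \<tau> \<xi> \<longleftrightarrow>
     0 \<le> \<tau> 0 \<and> (\<forall>k<n. \<tau> k \<le> \<tau> (Suc k)) \<and> \<tau> n \<le> T \<and>
     (\<forall>k<n. \<xi> k \<in> borel_measurable (F (\<tau> k)) \<and> (\<exists>C. \<forall>\<omega>\<in>space (F (\<tau> k)). \<bar>\<xi> k \<omega>\<bar> \<le> C))"

definition elementary_process ::
  "nat \<Rightarrow> (nat \<Rightarrow> real) \<Rightarrow> (nat \<Rightarrow> 'a \<Rightarrow> real) \<Rightarrow> real \<Rightarrow> 'a \<Rightarrow> real" where
  "elementary_process n \<tau> \<xi> t \<omega> = (\<Sum>k<n. \<xi> k \<omega> * indicator {\<tau> k..<\<tau> (Suc k)} t)"

definition elementary_integral ::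
  "(real \<Rightarrow> 'a \<Rightarrow> real) \<Rightarrow> nat \<Rightarrow> (nat \<Rightarrow> real) \<Rightarrow> (nat \<Rightarrow> 'a \<Rightarrow> real) \<Rightarrow> 'a \<Rightarrow> real" where
  "elementary_integral B n \<tau> \<xi> \<omega> = (\<Sum>k<n. \<xi> k \<omega> * (B (\<tau> (Suc k)) \<omega> - B (\<tau> k) \<omega>))"

definition ito_integrand ::
  "'a measure \<Rightarrow> (real \<Rightarrow> 'a measure) \<Rightarrow> real \<Rightarrow> (real \<Rightarrow> 'a \<Rightarrow> real) \<Rightarrow> bool" where
  "ito_integrand M F T X \<longleftrightarrow>
     (\<lambda>(t, \<omega>). X t \<omega>) \<in> borel_measurable (restrict_space lborel {0..T} \<Otimes>\<^sub>M M) \<and>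
     (\<forall>t\<in>{0..T}. X t \<in> borel_measurable (F t)) \<and>
     (\<integral>\<^sup>+\<omega>. (\<integral>\<^sup>+t\<in>{0..T}. ennreal ((X t \<omega>)\<^sup>2) \<partial>lborel) \<partial>M) < \<infinity>"

text \<open>\<open>I\<close> is a version of the stochastic integral of \<open>X\<close> with respect to \<open>B\<close> over \<open>[0, T]\<close>: the limit
  in mean square of the integrals of elementary processes that approximate \<open>X\<close> in mean square.
  By the Ito isometry \<open>I\<close> is unique up to null sets.\<close>

definition has_ito_integral ::
  "'a measure \<Rightarrow> (real \<Rightarrow> 'a measure) \<Rightarrow> (real \<Rightarrow> 'a \<Rightarrow> real) \<Rightarrow> real \<Rightarrow> (real \<Rightarrow> 'a \<Rightarrow> real) \<Rightarrow>
   ('a \<Rightarrow> real) \<Rightarrow> bool" where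
  "has_ito_integral M F B T X I \<longleftrightarrow>
     ito_integrand M F T X \<and> I \<in> borel_measurable M \<and>
     (\<exists>n \<tau> \<xi>. (\<forall>j. elementary F T (n j) (\<tau> j) (\<xi> j)) \<and>
        (\<lambda>j. \<integral>\<^sup>+\<omega>. (\<integral>\<^sup>+t\<in>{0..T}.
            ennreal ((X t \<omega> - elementary_process (n j) (\<tau> j) (\<xi> j) t \<omega>)\<^sup>2) \<partial>lborel) \<partial>M)
          \<longlonglongrightarrow> 0 \<and>
        (\<lambda>j. \<integral>\<^sup>+\<omega>. ennreal ((I \<omega> - elementary_integral B (n j) (\<tau> j) (\<xi> j) \<omega>)\<^sup>2) \<partial>M)
          \<longlonglongrightarrow> 0)"


section \<open>The Sine-beta process\<close>

text \<open>A solution of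
  \<open>d\<alpha> = l \<beta>/4 exp (- \<beta> t/4) dt + Re ((exp (- \<i> \<alpha>) - 1) (dB\<^sub>1 + \<i> dB\<^sub>2))\<close>, \<open>\<alpha> 0 = 0\<close>;
  for complex \<open>z\<close>, \<open>Re (z (dB\<^sub>1 + \<i> dB\<^sub>2)) = Re z dB\<^sub>1 - Im z dB\<^sub>2\<close>.\<close>

definition sine_sde_solution ::
  "real \<Rightarrow> 'a measure \<Rightarrow> (real \<Rightarrow> 'a measure) \<Rightarrow> (real \<Rightarrow> 'a \<Rightarrow> real) \<Rightarrow> (real \<Rightarrow> 'a \<Rightarrow> real) \<Rightarrow>
   real \<Rightarrow> (real \<Rightarrow> 'a \<Rightarrow> real) \<Rightarrow> bool" where
  "sine_sde_solution \<beta> M F B\<^sub>1 B\<^sub>2 l \<alpha> \<longleftrightarrow>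
     adapted F \<alpha> \<and>
     (AE \<omega> in M. \<alpha> 0 \<omega> = 0) \<and>
     (AE \<omega> in M. continuous_on {0..} (\<lambda>t. \<alpha> t \<omega>)) \<and>
     (\<forall>t\<ge>0. \<exists>I\<^sub>1 I\<^sub>2.
        has_ito_integral M F B\<^sub>1 t (\<lambda>s \<omega>. Re (cis (- \<alpha> s \<omega>) - 1)) I\<^sub>1 \<and>
        has_ito_integral M F B\<^sub>2 t (\<lambda>s \<omega>. - Im (cis (- \<alpha> s \<omega>) - 1)) I\<^sub>2 \<and>
        (AE \<omega> in M. \<alpha> t \<omega> =
           integral {0..t} (\<lambda>s. l * (\<beta> / 4) * exp (- (\<beta> / 4) * s)) + I\<^sub>1 \<omega> + I\<^sub>2 \<omega>))"

text \<open>Point processes on the line are random locally finite counting measures; the mass of a set is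
  the number of points in it, counted with multiplicity.\<close>

definition point_process :: "'a measure \<Rightarrow> ('a \<Rightarrow> real measure) \<Rightarrow> bool" where
  "point_process M N \<longleftrightarrow>
     (\<forall>\<omega>\<in>space M. sets (N \<omega>) = sets borel \<and>
        (\<forall>A\<in>sets borel. bounded A \<longrightarrow> emeasure (N \<omega>) A \<in> \<nat>)) \<and>
     (\<forall>A\<in>sets borel. (\<lambda>\<omega>. emeasure (N \<omega>) A) \<in> borel_measurable M)"

definition counting_function :: "real measure \<Rightarrow> real \<Rightarrow> real" where
  "counting_function \<mu> l = (if 0 \<le> l then measure \<mu> {0<..l} else - measure \<mu> {l<..0})"

text \<open>The limit is required almost surely for each fixed \<open>l\<close>, with an exceptional set that may
  depend on \<open>l\<close>. This determines the law of \<open>N\<close>.\<close>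

definition sine_process :: "real \<Rightarrow> 'a measure \<Rightarrow> ('a \<Rightarrow> real measure) \<Rightarrow> bool" where
  "sine_process \<beta> M N \<longleftrightarrow>
     point_process M N \<and>
     (\<exists>F B\<^sub>1 B\<^sub>2 \<alpha>. filtered_prob_space M F \<and> independent_brownian_motions M F B\<^sub>1 B\<^sub>2 \<and>
        (\<forall>l. sine_sde_solution \<beta> M F B\<^sub>1 B\<^sub>2 l (\<alpha> l)) \<and>
        (\<forall>l. AE \<omega> in M.
           ((\<lambda>t. 1 / (2 * pi) * \<alpha> l t \<omega>) \<longlongrightarrow> counting_function (N \<omega>) l) at_top))"


section \<open>Convergence in distribution\<close>

text \<open>The library notion \<open>weak_conv_m\<close> is for sequences; this is the same notion along a filter.\<close>

definition weak_conv_along :: "'i filter \<Rightarrow> ('i \<Rightarrow> real measure) \<Rightarrow> real measure \<Rightarrow> bool" where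
  "weak_conv_along G \<mu> \<nu> \<longleftrightarrow>
     (\<forall>x. isCont (cdf \<nu>) x \<longrightarrow> ((\<lambda>i. cdf (\<mu> i) x) \<longlongrightarrow> cdf \<nu> x) G)"

lemma weak_conv_along_sequentially: "weak_conv_along sequentially \<mu> \<nu> \<longleftrightarrow> weak_conv_m \<mu> \<nu>"
  by (simp add: weak_conv_along_def weak_conv_m_def weak_conv_def)

text \<open>The normal distribution with mean \<open>m\<close> and variance \<open>v > 0\<close>; the second argument of
  \<open>normal_density\<close> is the standard deviation.\<close>

definition normal_distribution :: "real \<Rightarrow> real \<Rightarrow> real measure" where
  "normal_distribution m v = density lborel (normal_density m (sqrt v))"

end

theory Submission
  imports Defs
begin

text \<open>
  Up to the factor \<open>1/(2\<pi>)\<close>, the number of points in \<open>(0, l]\<close> is the final value of the phase \<open>\<alpha>\<close> that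
  solves \<open>d\<alpha> = r dt + dL\<close>, where \<open>r(t) = l (\<beta>/4) exp (- \<beta> t/4)\<close> has total mass \<open>l\<close> and the martingale
  \<open>L\<close> has bracket \<open>(2 - 2 cos \<alpha>) dt\<close>. Until the time \<open>T = (4/\<beta>) ln l\<close> the rate \<open>r\<close> is at least of order
  one, the phase rotates fast for most of that time, \<open>cos \<alpha>\<close> averages out, and the bracket grows like
  \<open>2 T = (8/\<beta>) ln l\<close>. After \<open>T\<close> only a bounded amount is added. Hence \<open>\<alpha> - l\<close> is asymptotically normal
  with variance \<open>(8/\<beta>) ln l\<close>, and division by \<open>2\<pi>\<close> gives \<open>2/(\<beta>\<pi>\<^sup>2)\<close>.

  The proof works with the moments \<open>m(\<mu>, t) = E exp (\<i> \<mu> \<alpha>(t))\<close>. Multiplication by \<open>cos \<alpha>\<close> shifts \<open>\<mu>\<close> by one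
  in both directions, so Ito's formula gives a closed hierarchy (\<open>moment_derivative\<close>),
  \<open>m'(\<mu>) = \<i> \<mu> r m(\<mu>) + (\<mu>\<^sup>2/2) (m(\<mu> + 1) - 2 m(\<mu>) + m(\<mu> - 1))\<close>,
  from which everything follows by calculus.

  Early phase (\<open>early_gaussian\<close>). For small \<open>\<mu>\<close> the function \<open>exp (\<mu>\<^sup>2 t - \<i> \<mu> \<integral> r) m(\<mu>, t)\<close> is driven only by
  \<open>m(\<mu> \<plusminus> 1)\<close> with the prefactor \<open>\<mu>\<^sup>2/2\<close>. These neighbours oscillate with speed \<open>r\<close>, so that their
  integral up to \<open>T\<close> is of the order of \<open>1/r(T)\<close>, which is bounded. The error is therefore \<open>O(\<mu>\<^sup>2)\<close>, and for
  \<open>\<mu>\<close> of order \<open>1/sqrt (ln l)\<close> the centred moment at \<open>T\<close> is close to \<open>exp (- \<mu>\<^sup>2 T)\<close>.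

  Late phase (\<open>late_fluctuation\<close>). The centred moment moves by at most \<open>\<mu>\<^sup>2 \<integral> E (1 - cos \<alpha>)\<close>. That integral
  is bounded because of the Lyapunov function \<open>g(\<alpha>) = \<Sum>\<^sub>k cos (k \<alpha>)/k\<^sup>2\<close>: it is a parabola between consecutive
  multiples of \<open>2\<pi>\<close>, and its kinks there do no harm since the noise vanishes at them. The generator maps it to
  \<open>(1 - cos \<alpha>)/2\<close> plus \<open>r\<close> times a bounded sawtooth, and \<open>r\<close> has mass one after \<open>T\<close>.

  Ito's formula enters as an identity for expectations of exponentials. For step integrands it is
  an exact Gaussian computation (\<open>simple_integral_exponential\<close>), and the isometry
  (\<open>simple_integral_isometry\<close>) carries it over to Ito integrals (\<open>exponential_formula\<close>). The theorem then
  follows by letting \<open>t \<rightarrow> \<infinity>\<close> and applying Levy's continuity theorem.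
\<close>

section \<open>Gaussian integrals\<close>

lemma sets_normal_distribution [simp, measurable_cong]: "sets (normal_distribution m v) = sets borel"
  by (simp add: normal_distribution_def)

lemma space_normal_distribution [simp]: "space (normal_distribution m v) = UNIV"
  by (simp add: normal_distribution_def)

lemma cis_measurable [measurable]: "cis \<in> borel_measurable borel"
  by (intro borel_measurable_continuous_onI continuous_intros)

lemma prob_space_normal_distribution: "0 < v \<Longrightarrow> prob_space (normal_distribution m v)"
  by (simp add: normal_distribution_def prob_space_normal_density)

lemma char_normal_distribution:
  assumes v: "0 < v"
  shows "char (normal_distribution 0 v) t = complex_of_real (exp (- (v * t\<^sup>2) / 2))"
proof -
  interpret S: prob_space std_normal_distribution
    using prob_space_normal_distribution[of 1 0] by (simp add: normal_distribution_def)
  have "distributed std_normal_distribution lborel (\<lambda>x. x) std_normal_density"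
    by (auto simp: distributed_def distr_id2 intro!: distr_id2)
  from S.normal_density_affine[OF this, of "sqrt v" 0] v
  have "distributed std_normal_distribution lborel (\<lambda>x. sqrt v * x) (normal_density 0 (sqrt v))"
    by simp
  then have "distr std_normal_distribution lborel (\<lambda>x. sqrt v * x) = normal_distribution 0 v"
    by (simp add: distributed_distr_eq_density normal_distribution_def)
  then have "char (normal_distribution 0 v) t
    = (\<integral>x. iexp (t * x) \<partial>distr std_normal_distribution lborel (\<lambda>x. sqrt v * x))"
    by (simp add: char_def)
  also have "\<dots> = char std_normal_distribution (t * sqrt v)"
    unfolding char_def by (subst integral_distr) (auto simp: mult.assoc)
  also have "\<dots> = complex_of_real (exp (- (v * t\<^sup>2) / 2))"
    using v by (simp add: char_std_normal_distribution power_mult_distrib mult.commute)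
  finally show ?thesis .
qed

lemma nn_integral_normal_square:
  assumes v: "0 < v"
  shows "(\<integral>\<^sup>+x. ennreal ((c + b * x)\<^sup>2) \<partial>normal_distribution 0 v) = ennreal (c\<^sup>2 + b\<^sup>2 * v)"
proof -
  let ?d = "normal_density 0 (sqrt v)"
  have 0: "has_bochner_integral lborel (\<lambda>x. ?d x * 1) 1"
    using normal_moment_even[of "sqrt v" 0 0] v by simp
  have 1: "has_bochner_integral lborel (\<lambda>x. ?d x * x) 0"
    using normal_moment_nz_1[of "sqrt v" 0] v by simp
  have 2: "has_bochner_integral lborel (\<lambda>x. ?d x * x\<^sup>2) v"
    using normal_moment_even[of "sqrt v" 0 1] v by simp
  have "has_bochner_integral lborel (\<lambda>x. c\<^sup>2 * (?d x * 1) + (2 * c * b * (?d x * x) + b\<^sup>2 * (?d x * x\<^sup>2)))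
      (c\<^sup>2 * 1 + (2 * c * b * 0 + b\<^sup>2 * v))"
    by (intro has_bochner_integral_add has_bochner_integral_mult_right 0 1 2)
  then have "has_bochner_integral lborel (\<lambda>x. ?d x * (c + b * x)\<^sup>2) (c\<^sup>2 + b\<^sup>2 * v)"
    by (simp add: power2_eq_square algebra_simps)
  then have "(\<integral>\<^sup>+x. ennreal (?d x * (c + b * x)\<^sup>2) \<partial>lborel) = ennreal (c\<^sup>2 + b\<^sup>2 * v)"
    using v by (simp add: has_bochner_integral_iff nn_integral_eq_integral)
  then show ?thesis
    by (simp add: normal_distribution_def nn_integral_density ennreal_mult)
qed

abbreviation gauss_pair :: "real \<Rightarrow> (real \<times> real) measure" where
  "gauss_pair h \<equiv> normal_distribution 0 h \<Otimes>\<^sub>M normal_distribution 0 h"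

lemma prob_space_gauss_pair: "0 < h \<Longrightarrow> prob_space (gauss_pair h)"
  by (intro prob_space_pair prob_space_normal_distribution)

lemma nn_integral_gauss_pair_square:
  assumes h: "0 < h"
  shows "(\<integral>\<^sup>+g. ennreal ((c + a * fst g + b * snd g)\<^sup>2) \<partial>gauss_pair h)
    = ennreal (c\<^sup>2 + (a\<^sup>2 + b\<^sup>2) * h)"
proof -
  interpret N: prob_space "normal_distribution 0 h" by (rule prob_space_normal_distribution[OF h])
  have "(\<integral>\<^sup>+g. ennreal ((c + a * fst g + b * snd g)\<^sup>2) \<partial>gauss_pair h)
    = (\<integral>\<^sup>+x. \<integral>\<^sup>+y. ennreal ((c + a * x + b * y)\<^sup>2) \<partial>normal_distribution 0 h \<partial>normal_distribution 0 h)"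
    by (subst N.nn_integral_fst[symmetric]) auto
  also have "\<dots> = (\<integral>\<^sup>+x. ennreal ((c + a * x)\<^sup>2) + ennreal (b\<^sup>2 * h) \<partial>normal_distribution 0 h)"
    using h by (simp add: nn_integral_normal_square)
  also have "\<dots> = ennreal (c\<^sup>2 + a\<^sup>2 * h) + ennreal (b\<^sup>2 * h)"
    using h by (subst nn_integral_add) (auto simp: nn_integral_normal_square N.emeasure_space_1[simplified])
  also have "\<dots> = ennreal (c\<^sup>2 + (a\<^sup>2 + b\<^sup>2) * h)"
    using h by (simp add: ennreal_plus[symmetric] algebra_simps del: ennreal_plus)
  finally show ?thesis .
qed

lemma integral_gauss_pair_cis:
  assumes h: "0 < h"
  shows "(\<integral>g. cis (a * fst g + b * snd g) \<partial>gauss_pair h)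
    = complex_of_real (exp (- (a\<^sup>2 + b\<^sup>2) * h / 2))"
proof -
  interpret N: prob_space "normal_distribution 0 h" by (rule prob_space_normal_distribution[OF h])
  interpret P: pair_prob_space "normal_distribution 0 h" "normal_distribution 0 h" ..
  have i: "integrable (gauss_pair h)
      (\<lambda>g. cis (a * fst g) * cis (b * snd g))"
    by (rule P.P.integrable_const_bound[where B=1]) (auto simp: norm_mult)
  have "(\<integral>g. cis (a * fst g + b * snd g) \<partial>gauss_pair h)
    = (\<integral>x. \<integral>y. cis (a * x) * cis (b * y) \<partial>normal_distribution 0 h \<partial>normal_distribution 0 h)"
    using P.integral_fst'[OF i] by (simp add: cis_mult)
  also have "\<dots> = char (normal_distribution 0 h) a * char (normal_distribution 0 h) b"
    by (simp add: char_def cis_conv_exp)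
  also have "\<dots> = complex_of_real (exp (- (a\<^sup>2 + b\<^sup>2) * h / 2))"
    using h by (simp add: char_normal_distribution flip: of_real_mult)
      (simp add: mult_exp_exp algebra_simps add_divide_distrib diff_divide_distrib)
  finally show ?thesis .
qed


section \<open>Increments of two independent Brownian motions\<close>

locale brownian_pair = prob_space M for M :: "'a measure" +
  fixes F :: "real \<Rightarrow> 'a measure" and B\<^sub>1 B\<^sub>2 :: "real \<Rightarrow> 'a \<Rightarrow> real"
  assumes filtered: "filtered_prob_space M F"
    and brownian: "independent_brownian_motions M F B\<^sub>1 B\<^sub>2"
begin

lemma space_F [simp]: "space (F t) = space M"
  using filtered by (simp add: filtered_prob_space_def subalgebra_def)

lemma sets_F_mono: "s \<le> t \<Longrightarrow> sets (F s) \<subseteq> sets (F t)"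
  using filtered by (auto simp: filtered_prob_space_def filtration_def)

lemma measurable_F_mono: "f \<in> measurable (F s) N \<Longrightarrow> s \<le> t \<Longrightarrow> f \<in> measurable (F t) N"
  using sets_F_mono[of s t] by (auto simp: measurable_def)

lemma measurable_F_M: "f \<in> measurable (F s) N \<Longrightarrow> f \<in> measurable M N"
  using filtered by (auto simp: filtered_prob_space_def intro: measurable_from_subalg)

lemma id_measurable_F: "(\<lambda>\<omega>. \<omega>) \<in> measurable M (F s)"
  using measurable_F_M[of "\<lambda>\<omega>. \<omega>" s "F s"] by simp

lemma B_measurable_F:
  assumes "0 \<le> t" shows "B\<^sub>1 t \<in> borel_measurable (F t)" "B\<^sub>2 t \<in> borel_measurable (F t)"
  using brownian assms
  by (auto simp: independent_brownian_motions_def brownian_motion_def adapted_def)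

lemma B_measurable_M:
  assumes "0 \<le> t" shows "B\<^sub>1 t \<in> borel_measurable M" "B\<^sub>2 t \<in> borel_measurable M"
  using B_measurable_F[OF assms] measurable_F_M by blast+

lemma increment_law:
  assumes "0 \<le> u" "u < w"
  shows "distr M borel (\<lambda>\<omega>. B\<^sub>1 w \<omega> - B\<^sub>1 u \<omega>) = normal_distribution 0 (w - u)"
    and "distr M borel (\<lambda>\<omega>. B\<^sub>2 w \<omega> - B\<^sub>2 u \<omega>) = normal_distribution 0 (w - u)"
proof -
  have *: "distr M lborel X = distr M borel X" for X :: "'a \<Rightarrow> real"
    by (rule distr_cong) auto
  have "distributed M lborel (\<lambda>\<omega>. B\<^sub>1 w \<omega> - B\<^sub>1 u \<omega>) (normal_density 0 (sqrt (w - u)))"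
    "distributed M lborel (\<lambda>\<omega>. B\<^sub>2 w \<omega> - B\<^sub>2 u \<omega>) (normal_density 0 (sqrt (w - u)))"
    using brownian assms by (auto simp: independent_brownian_motions_def brownian_motion_def)
  then show "distr M borel (\<lambda>\<omega>. B\<^sub>1 w \<omega> - B\<^sub>1 u \<omega>) = normal_distribution 0 (w - u)"
    "distr M borel (\<lambda>\<omega>. B\<^sub>2 w \<omega> - B\<^sub>2 u \<omega>) = normal_distribution 0 (w - u)"
    unfolding normal_distribution_def using distributed_distr_eq_density * by metis+
qed

definition increment :: "real \<Rightarrow> real \<Rightarrow> 'a \<Rightarrow> real \<times> real" where
  "increment u w \<omega> = (B\<^sub>1 w \<omega> - B\<^sub>1 u \<omega>, B\<^sub>2 w \<omega> - B\<^sub>2 u \<omega>)"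

lemma increment_measurable:
  assumes "0 \<le> u" "u < w"
  shows "increment u w \<in> M \<rightarrow>\<^sub>M borel \<Otimes>\<^sub>M borel"
  unfolding increment_def using assms
  by (intro measurable_Pair borel_measurable_diff B_measurable_M) auto

lemma increment_pair_law:
  assumes uw: "0 \<le> u" "u < w"
  shows "distr M (borel \<Otimes>\<^sub>M borel) (increment u w) = gauss_pair (w - u)"
proof -
  let ?f = "\<lambda>x::real \<Rightarrow> real. x w - x u"
  have m: "?f \<in> borel_measurable (\<Pi>\<^sub>M t\<in>{0..}. borel)" using uw by (intro borel_measurable_diff measurable_component_singleton) auto
  have "indep_var (\<Pi>\<^sub>M t\<in>{0..}. borel) (\<lambda>\<omega>. \<lambda>t\<in>{0..}. B\<^sub>1 t \<omega>)
       (\<Pi>\<^sub>M t\<in>{0..}. borel) (\<lambda>\<omega>. \<lambda>t\<in>{0..}. B\<^sub>2 t \<omega>)"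
    using brownian by (simp add: independent_brownian_motions_def)
  from indep_var_compose[OF this m m]
  have "indep_var borel (\<lambda>\<omega>. B\<^sub>1 w \<omega> - B\<^sub>1 u \<omega>) borel (\<lambda>\<omega>. B\<^sub>2 w \<omega> - B\<^sub>2 u \<omega>)"
    using uw by (simp add: comp_def)
  then show ?thesis
    unfolding indep_var_distribution_eq increment_def using increment_law[OF uw] by simp
qed

text \<open>The identity map carries all information of \<open>F u\<close>, so this product law says that
the increment is independent of the whole past: in an expectation, everything measurable
with respect to \<open>F u\<close> may be held fixed while the increment is integrated out. The next two lemmas
are this principle for nonnegative and for bounded functions.\<close>

lemma indep_increment:
  assumes uw: "0 \<le> u" "u < w"
  shows "distr M (F u \<Otimes>\<^sub>M (borel \<Otimes>\<^sub>M borel)) (\<lambda>\<omega>. (\<omega>, increment u w \<omega>))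
    = distr M (F u) (\<lambda>\<omega>. \<omega>) \<Otimes>\<^sub>M gauss_pair (w - u)"
proof -
  have 1: "indep_set (sets (F u)) (sets (vimage_algebra (space M) (increment u w) (borel \<Otimes>\<^sub>M borel)))"
    using brownian uw unfolding independent_brownian_motions_def increment_def by blast
  have m: "(\<lambda>\<omega>. (\<omega>, increment u w \<omega>)) \<in> M \<rightarrow>\<^sub>M F u \<Otimes>\<^sub>M (borel \<Otimes>\<^sub>M borel)"
    using id_measurable_F increment_measurable[OF uw] by measurable
  interpret D: prob_space "distr M (F u) (\<lambda>\<omega>. \<omega>)" by (intro prob_space_distr id_measurable_F)
  interpret G: prob_space "distr M (borel \<Otimes>\<^sub>M borel) (increment u w)"
    by (intro prob_space_distr increment_measurable uw)
  show ?thesis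
    unfolding increment_pair_law[OF uw, symmetric]
  proof (rule pair_measure_eqI[symmetric])
    show "sigma_finite_measure (distr M (F u) (\<lambda>\<omega>. \<omega>))" ..
    show "sigma_finite_measure (distr M (borel \<Otimes>\<^sub>M borel) (increment u w))" ..
    fix A C assume "A \<in> sets (distr M (F u) (\<lambda>\<omega>. \<omega>))"
      and "C \<in> sets (distr M (borel \<Otimes>\<^sub>M borel) (increment u w))"
    then have A: "A \<in> sets (F u)" and C: "C \<in> sets (borel \<Otimes>\<^sub>M borel)" by auto
    let ?C = "increment u w -` C \<inter> space M"
    have "?C \<in> sets (vimage_algebra (space M) (increment u w) (borel \<Otimes>\<^sub>M borel))"
      using C by (rule in_vimage_algebra)
    with 1 A have p: "prob (A \<inter> ?C) = prob A * prob ?C"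
      by (simp add: indep_sets2_eq)
    have "A \<inter> space M = A" using sets.sets_into_space[OF A] by auto
    then have eq: "(\<lambda>\<omega>. (\<omega>, increment u w \<omega>)) -` (A \<times> C) \<inter> space M = A \<inter> ?C" by auto
    show "emeasure (distr M (F u) (\<lambda>\<omega>. \<omega>)) A * emeasure (distr M (borel \<Otimes>\<^sub>M borel) (increment u w)) C
      = emeasure (distr M (F u \<Otimes>\<^sub>M (borel \<Otimes>\<^sub>M borel)) (\<lambda>\<omega>. (\<omega>, increment u w \<omega>))) (A \<times> C)"
      using A C p \<open>A \<inter> space M = A\<close> increment_measurable[OF uw]
      by (subst (1 2 3) emeasure_distr)
        (auto simp: id_measurable_F m eq emeasure_eq_measure ennreal_mult)
  qed simp
qed

lemma nn_integral_increment:
  assumes uw: "0 \<le> u" "u < w" and h: "h \<in> borel_measurable (F u \<Otimes>\<^sub>M (borel \<Otimes>\<^sub>M borel))"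
  shows "(\<integral>\<^sup>+\<omega>. h (\<omega>, increment u w \<omega>) \<partial>M) = (\<integral>\<^sup>+\<omega>. \<integral>\<^sup>+g. h (\<omega>, g) \<partial>gauss_pair (w - u) \<partial>M)"
proof -
  interpret G: prob_space "gauss_pair (w - u)" using uw by (intro prob_space_gauss_pair) simp
  have m: "(\<lambda>\<omega>. (\<omega>, increment u w \<omega>)) \<in> M \<rightarrow>\<^sub>M F u \<Otimes>\<^sub>M (borel \<Otimes>\<^sub>M borel)"
    using id_measurable_F increment_measurable[OF uw] by measurable
  have h': "h \<in> borel_measurable (distr M (F u) (\<lambda>\<omega>. \<omega>) \<Otimes>\<^sub>M gauss_pair (w - u))"
    using h by (simp cong: measurable_cong_sets sets_pair_measure_cong)
  have "(\<integral>\<^sup>+\<omega>. h (\<omega>, increment u w \<omega>) \<partial>M)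
     = (\<integral>\<^sup>+x. h x \<partial>distr M (F u \<Otimes>\<^sub>M (borel \<Otimes>\<^sub>M borel)) (\<lambda>\<omega>. (\<omega>, increment u w \<omega>)))"
    using m h by (simp add: nn_integral_distr)
  also have "\<dots> = (\<integral>\<^sup>+\<omega>. \<integral>\<^sup>+g. h (\<omega>, g) \<partial>gauss_pair (w - u) \<partial>distr M (F u) (\<lambda>\<omega>. \<omega>))"
    unfolding indep_increment[OF uw] using h' by (simp add: G.nn_integral_fst)
  also have "\<dots> = (\<integral>\<^sup>+\<omega>. \<integral>\<^sup>+g. h (\<omega>, g) \<partial>gauss_pair (w - u) \<partial>M)"
    using h' G.borel_measurable_nn_integral_fst[OF h']
    by (intro nn_integral_distr) (auto intro: id_measurable_F)
  finally show ?thesis .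
qed

lemma expectation_increment:
  fixes h :: "'a \<times> (real \<times> real) \<Rightarrow> complex"
  assumes uw: "0 \<le> u" "u < w" and h: "h \<in> borel_measurable (F u \<Otimes>\<^sub>M (borel \<Otimes>\<^sub>M borel))"
    and bound: "\<And>\<omega> g. \<omega> \<in> space M \<Longrightarrow> norm (h (\<omega>, g)) \<le> C"
  shows "(\<integral>\<omega>. h (\<omega>, increment u w \<omega>) \<partial>M) = (\<integral>\<omega>. \<integral>g. h (\<omega>, g) \<partial>gauss_pair (w - u) \<partial>M)"
proof -
  interpret G: prob_space "gauss_pair (w - u)" using uw by (intro prob_space_gauss_pair) simp
  let ?D = "distr M (F u) (\<lambda>\<omega>. \<omega>)"
  interpret D: prob_space ?D by (intro prob_space_distr id_measurable_F)
  interpret P: pair_prob_space ?D "gauss_pair (w - u)" ..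
  have m: "(\<lambda>\<omega>. (\<omega>, increment u w \<omega>)) \<in> M \<rightarrow>\<^sub>M F u \<Otimes>\<^sub>M (borel \<Otimes>\<^sub>M borel)"
    using id_measurable_F increment_measurable[OF uw] by measurable
  have h': "h \<in> borel_measurable (?D \<Otimes>\<^sub>M gauss_pair (w - u))"
    using h by (simp cong: measurable_cong_sets sets_pair_measure_cong)
  have i: "integrable (?D \<Otimes>\<^sub>M gauss_pair (w - u)) h"
    using bound h' by (intro P.P.integrable_const_bound[where B=C]) (auto simp: space_pair_measure)
  have "(\<integral>\<omega>. h (\<omega>, increment u w \<omega>) \<partial>M)
     = (\<integral>x. h x \<partial>distr M (F u \<Otimes>\<^sub>M (borel \<Otimes>\<^sub>M borel)) (\<lambda>\<omega>. (\<omega>, increment u w \<omega>)))"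
    using m h by (simp add: integral_distr)
  also have "\<dots> = (\<integral>\<omega>. \<integral>g. h (\<omega>, g) \<partial>gauss_pair (w - u) \<partial>?D)"
    unfolding indep_increment[OF uw] using P.integral_fst'[OF i] by simp
  also have "\<dots> = (\<integral>\<omega>. \<integral>g. h (\<omega>, g) \<partial>gauss_pair (w - u) \<partial>M)"
    using G.borel_measurable_lebesgue_integral[of "curry h" ?D] h' 
    by (intro integral_distr) (auto intro: id_measurable_F simp: curry_def split_beta')
  finally show ?thesis .
qed


text \<open>The conditional characteristic function of a Gaussian increment. The factor \<open>Z\<close> will be the
exponential of the integral up to time \<open>u\<close>, or that exponential times the current value of the
integrand squared.\<close>

lemma expectation_cis_increment:
  fixes Z :: "'a \<Rightarrow> complex"
  assumes uw: "0 \<le> u" "u < w"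
    and Z [measurable]: "Z \<in> borel_measurable (F u)" and bound: "\<And>\<omega>. \<omega> \<in> space M \<Longrightarrow> norm (Z \<omega>) \<le> C"
    and x [measurable]: "x\<^sub>1 \<in> borel_measurable (F u)" "x\<^sub>2 \<in> borel_measurable (F u)"
  shows "(\<integral>\<omega>. Z \<omega> * cis (\<mu> * (x\<^sub>1 \<omega> * (B\<^sub>1 w \<omega> - B\<^sub>1 u \<omega>) + x\<^sub>2 \<omega> * (B\<^sub>2 w \<omega> - B\<^sub>2 u \<omega>))) \<partial>M)
    = (\<integral>\<omega>. Z \<omega> * exp (- (\<mu>\<^sup>2 / 2) * ((x\<^sub>1 \<omega>)\<^sup>2 + (x\<^sub>2 \<omega>)\<^sup>2) * (w - u)) \<partial>M)"
proof -
  let ?h = "\<lambda>p. Z (fst p) * cis (\<mu> * x\<^sub>1 (fst p) * fst (snd p) + \<mu> * x\<^sub>2 (fst p) * snd (snd p))"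
  have "(\<integral>\<omega>. ?h (\<omega>, increment u w \<omega>) \<partial>M) = (\<integral>\<omega>. \<integral>g. ?h (\<omega>, g) \<partial>gauss_pair (w - u) \<partial>M)"
    using uw bound by (intro expectation_increment[where C=C]) (auto simp: norm_mult)
  also have "\<dots> = (\<integral>\<omega>. Z \<omega> * exp (- ((\<mu> * x\<^sub>1 \<omega>)\<^sup>2 + (\<mu> * x\<^sub>2 \<omega>)\<^sup>2) * (w - u) / 2) \<partial>M)"
    using uw by (simp add: integral_gauss_pair_cis)
  finally show ?thesis
    by (simp add: increment_def algebra_simps power_mult_distrib add_divide_distrib diff_divide_distrib)
qed

lemma nn_expectation_square_increment:
  assumes uw: "0 \<le> u" "u < w" and x [measurable]: "S \<in> borel_measurable (F u)"
    "x\<^sub>1 \<in> borel_measurable (F u)" "x\<^sub>2 \<in> borel_measurable (F u)"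
  shows "(\<integral>\<^sup>+\<omega>. ennreal ((S \<omega> + x\<^sub>1 \<omega> * (B\<^sub>1 w \<omega> - B\<^sub>1 u \<omega>) + x\<^sub>2 \<omega> * (B\<^sub>2 w \<omega> - B\<^sub>2 u \<omega>))\<^sup>2) \<partial>M)
    = (\<integral>\<^sup>+\<omega>. ennreal ((S \<omega>)\<^sup>2) \<partial>M) + (\<integral>\<^sup>+\<omega>. ennreal ((x\<^sub>1 \<omega>)\<^sup>2 + (x\<^sub>2 \<omega>)\<^sup>2) \<partial>M) * ennreal (w - u)"
proof -
  note [measurable] = x[THEN measurable_F_M]
  let ?h = "\<lambda>p. ennreal ((S (fst p) + x\<^sub>1 (fst p) * fst (snd p) + x\<^sub>2 (fst p) * snd (snd p))\<^sup>2)"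
  have "(\<integral>\<^sup>+\<omega>. ?h (\<omega>, increment u w \<omega>) \<partial>M) = (\<integral>\<^sup>+\<omega>. \<integral>\<^sup>+g. ?h (\<omega>, g) \<partial>gauss_pair (w - u) \<partial>M)"
    by (rule nn_integral_increment[OF uw]) simp
  also have "\<dots> = (\<integral>\<^sup>+\<omega>. ennreal ((S \<omega>)\<^sup>2) + ennreal ((x\<^sub>1 \<omega>)\<^sup>2 + (x\<^sub>2 \<omega>)\<^sup>2) * ennreal (w - u) \<partial>M)"
    using uw by (simp add: nn_integral_gauss_pair_square ennreal_mult)
  also have "\<dots> = (\<integral>\<^sup>+\<omega>. ennreal ((S \<omega>)\<^sup>2) \<partial>M) + (\<integral>\<^sup>+\<omega>. ennreal ((x\<^sub>1 \<omega>)\<^sup>2 + (x\<^sub>2 \<omega>)\<^sup>2) * ennreal (w - u) \<partial>M)"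
    by (intro nn_integral_add) auto
  also have "(\<integral>\<^sup>+\<omega>. ennreal ((x\<^sub>1 \<omega>)\<^sup>2 + (x\<^sub>2 \<omega>)\<^sup>2) * ennreal (w - u) \<partial>M)
      = (\<integral>\<^sup>+\<omega>. ennreal ((x\<^sub>1 \<omega>)\<^sup>2 + (x\<^sub>2 \<omega>)\<^sup>2) \<partial>M) * ennreal (w - u)"
    by (intro nn_integral_multc) auto
  finally show ?thesis by (simp add: increment_def)
qed

end

section \<open>Stochastic integrals of step processes\<close>

text \<open>Identities that are additive over adjacent intervals need to be checked only on intervals whose
interior meets no partition point. This replaces common refinements of partitions.\<close>

lemma partition_induct [consumes 2, case_names step split]:
  fixes a b :: real
  assumes "finite P" "a < b"
    and step: "\<And>u w. a \<le> u \<Longrightarrow> u < w \<Longrightarrow> w \<le> b \<Longrightarrow> {u<..<w} \<inter> P = {} \<Longrightarrow> Q u w"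
    and split: "\<And>u v w. a \<le> u \<Longrightarrow> u < v \<Longrightarrow> v < w \<Longrightarrow> w \<le> b \<Longrightarrow> Q u v \<Longrightarrow> Q v w \<Longrightarrow> Q u w"
  shows "Q a b"
proof -
  have "a \<le> u \<Longrightarrow> u < w \<Longrightarrow> w \<le> b \<Longrightarrow> Q u w" for u w
  proof (induction "card ({u<..<w} \<inter> P)" arbitrary: u w rule: less_induct)
    case less
    show ?case
    proof (cases "{u<..<w} \<inter> P = {}")
      case True
      with less.prems step show ?thesis by blast
    next
      case False
      then obtain p where p: "p \<in> P" "u < p" "p < w" by auto
      have "card ({u<..<p} \<inter> P) < card ({u<..<w} \<inter> P)" "card ({p<..<w} \<inter> P) < card ({u<..<w} \<inter> P)"
        using p \<open>finite P\<close> by (auto intro!: psubset_card_mono)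
      with less p have "Q u p" "Q p w" by auto
      with split p less.prems show ?thesis by blast
    qed
  qed
  then show ?thesis using \<open>a < b\<close> by simp
qed

lemma exp_quadratic_bound:
  fixes y :: real
  assumes "\<bar>y\<bar> \<le> 1"
  shows "\<bar>exp y - 1 - y\<bar> \<le> y\<^sup>2"
proof -
  have l: "1 + y \<le> exp y" by (rule exp_ge_add_one_self)
  have "exp y \<le> 1 + y + y\<^sup>2"
  proof (cases "0 \<le> y")
    case True
    with assms exp_bound[of y] show ?thesis by simp
  next
    case False
    have "1 - y \<le> exp (- y)" using exp_ge_add_one_self[of "-y"] by simp
    then have "exp y \<le> inverse (1 - y)"
      using False by (simp add: exp_minus field_simps)
    also have "\<dots> \<le> 1 + y + y\<^sup>2"
    proof -
      have "1 \<le> (1 + y + y\<^sup>2) * (1 - y)"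
        using False mult_nonneg_nonneg[of "-y" "y\<^sup>2"] by (simp add: algebra_simps power2_eq_square)
      then show ?thesis using False by (simp add: field_simps)
    qed
    finally show ?thesis .
  qed
  with l zero_le_power2[of y] show ?thesis by linarith
qed

lemma has_vector_derivative_quadratic:
  fixes f :: "real \<Rightarrow> 'a::real_normed_vector"
  assumes d: "0 < d" and bound: "\<And>h. \<bar>h\<bar> \<le> d \<Longrightarrow> norm (f (s + h) - f s - h *\<^sub>R D) \<le> K * h\<^sup>2"
  shows "(f has_vector_derivative D) (at s)"
  unfolding has_vector_derivative_def has_derivative_iff_norm
proof (intro conjI bounded_linear_scaleR_left)
  have "((\<lambda>y. K * \<bar>y - s\<bar>) \<longlongrightarrow> K * \<bar>s - s\<bar>) (at s)" by (intro tendsto_intros)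
  then have K: "((\<lambda>y. K * \<bar>y - s\<bar>) \<longlongrightarrow> 0) (at s)" by simp
  have "norm (f y - f s - (y - s) *\<^sub>R D) / norm (y - s) \<le> K * \<bar>y - s\<bar>" if "y \<noteq> s" "dist y s < d" for y
    using bound[of "y - s"] that
    by (auto simp: divide_le_eq power2_eq_square dist_real_def abs_mult_self_eq mult.assoc)
  then have "\<forall>\<^sub>F y in at s. norm (f y - f s - (y - s) *\<^sub>R D) / norm (y - s) \<le> K * \<bar>y - s\<bar>"
    using d unfolding eventually_at by (intro exI[of _ d]) auto
  then show "((\<lambda>y. norm (f y - f s - (y - s) *\<^sub>R D) / norm (y - s)) \<longlongrightarrow> 0) (at s)"
    by (intro tendsto_sandwich[OF _ _ tendsto_const K]) auto
qed

text \<open>Differentiation under the expectation: as \<open>c\<close> is bounded, the second order remainder of the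
exponential is \<open>O(h\<^sup>2)\<close> uniformly in \<open>\<omega>\<close>.\<close>

lemma (in prob_space) expectation_exp_derivative:
  fixes Z :: "'a \<Rightarrow> complex" and c :: "'a \<Rightarrow> real"
  assumes [measurable]: "Z \<in> borel_measurable M" "c \<in> borel_measurable M"
    and Z: "\<And>\<omega>. \<omega> \<in> space M \<Longrightarrow> norm (Z \<omega>) \<le> 1" and c: "\<And>\<omega>. \<omega> \<in> space M \<Longrightarrow> \<bar>c \<omega>\<bar> \<le> K"
  shows "((\<lambda>s. \<integral>\<omega>. Z \<omega> * exp (- c \<omega> * s) \<partial>M) has_vector_derivative
           (\<integral>\<omega>. Z \<omega> * (- c \<omega>) * exp (- c \<omega> * s) \<partial>M)) (at s)"
proof -
  define k where "k = max K 1"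
  have k: "1 \<le> k" and ck: "\<And>\<omega>. \<omega> \<in> space M \<Longrightarrow> \<bar>c \<omega>\<bar> \<le> k" using c by (auto simp: k_def max_def intro: order_trans)
  have e: "exp (- c \<omega> * r) \<le> exp (k * \<bar>r\<bar>)" if "\<omega> \<in> space M" for \<omega> r
  proof -
    have "- c \<omega> * r \<le> \<bar>- c \<omega> * r\<bar>" by simp
    also have "\<dots> \<le> k * \<bar>r\<bar>" using ck[OF that] by (simp add: abs_mult mult_right_mono)
    finally show ?thesis by simp
  qed
  have i1: "integrable M (\<lambda>\<omega>. Z \<omega> * exp (- c \<omega> * r))" for r
    using mult_mono[OF Z e[of _ r]]
    by (intro integrable_const_bound[where B="1 * exp (k * \<bar>r\<bar>)"]) (auto simp: norm_mult simp del: of_real_exp)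
  have i2: "integrable M (\<lambda>\<omega>. Z \<omega> * (- c \<omega>) * exp (- c \<omega> * r))" for r
    using mult_mono[OF mult_mono[OF Z ck] e[of _ r]] k
    by (intro integrable_const_bound[where B="1 * k * exp (k * \<bar>r\<bar>)"]) (auto simp: norm_mult simp del: of_real_exp)
  show ?thesis
  proof (rule has_vector_derivative_quadratic[where d = "1 / k" and K = "exp (k * \<bar>s\<bar>) * k\<^sup>2"])
    show "0 < 1 / k" using k by simp
    fix h :: real assume h: "\<bar>h\<bar> \<le> 1 / k"
    \<comment> \<open>the remainder of the first order expansion of the exponential at \<open>s\<close>\<close>
    let ?D = "\<lambda>\<omega>. Z \<omega> * complex_of_real (exp (- c \<omega> * s) * (exp (- c \<omega> * h) - 1 - (- c \<omega> * h)))"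
    have "(\<integral>\<omega>. Z \<omega> * exp (- c \<omega> * (s + h)) \<partial>M) - (\<integral>\<omega>. Z \<omega> * exp (- c \<omega> * s) \<partial>M)
        - h *\<^sub>R (\<integral>\<omega>. Z \<omega> * (- c \<omega>) * exp (- c \<omega> * s) \<partial>M)
      = (\<integral>\<omega>. Z \<omega> * exp (- c \<omega> * (s + h)) - Z \<omega> * exp (- c \<omega> * s)
        - h *\<^sub>R (Z \<omega> * (- c \<omega>) * exp (- c \<omega> * s)) \<partial>M)"
      using i1 i2 by simp
    also have "\<dots> = (\<integral>\<omega>. ?D \<omega> \<partial>M)"
    proof (intro Bochner_Integration.integral_cong refl)
      fix \<omega>
      have "exp (- c \<omega> * (s + h)) = exp (- c \<omega> * s) * exp (- c \<omega> * h)"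
        by (simp add: exp_add[symmetric] distrib_left)
      then show "Z \<omega> * exp (- c \<omega> * (s + h)) - Z \<omega> * exp (- c \<omega> * s)
          - h *\<^sub>R (Z \<omega> * (- c \<omega>) * exp (- c \<omega> * s)) = ?D \<omega>"
        by (simp add: scaleR_conv_of_real algebra_simps)
    qed
    also have "norm \<dots> \<le> exp (k * \<bar>s\<bar>) * k\<^sup>2 * h\<^sup>2"
    proof (rule order_trans[OF integral_norm_bound])
      have "norm (?D \<omega>) \<le> exp (k * \<bar>s\<bar>) * k\<^sup>2 * h\<^sup>2" if w: "\<omega> \<in> space M" for \<omega>
      proof -
        have ch: "\<bar>c \<omega> * h\<bar> \<le> k * \<bar>h\<bar>" using ck[OF w] by (simp add: abs_mult mult_right_mono)
        also have "\<dots> \<le> 1" using h k by (simp add: field_simps)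
        finally have "\<bar>exp (- c \<omega> * h) - 1 - (- c \<omega> * h)\<bar> \<le> (- c \<omega> * h)\<^sup>2"
          by (intro exp_quadratic_bound) simp
        also have "\<dots> \<le> (k * \<bar>h\<bar>)\<^sup>2"
          using power_mono[OF ch, of 2] by (simp add: power_mult_distrib)
        finally have "\<bar>exp (- c \<omega> * h) - 1 - (- c \<omega> * h)\<bar> \<le> k\<^sup>2 * h\<^sup>2" by (simp add: power_mult_distrib)
        then have "norm (Z \<omega>) * (exp (- c \<omega> * s) * \<bar>exp (- c \<omega> * h) - 1 - (- c \<omega> * h)\<bar>)
            \<le> 1 * (exp (k * \<bar>s\<bar>) * (k\<^sup>2 * h\<^sup>2))"
          using Z[OF w] e[OF w, of s] by (intro mult_mono) auto
        then show ?thesis by (simp add: norm_mult abs_mult mult.assoc del: of_real_mult of_real_diff of_real_exp flip: of_real_mult)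
      qed
      then show "(\<integral>\<omega>. norm (?D \<omega>) \<partial>M) \<le> exp (k * \<bar>s\<bar>) * k\<^sup>2 * h\<^sup>2"
        by (intro integral_le_const integrable_const_bound[where B="exp (k * \<bar>s\<bar>) * k\<^sup>2 * h\<^sup>2"]) auto
    qed
    finally show "norm ((\<integral>\<omega>. Z \<omega> * exp (- c \<omega> * (s + h)) \<partial>M) - (\<integral>\<omega>. Z \<omega> * exp (- c \<omega> * s) \<partial>M)
        - h *\<^sub>R (\<integral>\<omega>. Z \<omega> * (- c \<omega>) * exp (- c \<omega> * s) \<partial>M)) \<le> exp (k * \<bar>s\<bar>) * k\<^sup>2 * h\<^sup>2" .
  qed
qed

context brownian_pair
begin

text \<open>The process \<open>S\<close> is the integral of the step processes \<open>x\<^sub>1\<close>, \<open>x\<^sub>2\<close> against \<open>B\<^sub>1\<close>, \<open>B\<^sub>2\<close>. It is described by its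
increments and not by a formula for a particular partition, so that the difference of two such
integrals belongs to the union of the two sets of break points. Break points are allowed at both ends
of the interval \<open>[u, w]\<close>: the integrands are constant on \<open>[u, w)\<close>, as they are right-continuous.\<close>

definition simple_integral ::
  "real set \<Rightarrow> (real \<Rightarrow> 'a \<Rightarrow> real) \<Rightarrow> (real \<Rightarrow> 'a \<Rightarrow> real) \<Rightarrow> (real \<Rightarrow> 'a \<Rightarrow> real) \<Rightarrow> bool" where
  "simple_integral P S x\<^sub>1 x\<^sub>2 \<longleftrightarrow> finite P \<and>
     (\<forall>v\<ge>0. S v \<in> borel_measurable (F v) \<and> x\<^sub>1 v \<in> borel_measurable (F v) \<and> x\<^sub>2 v \<in> borel_measurable (F v)) \<and>
     (\<exists>C. \<forall>v. \<forall>\<omega>\<in>space M. \<bar>x\<^sub>1 v \<omega>\<bar> \<le> C \<and> \<bar>x\<^sub>2 v \<omega>\<bar> \<le> C) \<and>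
     (\<forall>\<omega>\<in>space M. S 0 \<omega> = 0) \<and>
     (\<forall>u w. 0 \<le> u \<longrightarrow> u < w \<longrightarrow> {u<..<w} \<inter> P = {} \<longrightarrow> (\<forall>\<omega>\<in>space M.
        S w \<omega> = S u \<omega> + x\<^sub>1 u \<omega> * (B\<^sub>1 w \<omega> - B\<^sub>1 u \<omega>) + x\<^sub>2 u \<omega> * (B\<^sub>2 w \<omega> - B\<^sub>2 u \<omega>) \<and>
        (\<forall>v\<in>{u..<w}. x\<^sub>1 v \<omega> = x\<^sub>1 u \<omega> \<and> x\<^sub>2 v \<omega> = x\<^sub>2 u \<omega>)))"

lemma simple_integralD:
  assumes "simple_integral P S x\<^sub>1 x\<^sub>2"
  shows "finite P"
    and "0 \<le> v \<Longrightarrow> S v \<in> borel_measurable (F v)"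
    and "0 \<le> v \<Longrightarrow> x\<^sub>1 v \<in> borel_measurable (F v)"
    and "0 \<le> v \<Longrightarrow> x\<^sub>2 v \<in> borel_measurable (F v)"
    and "\<omega> \<in> space M \<Longrightarrow> S 0 \<omega> = 0"
    and "0 \<le> u \<Longrightarrow> u < w \<Longrightarrow> {u<..<w} \<inter> P = {} \<Longrightarrow> \<omega> \<in> space M \<Longrightarrow>
      S w \<omega> = S u \<omega> + x\<^sub>1 u \<omega> * (B\<^sub>1 w \<omega> - B\<^sub>1 u \<omega>) + x\<^sub>2 u \<omega> * (B\<^sub>2 w \<omega> - B\<^sub>2 u \<omega>)"
    and "0 \<le> u \<Longrightarrow> {u<..<w} \<inter> P = {} \<Longrightarrow> \<omega> \<in> space M \<Longrightarrow> v \<in> {u..<w} \<Longrightarrow> x\<^sub>1 v \<omega> = x\<^sub>1 u \<omega>"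
    and "0 \<le> u \<Longrightarrow> {u<..<w} \<inter> P = {} \<Longrightarrow> \<omega> \<in> space M \<Longrightarrow> v \<in> {u..<w} \<Longrightarrow> x\<^sub>2 v \<omega> = x\<^sub>2 u \<omega>"
proof -
  note * = assms[unfolded simple_integral_def]
  show "finite P"
    "0 \<le> v \<Longrightarrow> S v \<in> borel_measurable (F v)"
    "0 \<le> v \<Longrightarrow> x\<^sub>1 v \<in> borel_measurable (F v)"
    "0 \<le> v \<Longrightarrow> x\<^sub>2 v \<in> borel_measurable (F v)"
    "\<omega> \<in> space M \<Longrightarrow> S 0 \<omega> = 0"
    using * by blast+
  show "0 \<le> u \<Longrightarrow> u < w \<Longrightarrow> {u<..<w} \<inter> P = {} \<Longrightarrow> \<omega> \<in> space M \<Longrightarrow>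
      S w \<omega> = S u \<omega> + x\<^sub>1 u \<omega> * (B\<^sub>1 w \<omega> - B\<^sub>1 u \<omega>) + x\<^sub>2 u \<omega> * (B\<^sub>2 w \<omega> - B\<^sub>2 u \<omega>)"
    using * by blast
  show "0 \<le> u \<Longrightarrow> {u<..<w} \<inter> P = {} \<Longrightarrow> \<omega> \<in> space M \<Longrightarrow> v \<in> {u..<w} \<Longrightarrow> x\<^sub>1 v \<omega> = x\<^sub>1 u \<omega>"
    "0 \<le> u \<Longrightarrow> {u<..<w} \<inter> P = {} \<Longrightarrow> \<omega> \<in> space M \<Longrightarrow> v \<in> {u..<w} \<Longrightarrow> x\<^sub>2 v \<omega> = x\<^sub>2 u \<omega>"
    using * by (meson atLeastLessThan_iff order_le_less_trans)+
qed

lemma simple_integral_diff: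
  assumes "simple_integral P S x\<^sub>1 x\<^sub>2" "simple_integral Q R y\<^sub>1 y\<^sub>2"
  shows "simple_integral (P \<union> Q) (\<lambda>v \<omega>. S v \<omega> - R v \<omega>) (\<lambda>v \<omega>. x\<^sub>1 v \<omega> - y\<^sub>1 v \<omega>) (\<lambda>v \<omega>. x\<^sub>2 v \<omega> - y\<^sub>2 v \<omega>)"
proof -
  obtain C D where C: "\<forall>v. \<forall>\<omega>\<in>space M. \<bar>x\<^sub>1 v \<omega>\<bar> \<le> C \<and> \<bar>x\<^sub>2 v \<omega>\<bar> \<le> C"
    and D: "\<forall>v. \<forall>\<omega>\<in>space M. \<bar>y\<^sub>1 v \<omega>\<bar> \<le> D \<and> \<bar>y\<^sub>2 v \<omega>\<bar> \<le> D"
    using assms unfolding simple_integral_def by auto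
  have "\<bar>x - y\<bar> \<le> C + D" if "\<bar>x\<bar> \<le> C" "\<bar>y\<bar> \<le> D" for x y :: real
    using that by linarith
  then have b: "\<exists>K. \<forall>v. \<forall>\<omega>\<in>space M. \<bar>x\<^sub>1 v \<omega> - y\<^sub>1 v \<omega>\<bar> \<le> K \<and> \<bar>x\<^sub>2 v \<omega> - y\<^sub>2 v \<omega>\<bar> \<le> K"
    using C D by (intro exI[of _ "C + D"]) blast
  have disj: "{u<..<w} \<inter> P = {}" "{u<..<w} \<inter> Q = {}" if "{u<..<w} \<inter> (P \<union> Q) = {}" for u w
    using that by auto
  note S = simple_integralD[OF assms(1)] and R = simple_integralD[OF assms(2)]
  show ?thesis
    unfolding simple_integral_def
  proof (intro conjI allI impI ballI)
    show "finite (P \<union> Q)" using S(1) R(1) by simp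
    fix v :: real assume "0 \<le> v"
    then show "(\<lambda>\<omega>. S v \<omega> - R v \<omega>) \<in> borel_measurable (F v)" "(\<lambda>\<omega>. x\<^sub>1 v \<omega> - y\<^sub>1 v \<omega>) \<in> borel_measurable (F v)"
      "(\<lambda>\<omega>. x\<^sub>2 v \<omega> - y\<^sub>2 v \<omega>) \<in> borel_measurable (F v)"
      using S(2-4) R(2-4) by (blast intro: borel_measurable_diff)+
  next
    show "\<exists>K. \<forall>v. \<forall>\<omega>\<in>space M. \<bar>x\<^sub>1 v \<omega> - y\<^sub>1 v \<omega>\<bar> \<le> K \<and> \<bar>x\<^sub>2 v \<omega> - y\<^sub>2 v \<omega>\<bar> \<le> K" by (rule b)
    show "S 0 \<omega> - R 0 \<omega> = 0" if "\<omega> \<in> space M" for \<omega> using S(5) R(5) that by simp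
  next
    fix u w :: real and \<omega> assume uw: "0 \<le> u" "u < w" "{u<..<w} \<inter> (P \<union> Q) = {}" and \<omega>: "\<omega> \<in> space M"
    note d = disj[OF uw(3)]
    show "S w \<omega> - R w \<omega> = S u \<omega> - R u \<omega> + (x\<^sub>1 u \<omega> - y\<^sub>1 u \<omega>) * (B\<^sub>1 w \<omega> - B\<^sub>1 u \<omega>)
        + (x\<^sub>2 u \<omega> - y\<^sub>2 u \<omega>) * (B\<^sub>2 w \<omega> - B\<^sub>2 u \<omega>)"
      using S(6)[OF uw(1,2) d(1) \<omega>] R(6)[OF uw(1,2) d(2) \<omega>] by (simp add: algebra_simps)
    fix v assume v: "v \<in> {u..<w}"
    show "x\<^sub>1 v \<omega> - y\<^sub>1 v \<omega> = x\<^sub>1 u \<omega> - y\<^sub>1 u \<omega>"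
      using S(7)[OF uw(1) d(1) \<omega> v] R(7)[OF uw(1) d(2) \<omega> v] by simp
    show "x\<^sub>2 v \<omega> - y\<^sub>2 v \<omega> = x\<^sub>2 u \<omega> - y\<^sub>2 u \<omega>"
      using S(8)[OF uw(1) d(1) \<omega> v] R(8)[OF uw(1) d(2) \<omega> v] by simp
  qed
qed

text \<open>On an interval without interior break points the increment is Gaussian with conditional mean zero and
conditional variance \<open>(x\<^sub>1\<^sup>2 + x\<^sub>2\<^sup>2) (w - u)\<close>; the pieces add up. Measurability of the integrand
over time is part of the induction because the integral on the right is split.\<close>

theorem simple_integral_isometry:
  assumes S: "simple_integral P S x\<^sub>1 x\<^sub>2" and b: "0 \<le> b"
  defines "e \<equiv> \<lambda>v. \<integral>\<^sup>+\<omega>. ennreal ((x\<^sub>1 v \<omega>)\<^sup>2 + (x\<^sub>2 v \<omega>)\<^sup>2) \<partial>M"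
  shows "(\<integral>\<^sup>+\<omega>. ennreal ((S b \<omega>)\<^sup>2) \<partial>M) = (\<integral>\<^sup>+v. e v * indicator {0..<b} v \<partial>lborel)"
proof -
  have "(\<integral>\<^sup>+\<omega>. ennreal ((S 0 \<omega>)\<^sup>2) \<partial>M) = (\<integral>\<^sup>+\<omega>. 0 \<partial>M)"
    using simple_integralD(5)[OF S] by (intro nn_integral_cong) simp
  then have S0: "(\<integral>\<^sup>+\<omega>. ennreal ((S 0 \<omega>)\<^sup>2) \<partial>M) = 0" by simp
  show ?thesis
  proof (cases "b = 0")
    case True
    then show ?thesis using S0 by simp
  next
    case False
    then have "0 < b" using b by simp
    note S = simple_integralD[OF S]
    have "(\<lambda>v. e v * indicator {0..<b} v) \<in> borel_measurable lborel \<and>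
      (\<integral>\<^sup>+\<omega>. ennreal ((S b \<omega>)\<^sup>2) \<partial>M) = (\<integral>\<^sup>+\<omega>. ennreal ((S 0 \<omega>)\<^sup>2) \<partial>M) + (\<integral>\<^sup>+v. e v * indicator {0..<b} v \<partial>lborel)"
      (is "?m 0 b \<and> ?i 0 b")
      using \<open>finite P\<close> \<open>0 < b\<close>
    proof (induction rule: partition_induct)
      fix u w :: real assume uw: "0 \<le> u" "u < w" "{u<..<w} \<inter> P = {}"
      have "e v = e u" if "v \<in> {u..<w}" for v
        unfolding e_def by (intro nn_integral_cong) (simp add: S(7)[OF uw(1,3) _ that] S(8)[OF uw(1,3) _ that])
      then have e: "(\<lambda>v. e v * indicator {u..<w} v) = (\<lambda>v. e u * indicator {u..<w} v)"
        by (intro ext) (metis indicator_simps(2) mult_zero_right)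
      have "(\<integral>\<^sup>+\<omega>. ennreal ((S w \<omega>)\<^sup>2) \<partial>M) = (\<integral>\<^sup>+\<omega>. ennreal ((S u \<omega>)\<^sup>2) \<partial>M) + e u * ennreal (w - u)"
        unfolding e_def nn_expectation_square_increment[OF uw(1,2) S(2-4)[OF uw(1)], symmetric]
        by (intro nn_integral_cong) (simp add: S(6)[OF uw])
      then show "?m u w \<and> ?i u w"
        unfolding e using uw by (simp add: nn_integral_cmult_indicator)
    next
      fix u v w :: real assume *: "u < v" "v < w" "?m u v \<and> ?i u v" "?m v w \<and> ?i v w"
      have e: "(\<lambda>s. e s * indicator {u..<w} s) = (\<lambda>s. e s * indicator {u..<v} s + e s * indicator {v..<w} s)"
        using *(1,2) by (auto simp: fun_eq_iff indicator_def)
      show "?m u w \<and> ?i u w"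
        unfolding e using conjunct1[OF *(3)] conjunct1[OF *(4)] conjunct2[OF *(3)] conjunct2[OF *(4)]
        by (simp only: nn_integral_add borel_measurable_add add.assoc simp_thms)
    qed
    then show ?thesis unfolding S0 by simp
  qed
qed

text \<open>Ito's formula for \<open>exp (\<i> \<mu> S)\<close>, in expectation. On an interval without interior break points,
\<open>E exp (\<i> \<mu> S(v)) = E exp (\<i> \<mu> S(u) - c (v - u))\<close> with \<open>c = (\<mu>\<^sup>2/2) (x\<^sub>1\<^sup>2 + x\<^sub>2\<^sup>2)\<close> frozen at time \<open>u\<close>.
Differentiating in \<open>v\<close> brings down the factor \<open>- c\<close>, and reading the conditional characteristic function
backwards turns the result into an expectation at time \<open>v\<close>.\<close>

theorem simple_integral_exponential:
  assumes S: "simple_integral P S x\<^sub>1 x\<^sub>2" and ab: "0 \<le> a" "a < b"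
  shows "((\<lambda>v. - (\<mu>\<^sup>2 / 2) *\<^sub>R (\<integral>\<omega>. ((x\<^sub>1 v \<omega>)\<^sup>2 + (x\<^sub>2 v \<omega>)\<^sup>2) *\<^sub>R cis (\<mu> * S v \<omega>) \<partial>M)) has_integral
    ((\<integral>\<omega>. cis (\<mu> * S b \<omega>) \<partial>M) - (\<integral>\<omega>. cis (\<mu> * S a \<omega>) \<partial>M))) {a..b}"
    (is "(?G has_integral (?\<phi> b - ?\<phi> a)) {a..b}")
proof -
  obtain C where C: "\<And>v \<omega>. \<omega> \<in> space M \<Longrightarrow> \<bar>x\<^sub>1 v \<omega>\<bar> \<le> C \<and> \<bar>x\<^sub>2 v \<omega>\<bar> \<le> C"
    using S unfolding simple_integral_def by auto
  note S = simple_integralD[OF S]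
  show ?thesis
    using \<open>finite P\<close> \<open>a < b\<close>
  proof (induction rule: partition_induct)
    fix u w :: real assume "a \<le> u" and uw': "u < w" "{u<..<w} \<inter> P = {}"
    with ab have uw: "0 \<le> u" "u < w" "{u<..<w} \<inter> P = {}" by auto
    note [measurable] = S(2-4)[OF uw(1)] S(2-4)[OF uw(1), THEN measurable_F_M]
    define c where "c \<omega> = \<mu>\<^sup>2 / 2 * ((x\<^sub>1 u \<omega>)\<^sup>2 + (x\<^sub>2 u \<omega>)\<^sup>2)" for \<omega>
    have [measurable]: "c \<in> borel_measurable (F u)" "c \<in> borel_measurable M" unfolding c_def by measurable
    have sq: "(x\<^sub>1 u \<omega>)\<^sup>2 + (x\<^sub>2 u \<omega>)\<^sup>2 \<le> C\<^sup>2 + C\<^sup>2" if "\<omega> \<in> space M" for \<omega>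
      using C[OF that, of u] power_mono[of "\<bar>x\<^sub>1 u \<omega>\<bar>" C 2] power_mono[of "\<bar>x\<^sub>2 u \<omega>\<bar>" C 2] by auto
    have c: "\<bar>c \<omega>\<bar> \<le> \<mu>\<^sup>2 / 2 * (C\<^sup>2 + C\<^sup>2)" if "\<omega> \<in> space M" for \<omega>
      unfolding c_def abs_mult using sq[OF that] by (intro mult_mono) auto
    have inc: "S v \<omega> = S u \<omega> + (x\<^sub>1 u \<omega> * (B\<^sub>1 v \<omega> - B\<^sub>1 u \<omega>) + x\<^sub>2 u \<omega> * (B\<^sub>2 v \<omega> - B\<^sub>2 u \<omega>))"
      if "u < v" "v \<le> w" "\<omega> \<in> space M" for v \<omega>
    proof -
      have "{u<..<v} \<subseteq> {u<..<w}" using that by auto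
      then have "{u<..<v} \<inter> P = {}" using uw(3) by blast
      with S(6)[OF uw(1) \<open>u < v\<close> this \<open>\<omega> \<in> space M\<close>] show ?thesis by simp
    qed
    \<comment> \<open>the expectation with the noise on \<open>[u, v]\<close> integrated out: smooth in \<open>v\<close>, equal to \<open>E exp (\<i> \<mu> S(v))\<close> on \<open>[u, w]\<close>\<close>
    let ?f = "\<lambda>v. \<integral>\<omega>. cis (\<mu> * S u \<omega>) * exp (- c \<omega> * (v - u)) \<partial>M"
    let ?f' = "\<lambda>v. \<integral>\<omega>. cis (\<mu> * S u \<omega>) * (- c \<omega>) * exp (- c \<omega> * (v - u)) \<partial>M"
    have f: "?f v = ?\<phi> v" if v: "u \<le> v" "v \<le> w" for v
    proof (cases "u = v")
      case False
      then have uv: "u < v" using v by simp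
      have "?f v = (\<integral>\<omega>. cis (\<mu> * S u \<omega>) * cis (\<mu> * (x\<^sub>1 u \<omega> * (B\<^sub>1 v \<omega> - B\<^sub>1 u \<omega>) + x\<^sub>2 u \<omega> * (B\<^sub>2 v \<omega> - B\<^sub>2 u \<omega>))) \<partial>M)"
        by (subst expectation_cis_increment[OF uw(1) uv, where C=1]) (auto simp: c_def)
      also have "\<dots> = ?\<phi> v"
        using uv v by (intro Bochner_Integration.integral_cong refl) (simp add: inc cis_mult ring_distribs)
      finally show ?thesis .
    qed simp
    have f': "?f' v = ?G v" if v: "u < v" "v < w" for v
    proof -
      have x: "x\<^sub>1 v \<omega> = x\<^sub>1 u \<omega>" "x\<^sub>2 v \<omega> = x\<^sub>2 u \<omega>" if "\<omega> \<in> space M" for \<omega>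
        using S(7)[OF uw(1,3) that, of v] S(8)[OF uw(1,3) that, of v] v by auto
      have "?f' v = (\<integral>\<omega>. (cis (\<mu> * S u \<omega>) * (- c \<omega>)) * cis (\<mu> * (x\<^sub>1 u \<omega> * (B\<^sub>1 v \<omega> - B\<^sub>1 u \<omega>) + x\<^sub>2 u \<omega> * (B\<^sub>2 v \<omega> - B\<^sub>2 u \<omega>))) \<partial>M)"
      proof (subst expectation_cis_increment[OF uw(1) v(1), where C="\<mu>\<^sup>2 / 2 * (C\<^sup>2 + C\<^sup>2)"])
        show "norm (cis (\<mu> * S u \<omega>) * (- c \<omega>)) \<le> \<mu>\<^sup>2 / 2 * (C\<^sup>2 + C\<^sup>2)" if "\<omega> \<in> space M" for \<omega>
          using c[OF that] by (simp add: norm_mult)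
      qed (auto simp: c_def)
      also have "\<dots> = (\<integral>\<omega>. - (\<mu>\<^sup>2 / 2) *\<^sub>R (((x\<^sub>1 v \<omega>)\<^sup>2 + (x\<^sub>2 v \<omega>)\<^sup>2) *\<^sub>R cis (\<mu> * S v \<omega>)) \<partial>M)"
        using v by (intro Bochner_Integration.integral_cong refl)
          (simp add: inc x c_def cis_mult[symmetric] distrib_left scaleR_conv_of_real, simp add: field_simps)
      also have "\<dots> = ?G v"
        by (rule integral_scaleR_right)
      finally show ?thesis .
    qed
    have d: "(?f has_vector_derivative ?f' v) (at v)" for v
      using vector_diff_chain_at[of "\<lambda>v. v - u" 1 v "\<lambda>s. \<integral>\<omega>. cis (\<mu> * S u \<omega>) * exp (- c \<omega> * s) \<partial>M",
          OF _ expectation_exp_derivative[where K="\<mu>\<^sup>2 / 2 * (C\<^sup>2 + C\<^sup>2)"]] c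
      by (auto simp: comp_def has_vector_derivative_diff_const intro!: derivative_eq_intros)
    have "(?G has_integral (?f w - ?f u)) {u..w}"
    proof (rule fundamental_theorem_of_calculus_interior)
      show "u \<le> w" using uw by simp
      show "continuous_on {u..w} ?f"
        using d by (intro continuous_at_imp_continuous_on) (blast intro: has_vector_derivative_continuous)
      show "(?f has_vector_derivative ?G v) (at v)" if "v \<in> {u<..<w}" for v
        using d[of v] f'[of v] that by simp
    qed
    then show "(?G has_integral (?\<phi> w - ?\<phi> u)) {u..w}"
      using f[of w] f[of u] uw by simp
  next
    fix u v w assume "u < v" "v < w" "(?G has_integral (?\<phi> v - ?\<phi> u)) {u..v}" "(?G has_integral (?\<phi> w - ?\<phi> v)) {v..w}"
    then show "(?G has_integral (?\<phi> w - ?\<phi> u)) {u..w}"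
      using has_integral_combine[of u v w ?G] by fastforce
  qed
qed

end

section \<open>Elementary processes as step processes\<close>

definition stopped_integral ::
  "(real \<Rightarrow> 'a \<Rightarrow> real) \<Rightarrow> nat \<Rightarrow> (nat \<Rightarrow> real) \<Rightarrow> (nat \<Rightarrow> 'a \<Rightarrow> real) \<Rightarrow> real \<Rightarrow> 'a \<Rightarrow> real" where
  "stopped_integral B n \<tau> \<xi> v \<omega>
     = (\<Sum>k<n. \<xi> k \<omega> * (B (min (\<tau> (Suc k)) v) \<omega> - B (min (\<tau> k) v) \<omega>))"

lemma elementary_times:
  assumes "elementary F T n \<tau> \<xi>" "k \<le> n"
  shows "0 \<le> \<tau> k" "\<tau> k \<le> T"
proof -
  have mono: "\<tau> i \<le> \<tau> j" if "i \<le> j" "j \<le> n" for i j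
    using that
  proof (induction j)
    case (Suc j)
    then show ?case
      using assms(1) unfolding elementary_def
      by (cases "i = Suc j") (auto intro: order_trans[of "\<tau> i" "\<tau> j"])
  qed simp
  from mono[of 0 k] mono[of k n] assms show "0 \<le> \<tau> k" "\<tau> k \<le> T"
    by (auto simp: elementary_def)
qed

lemma stopped_integral_final:
  assumes "elementary F T n \<tau> \<xi>"
  shows "stopped_integral B n \<tau> \<xi> T = elementary_integral B n \<tau> \<xi>"
  unfolding stopped_integral_def elementary_integral_def
  using elementary_times(2)[OF assms] by (intro ext sum.cong refl) (simp add: min_def)

lemma stopped_integral_0:
  assumes "elementary F T n \<tau> \<xi>"
  shows "stopped_integral B n \<tau> \<xi> 0 \<omega> = 0"
  unfolding stopped_integral_def
proof (intro sum.neutral ballI)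
  fix k assume "k \<in> {..<n}"
  then have "min (\<tau> k) 0 = 0" "min (\<tau> (Suc k)) 0 = 0"
    using elementary_times(1)[OF assms, of k] elementary_times(1)[OF assms, of "Suc k"] by auto
  then show "\<xi> k \<omega> * (B (min (\<tau> (Suc k)) 0) \<omega> - B (min (\<tau> k) 0) \<omega>) = 0" by simp
qed

lemma partition_side:
  fixes p u w :: real
  assumes "{u<..<w} \<inter> P = {}" "p \<in> P"
  shows "p \<le> u \<or> w \<le> p"
  using assms by (force simp: disjoint_iff)

text \<open>Between partition points each \<open>\<tau> k\<close> lies on one side of the interval, so the stopped times
\<open>min (\<tau> k) v\<close> either stand still or move with \<open>v\<close>; exactly the term whose interval contains \<open>u\<close> has
one end of each kind.\<close>

lemma elementary_step:
  assumes el: "elementary F T n \<tau> \<xi>" and uw: "u < w" and P: "{u<..<w} \<inter> \<tau> ` {..n} = {}"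
  shows "stopped_integral B n \<tau> \<xi> w \<omega>
    = stopped_integral B n \<tau> \<xi> u \<omega> + elementary_process n \<tau> \<xi> u \<omega> * (B w \<omega> - B u \<omega>)"
    and "v \<in> {u..<w} \<Longrightarrow> elementary_process n \<tau> \<xi> v \<omega> = elementary_process n \<tau> \<xi> u \<omega>"
proof -
  have side: "\<tau> k \<le> u \<or> w \<le> \<tau> k" if "k \<le> n" for k
    using partition_side[OF P] that by auto
  have mono: "\<tau> k \<le> \<tau> (Suc k)" if "k < n" for k
    using el that by (simp add: elementary_def)
  show "stopped_integral B n \<tau> \<xi> w \<omega>
    = stopped_integral B n \<tau> \<xi> u \<omega> + elementary_process n \<tau> \<xi> u \<omega> * (B w \<omega> - B u \<omega>)"
    unfolding stopped_integral_def elementary_process_def sum_distrib_right sum.distrib[symmetric]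
  proof (intro sum.cong refl)
    fix k assume "k \<in> {..<n}"
    then have k: "k < n" by simp
    consider "\<tau> (Suc k) \<le> u" | "\<tau> k \<le> u" "w \<le> \<tau> (Suc k)" | "w \<le> \<tau> k"
      using side[of k] side[of "Suc k"] mono[OF k] k by force
    then show "\<xi> k \<omega> * (B (min (\<tau> (Suc k)) w) \<omega> - B (min (\<tau> k) w) \<omega>)
      = \<xi> k \<omega> * (B (min (\<tau> (Suc k)) u) \<omega> - B (min (\<tau> k) u) \<omega>)
        + \<xi> k \<omega> * indicator {\<tau> k..<\<tau> (Suc k)} u * (B w \<omega> - B u \<omega>)"
      using mono[OF k] uw by cases (auto simp: min_absorb1 min_absorb2 algebra_simps indicator_def)
  qed
  show "elementary_process n \<tau> \<xi> v \<omega> = elementary_process n \<tau> \<xi> u \<omega>" if v: "v \<in> {u..<w}"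
    unfolding elementary_process_def
  proof (intro sum.cong refl)
    fix k assume "k \<in> {..<n}"
    then have "\<tau> k \<le> u \<or> w \<le> \<tau> k" "\<tau> (Suc k) \<le> u \<or> w \<le> \<tau> (Suc k)"
      using side[of k] side[of "Suc k"] by auto
    then show "\<xi> k \<omega> * indicator {\<tau> k..<\<tau> (Suc k)} v = \<xi> k \<omega> * indicator {\<tau> k..<\<tau> (Suc k)} u"
      using v by (auto simp: indicator_def)
  qed
qed

context brownian_pair
begin

text \<open>The value \<open>\<xi> k\<close> is known only from time \<open>\<tau> k\<close> on; before that time its coefficient vanishes.\<close>

lemma elementary_measurable:
  assumes el: "elementary F T n \<tau> \<xi>" and v: "0 \<le> v"
    and B: "\<And>t. 0 \<le> t \<Longrightarrow> B t \<in> borel_measurable (F t)"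
  shows "stopped_integral B n \<tau> \<xi> v \<in> borel_measurable (F v)"
    and "elementary_process n \<tau> \<xi> v \<in> borel_measurable (F v)"
proof -
  have \<xi>: "\<xi> k \<in> borel_measurable (F v)" if "k < n" "\<tau> k \<le> v" for k
    using el that measurable_F_mono[of "\<xi> k" "\<tau> k" borel v] by (auto simp: elementary_def)
  have mono: "\<tau> k \<le> \<tau> (Suc k)" if "k < n" for k
    using el that by (simp add: elementary_def)
  have Bmin: "B (min t v) \<in> borel_measurable (F v)" if "0 \<le> t" for t
    using measurable_F_mono[OF B[of "min t v"], of v] that v by auto
  show "stopped_integral B n \<tau> \<xi> v \<in> borel_measurable (F v)"
    unfolding stopped_integral_def[abs_def]
  proof (intro borel_measurable_sum)
    fix k assume "k \<in> {..<n}"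
    then have k: "k < n" by simp
    show "(\<lambda>\<omega>. \<xi> k \<omega> * (B (min (\<tau> (Suc k)) v) \<omega> - B (min (\<tau> k) v) \<omega>)) \<in> borel_measurable (F v)"
    proof (cases "\<tau> k \<le> v")
      case True
      then show ?thesis
        using k by (intro borel_measurable_times borel_measurable_diff \<xi> Bmin elementary_times(1)[OF el]) simp_all
    next
      case False
      then show ?thesis using mono[OF k] by (simp add: min_def)
    qed
  qed
  show "elementary_process n \<tau> \<xi> v \<in> borel_measurable (F v)"
    unfolding elementary_process_def[abs_def]
  proof (intro borel_measurable_sum)
    fix k assume "k \<in> {..<n}"
    then have k: "k < n" by simp
    show "(\<lambda>\<omega>. \<xi> k \<omega> * indicator {\<tau> k..<\<tau> (Suc k)} v) \<in> borel_measurable (F v)"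
      using \<xi>[OF k] by (cases "\<tau> k \<le> v") (auto simp: indicator_def)
  qed
qed

lemma elementary_bounded:
  assumes el: "elementary F T n \<tau> \<xi>"
  shows "\<exists>C. \<forall>v. \<forall>\<omega>\<in>space M. \<bar>elementary_process n \<tau> \<xi> v \<omega>\<bar> \<le> C"
proof -
  have "\<forall>k\<in>{..<n}. \<exists>C. \<forall>\<omega>\<in>space M. \<bar>\<xi> k \<omega>\<bar> \<le> C"
    using el by (auto simp: elementary_def)
  then obtain C where C: "\<forall>k\<in>{..<n}. \<forall>\<omega>\<in>space M. \<bar>\<xi> k \<omega>\<bar> \<le> C k" by metis
  have "\<bar>elementary_process n \<tau> \<xi> v \<omega>\<bar> \<le> (\<Sum>k<n. C k)" if "\<omega> \<in> space M" for v \<omega>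
    unfolding elementary_process_def
    using C that by (intro order_trans[OF sum_abs] sum_mono) (auto simp: indicator_def intro: order_trans[OF abs_ge_zero])
  then show ?thesis by blast
qed

lemma elementary_simple_integral:
  assumes 1: "elementary F T n \<tau> \<xi>" and 2: "elementary F T m \<sigma> \<eta>"
  shows "simple_integral (\<tau> ` {..n} \<union> \<sigma> ` {..m})
    (\<lambda>v \<omega>. stopped_integral B\<^sub>1 n \<tau> \<xi> v \<omega> + stopped_integral B\<^sub>2 m \<sigma> \<eta> v \<omega>)
    (elementary_process n \<tau> \<xi>) (elementary_process m \<sigma> \<eta>)"
proof -
  obtain C\<^sub>1 C\<^sub>2 where C: "\<And>v \<omega>. \<omega> \<in> space M \<Longrightarrow> \<bar>elementary_process n \<tau> \<xi> v \<omega>\<bar> \<le> C\<^sub>1"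
    "\<And>v \<omega>. \<omega> \<in> space M \<Longrightarrow> \<bar>elementary_process m \<sigma> \<eta> v \<omega>\<bar> \<le> C\<^sub>2"
    using elementary_bounded[OF 1] elementary_bounded[OF 2] by blast
  note meas = elementary_measurable[OF 1 _ B_measurable_F(1)] elementary_measurable[OF 2 _ B_measurable_F(2)]
  show ?thesis
    unfolding simple_integral_def
  proof (intro conjI allI impI ballI)
    fix v :: real assume "0 \<le> v"
    with meas show "(\<lambda>\<omega>. stopped_integral B\<^sub>1 n \<tau> \<xi> v \<omega> + stopped_integral B\<^sub>2 m \<sigma> \<eta> v \<omega>) \<in> borel_measurable (F v)"
      "elementary_process n \<tau> \<xi> v \<in> borel_measurable (F v)" "elementary_process m \<sigma> \<eta> v \<in> borel_measurable (F v)"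
      by auto
  next
    show "\<exists>C. \<forall>v. \<forall>\<omega>\<in>space M. \<bar>elementary_process n \<tau> \<xi> v \<omega>\<bar> \<le> C \<and> \<bar>elementary_process m \<sigma> \<eta> v \<omega>\<bar> \<le> C"
      by (intro exI[of _ "max C\<^sub>1 C\<^sub>2"]) (auto intro: order_trans[OF C(1)] order_trans[OF C(2)])
  next
    fix u w :: real and \<omega> assume uw: "0 \<le> u" "u < w" "{u<..<w} \<inter> (\<tau> ` {..n} \<union> \<sigma> ` {..m}) = {}"
    then have d: "{u<..<w} \<inter> \<tau> ` {..n} = {}" "{u<..<w} \<inter> \<sigma> ` {..m} = {}" by auto
    show "stopped_integral B\<^sub>1 n \<tau> \<xi> w \<omega> + stopped_integral B\<^sub>2 m \<sigma> \<eta> w \<omega>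
      = stopped_integral B\<^sub>1 n \<tau> \<xi> u \<omega> + stopped_integral B\<^sub>2 m \<sigma> \<eta> u \<omega>
        + elementary_process n \<tau> \<xi> u \<omega> * (B\<^sub>1 w \<omega> - B\<^sub>1 u \<omega>) + elementary_process m \<sigma> \<eta> u \<omega> * (B\<^sub>2 w \<omega> - B\<^sub>2 u \<omega>)"
      unfolding elementary_step(1)[OF 1 uw(2) d(1)] elementary_step(1)[OF 2 uw(2) d(2)] by simp
    fix v assume "v \<in> {u..<w}"
    then show "elementary_process n \<tau> \<xi> v \<omega> = elementary_process n \<tau> \<xi> u \<omega>"
      "elementary_process m \<sigma> \<eta> v \<omega> = elementary_process m \<sigma> \<eta> u \<omega>"
      using elementary_step(2)[OF 1 uw(2) d(1)] elementary_step(2)[OF 2 uw(2) d(2)] by blast+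
  qed (simp_all add: stopped_integral_0[OF 1] stopped_integral_0[OF 2])
qed

text \<open>The Ito integral is defined by a distance that averages over time first. The estimates below fix a
time and average over \<open>\<omega>\<close>, which is the other order of integration.\<close>

lemma mean_square_distance_swap:
  fixes X :: "real \<Rightarrow> 'a \<Rightarrow> real"
  assumes X: "ito_integrand M F T X" and el: "elementary F T n \<tau> \<xi>"
  defines "D \<equiv> \<lambda>t. \<integral>\<^sup>+\<omega>. ennreal ((X t \<omega> - elementary_process n \<tau> \<xi> t \<omega>)\<^sup>2) \<partial>M"
  shows "(\<lambda>t. D t * indicator {0..T} t) \<in> borel_measurable borel"
    and "(\<integral>\<^sup>+\<omega>. (\<integral>\<^sup>+t\<in>{0..T}. ennreal ((X t \<omega> - elementary_process n \<tau> \<xi> t \<omega>)\<^sup>2) \<partial>lborel) \<partial>M)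
      = (\<integral>\<^sup>+t\<in>{0..T}. D t \<partial>lborel)"
proof -
  let ?L = "restrict_space lborel {0..T}"
  interpret L: sigma_finite_measure ?L
    by (intro sigma_finite_measure_restrict_space lborel.sigma_finite_measure_axioms) simp
  interpret P: pair_sigma_finite ?L M ..
  have \<xi> [measurable]: "\<xi> k \<in> borel_measurable M" if "k < n" for k
    using el that measurable_F_M[of "\<xi> k" "\<tau> k" borel] by (simp add: elementary_def)
  have ind [measurable]: "indicator {a..<b} \<in> borel_measurable ?L" for a b :: real
    by (intro measurable_restrict_space1) simp
  have X' [measurable]: "(\<lambda>p. X (fst p) (snd p)) \<in> borel_measurable (?L \<Otimes>\<^sub>M M)"
    using X by (simp add: ito_integrand_def split_beta')
  have e [measurable]: "(\<lambda>p. elementary_process n \<tau> \<xi> (fst p) (snd p)) \<in> borel_measurable (?L \<Otimes>\<^sub>M M)"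
    unfolding elementary_process_def
  proof (intro borel_measurable_sum borel_measurable_times)
    fix k assume "k \<in> {..<n}"
    then have [measurable]: "\<xi> k \<in> borel_measurable M" using \<xi> by simp
    show "(\<lambda>p. \<xi> k (snd p)) \<in> borel_measurable (?L \<Otimes>\<^sub>M M)" by measurable
    show "(\<lambda>p. indicator {\<tau> k..<\<tau> (Suc k)} (fst p)) \<in> borel_measurable (?L \<Otimes>\<^sub>M M)"
      by (rule measurable_compose[OF measurable_fst ind])
  qed
  let ?f = "\<lambda>p. ennreal ((X (fst p) (snd p) - elementary_process n \<tau> \<xi> (fst p) (snd p))\<^sup>2)"
  have f: "?f \<in> borel_measurable (?L \<Otimes>\<^sub>M M)" by measurable
  have "D \<in> borel_measurable ?L"
    unfolding D_def using borel_measurable_nn_integral_fst[OF f] by simp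
  then show "(\<lambda>t. D t * indicator {0..T} t) \<in> borel_measurable borel"
    by (simp add: borel_measurable_restrict_space_iff_ennreal)
  have "(\<integral>\<^sup>+\<omega>. (\<integral>\<^sup>+t. ?f (t, \<omega>) \<partial>?L) \<partial>M) = (\<integral>\<^sup>+t. (\<integral>\<^sup>+\<omega>. ?f (t, \<omega>) \<partial>M) \<partial>?L)"
    using P.Fubini[OF f] by simp
  then show "(\<integral>\<^sup>+\<omega>. (\<integral>\<^sup>+t\<in>{0..T}. ennreal ((X t \<omega> - elementary_process n \<tau> \<xi> t \<omega>)\<^sup>2) \<partial>lborel) \<partial>M)
      = (\<integral>\<^sup>+t\<in>{0..T}. D t \<partial>lborel)"
    by (simp add: nn_integral_restrict_space D_def)
qed

end

section \<open>The exponential formula for Ito integrals\<close>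

lemma norm_cis_diff_le: "norm (cis x - cis y) \<le> \<bar>x - y\<bar>"
proof -
  have "cis x - cis y = cis y * (cis (x - y) - 1)"
    by (simp add: right_diff_distrib cis_mult)
  then have "norm (cis x - cis y) = norm (iexp (x - y) - 1)"
    by (simp add: norm_mult cis_conv_exp)
  also have "\<dots> \<le> \<bar>x - y\<bar>"
    using iexp_approx1[of "x - y" 0] by simp
  finally show ?thesis .
qed

lemma ennreal_square_diff_le:
  fixes x y z :: real
  shows "ennreal ((x - z)\<^sup>2) \<le> 2 * ennreal ((x - y)\<^sup>2) + 2 * ennreal ((y - z)\<^sup>2)"
proof -
  have "(x - z)\<^sup>2 \<le> 2 * (x - y)\<^sup>2 + 2 * (y - z)\<^sup>2"
    using zero_le_power2[of "(x - y) - (y - z)"] by (simp add: power2_eq_square algebra_simps)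
  then have "ennreal ((x - z)\<^sup>2) \<le> ennreal (2 * (x - y)\<^sup>2 + 2 * (y - z)\<^sup>2)"
    by (rule ennreal_leI)
  then show ?thesis by (simp add: ennreal_mult)
qed

text \<open>A bound for the difference of squares in terms of the squared difference alone. The price for the
cross term is the free constant \<open>\<epsilon>\<close>, which is chosen after the mean square distance.\<close>

lemma abs_square_diff_le:
  fixes x y K \<epsilon> :: real
  assumes "\<bar>y\<bar> \<le> K" "0 < \<epsilon>"
  shows "\<bar>x\<^sup>2 - y\<^sup>2\<bar> \<le> \<epsilon> + (1 + K\<^sup>2 / \<epsilon>) * (y - x)\<^sup>2"
proof -
  let ?d = "\<bar>y - x\<bar>"
  have "\<bar>x\<^sup>2 - y\<^sup>2\<bar> = ?d * \<bar>x + y\<bar>"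
    by (simp add: power2_eq_square square_diff_square_factored abs_mult abs_minus_commute mult.commute)
  also have "\<dots> \<le> ?d * (?d + 2 * K)"
    using assms by (intro mult_left_mono) auto
  also have "\<dots> = ?d\<^sup>2 + 2 * ?d * K" by (simp add: power2_eq_square algebra_simps)
  also have "2 * ?d * K \<le> \<epsilon> + K\<^sup>2 / \<epsilon> * ?d\<^sup>2"
  proof -
    have "0 \<le> (\<epsilon> - K * ?d)\<^sup>2 / \<epsilon>" using assms by simp
    also have "\<dots> = \<epsilon> + K\<^sup>2 / \<epsilon> * ?d\<^sup>2 - 2 * ?d * K"
      using assms(2) by (simp add: power2_eq_square field_simps)
    finally show ?thesis by simp
  qed
  finally show ?thesis by (simp add: algebra_simps)
qed

lemma (in prob_space) abs_expectation_from_square: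
  fixes U V :: "'a \<Rightarrow> real"
  assumes [measurable]: "U \<in> borel_measurable M" "V \<in> borel_measurable M"
    and sq: "(\<integral>\<^sup>+\<omega>. ennreal ((U \<omega> - V \<omega>)\<^sup>2) \<partial>M) \<le> ennreal c" and "0 \<le> c" "0 < \<epsilon>"
  shows "integrable M (\<lambda>\<omega>. \<bar>U \<omega> - V \<omega>\<bar>)" and "(\<integral>\<omega>. \<bar>U \<omega> - V \<omega>\<bar> \<partial>M) \<le> \<epsilon> + c / \<epsilon>"
proof -
  have i: "integrable M (\<lambda>\<omega>. (U \<omega> - V \<omega>)\<^sup>2)"
    using le_less_trans[OF sq ennreal_less_top] by (intro integrableI_nonneg) auto
  have E: "(\<integral>\<omega>. (U \<omega> - V \<omega>)\<^sup>2 \<partial>M) \<le> c"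
    using sq \<open>0 \<le> c\<close> by (simp add: integral_eq_nn_integral enn2real_leI)
  have b: "\<bar>d\<bar> \<le> \<epsilon> + d\<^sup>2 / \<epsilon>" for d :: real
  proof -
    have "\<bar>d\<bar> * \<epsilon> \<le> \<epsilon>\<^sup>2 + d\<^sup>2"
    proof -
      have "\<bar>d\<bar> * \<epsilon> \<le> \<epsilon>\<^sup>2 + d\<^sup>2 / 4"
        using zero_le_power2[of "\<epsilon> - \<bar>d\<bar> / 2"] by (simp add: power2_eq_square algebra_simps)
      also have "\<dots> \<le> \<epsilon>\<^sup>2 + d\<^sup>2" by simp
      finally show ?thesis .
    qed
    then show ?thesis using \<open>0 < \<epsilon>\<close> by (simp add: field_simps power2_eq_square)
  qed
  show ia: "integrable M (\<lambda>\<omega>. \<bar>U \<omega> - V \<omega>\<bar>)"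
    by (rule Bochner_Integration.integrable_bound[where f="\<lambda>\<omega>. \<epsilon> + (U \<omega> - V \<omega>)\<^sup>2 / \<epsilon>"])
      (use i b \<open>0 < \<epsilon>\<close> in auto)
  have "(\<integral>\<omega>. \<bar>U \<omega> - V \<omega>\<bar> \<partial>M) \<le> (\<integral>\<omega>. \<epsilon> + (U \<omega> - V \<omega>)\<^sup>2 / \<epsilon> \<partial>M)"
    using i ia b by (intro integral_mono) auto
  also have "\<dots> = \<epsilon> + (\<integral>\<omega>. (U \<omega> - V \<omega>)\<^sup>2 \<partial>M) / \<epsilon>"
    using i by (simp add: prob_space)
  also have "\<dots> \<le> \<epsilon> + c / \<epsilon>" using E \<open>0 < \<epsilon>\<close> by (simp add: divide_right_mono)
  finally show "(\<integral>\<omega>. \<bar>U \<omega> - V \<omega>\<bar> \<partial>M) \<le> \<epsilon> + c / \<epsilon>" .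
qed

lemma (in prob_space) norm_expectation_diff_le:
  fixes f g :: "'a \<Rightarrow> complex"
  assumes "integrable M f" "integrable M g" "integrable M b"
    and "\<And>\<omega>. \<omega> \<in> space M \<Longrightarrow> norm (f \<omega> - g \<omega>) \<le> b \<omega>"
  shows "norm ((\<integral>\<omega>. f \<omega> \<partial>M) - (\<integral>\<omega>. g \<omega> \<partial>M)) \<le> (\<integral>\<omega>. b \<omega> \<partial>M)"
proof -
  have "norm ((\<integral>\<omega>. f \<omega> \<partial>M) - (\<integral>\<omega>. g \<omega> \<partial>M)) = norm (\<integral>\<omega>. f \<omega> - g \<omega> \<partial>M)"
    using assms by simp
  also have "\<dots> \<le> (\<integral>\<omega>. norm (f \<omega> - g \<omega>) \<partial>M)" by (rule integral_norm_bound)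
  also have "\<dots> \<le> (\<integral>\<omega>. b \<omega> \<partial>M)"
    using assms by (intro integral_mono) auto
  finally show ?thesis .
qed

text \<open>The process \<open>Y\<close> is a sum of two Ito integrals at each time separately: the approximating step processes
that define \<open>Y v\<close> and those that define \<open>Y t\<close> are unrelated. Boundedness of the integrands holds for the
phase equation, where they are \<open>cos \<alpha> - 1\<close> and \<open>sin \<alpha>\<close>.\<close>

locale ito_pair = brownian_pair M F B\<^sub>1 B\<^sub>2
  for M :: "'a measure" and F B\<^sub>1 B\<^sub>2 +
  fixes X\<^sub>1 X\<^sub>2 Y :: "real \<Rightarrow> 'a \<Rightarrow> real" and K :: real
  assumes Y_measurable: "\<And>v. 0 \<le> v \<Longrightarrow> Y v \<in> borel_measurable M"
    and X_bounded: "\<And>v \<omega>. \<bar>X\<^sub>1 v \<omega>\<bar> \<le> K" "\<And>v \<omega>. \<bar>X\<^sub>2 v \<omega>\<bar> \<le> K"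
    and ito: "\<And>t. 0 \<le> t \<Longrightarrow> \<exists>I\<^sub>1 I\<^sub>2. has_ito_integral M F B\<^sub>1 t X\<^sub>1 I\<^sub>1 \<and> has_ito_integral M F B\<^sub>2 t X\<^sub>2 I\<^sub>2 \<and>
      (AE \<omega> in M. Y t \<omega> = I\<^sub>1 \<omega> + I\<^sub>2 \<omega>)"
begin

lemma X_measurable:
  assumes "0 \<le> v" shows "X\<^sub>1 v \<in> borel_measurable M" "X\<^sub>2 v \<in> borel_measurable M"
proof -
  obtain I\<^sub>1 I\<^sub>2 where I: "has_ito_integral M F B\<^sub>1 v X\<^sub>1 I\<^sub>1" "has_ito_integral M F B\<^sub>2 v X\<^sub>2 I\<^sub>2"
    using ito[OF assms] by blast
  have "v \<in> {0..v}" using assms by simp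
  then have "X\<^sub>1 v \<in> borel_measurable (F v)" "X\<^sub>2 v \<in> borel_measurable (F v)"
    using I unfolding has_ito_integral_def ito_integrand_def by blast+
  then show "X\<^sub>1 v \<in> borel_measurable M" "X\<^sub>2 v \<in> borel_measurable M"
    by (auto intro: measurable_F_M)
qed

definition sq_dist :: "(real \<Rightarrow> 'a \<Rightarrow> real) \<Rightarrow> (real \<Rightarrow> 'a \<Rightarrow> real) \<Rightarrow> real \<Rightarrow> ennreal" where
  "sq_dist x\<^sub>1 x\<^sub>2 v = (\<integral>\<^sup>+\<omega>. ennreal ((X\<^sub>1 v \<omega> - x\<^sub>1 v \<omega>)\<^sup>2 + (X\<^sub>2 v \<omega> - x\<^sub>2 v \<omega>)\<^sup>2) \<partial>M)"

definition approximates :: "real \<Rightarrow> real \<Rightarrow> real set \<Rightarrow> (real \<Rightarrow> 'a \<Rightarrow> real) \<Rightarrow> (real \<Rightarrow> 'a \<Rightarrow> real) \<Rightarrow> (real \<Rightarrow> 'a \<Rightarrow> real) \<Rightarrow> bool"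
  where "approximates T \<eta> P S x\<^sub>1 x\<^sub>2 \<longleftrightarrow> simple_integral P S x\<^sub>1 x\<^sub>2 \<and>
    (\<lambda>t. sq_dist x\<^sub>1 x\<^sub>2 t * indicator {0..T} t) \<in> borel_measurable borel \<and>
    (\<integral>\<^sup>+t\<in>{0..T}. sq_dist x\<^sub>1 x\<^sub>2 t \<partial>lborel) \<le> ennreal \<eta> \<and>
    (\<integral>\<^sup>+\<omega>. ennreal ((S T \<omega> - Y T \<omega>)\<^sup>2) \<partial>M) \<le> ennreal \<eta>"

lemma approximation_exists:
  assumes T: "0 \<le> T" and \<eta>: "0 < \<eta>"
  shows "\<exists>P S x\<^sub>1 x\<^sub>2. approximates T \<eta> P S x\<^sub>1 x\<^sub>2"
proof -
  have pick: "\<exists>n \<tau> \<xi>. elementary F T n \<tau> \<xi> \<and>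
      (\<integral>\<^sup>+\<omega>. (\<integral>\<^sup>+t\<in>{0..T}. ennreal ((X t \<omega> - elementary_process n \<tau> \<xi> t \<omega>)\<^sup>2) \<partial>lborel) \<partial>M) \<le> ennreal (\<eta> / 4) \<and>
      (\<integral>\<^sup>+\<omega>. ennreal ((I \<omega> - elementary_integral B n \<tau> \<xi> \<omega>)\<^sup>2) \<partial>M) \<le> ennreal (\<eta> / 4)"
    if I: "has_ito_integral M F B T X I" for X B I
  proof -
    from I obtain n \<tau> \<xi> where el: "\<And>j. elementary F T (n j) (\<tau> j) (\<xi> j)"
      and l1: "(\<lambda>j. \<integral>\<^sup>+\<omega>. (\<integral>\<^sup>+t\<in>{0..T}. ennreal ((X t \<omega> - elementary_process (n j) (\<tau> j) (\<xi> j) t \<omega>)\<^sup>2) \<partial>lborel) \<partial>M) \<longlonglongrightarrow> 0"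
      and l2: "(\<lambda>j. \<integral>\<^sup>+\<omega>. ennreal ((I \<omega> - elementary_integral B (n j) (\<tau> j) (\<xi> j) \<omega>)\<^sup>2) \<partial>M) \<longlonglongrightarrow> 0"
      unfolding has_ito_integral_def by blast
    have "0 < ennreal (\<eta> / 4)" using \<eta> by simp
    from eventually_happens'[OF sequentially_bot
        eventually_conj[OF order_tendstoD(2)[OF l1 this] order_tendstoD(2)[OF l2 this]]]
    obtain j where
      "(\<integral>\<^sup>+\<omega>. (\<integral>\<^sup>+t\<in>{0..T}. ennreal ((X t \<omega> - elementary_process (n j) (\<tau> j) (\<xi> j) t \<omega>)\<^sup>2) \<partial>lborel) \<partial>M) < ennreal (\<eta> / 4)"
      "(\<integral>\<^sup>+\<omega>. ennreal ((I \<omega> - elementary_integral B (n j) (\<tau> j) (\<xi> j) \<omega>)\<^sup>2) \<partial>M) < ennreal (\<eta> / 4)"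
      by (elim exE conjE) simp
    with el show ?thesis by (intro exI[of _ "n j"] exI[of _ "\<tau> j"] exI[of _ "\<xi> j"]) (auto intro: less_imp_le)
  qed
  obtain I\<^sub>1 I\<^sub>2 where I: "has_ito_integral M F B\<^sub>1 T X\<^sub>1 I\<^sub>1" "has_ito_integral M F B\<^sub>2 T X\<^sub>2 I\<^sub>2"
    and Y: "AE \<omega> in M. Y T \<omega> = I\<^sub>1 \<omega> + I\<^sub>2 \<omega>"
    using ito[OF T] by blast
  have [measurable]: "I\<^sub>1 \<in> borel_measurable M" "I\<^sub>2 \<in> borel_measurable M"
    and int: "ito_integrand M F T X\<^sub>1" "ito_integrand M F T X\<^sub>2"
    using I by (auto simp: has_ito_integral_def)
  obtain n \<tau> \<xi> where 1: "elementary F T n \<tau> \<xi>"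
    and 11: "(\<integral>\<^sup>+\<omega>. (\<integral>\<^sup>+t\<in>{0..T}. ennreal ((X\<^sub>1 t \<omega> - elementary_process n \<tau> \<xi> t \<omega>)\<^sup>2) \<partial>lborel) \<partial>M) \<le> ennreal (\<eta> / 4)"
    and 12: "(\<integral>\<^sup>+\<omega>. ennreal ((I\<^sub>1 \<omega> - elementary_integral B\<^sub>1 n \<tau> \<xi> \<omega>)\<^sup>2) \<partial>M) \<le> ennreal (\<eta> / 4)"
    using pick[OF I(1)] by blast
  obtain m \<sigma> \<zeta> where 2: "elementary F T m \<sigma> \<zeta>"
    and 21: "(\<integral>\<^sup>+\<omega>. (\<integral>\<^sup>+t\<in>{0..T}. ennreal ((X\<^sub>2 t \<omega> - elementary_process m \<sigma> \<zeta> t \<omega>)\<^sup>2) \<partial>lborel) \<partial>M) \<le> ennreal (\<eta> / 4)"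
    and 22: "(\<integral>\<^sup>+\<omega>. ennreal ((I\<^sub>2 \<omega> - elementary_integral B\<^sub>2 m \<sigma> \<zeta> \<omega>)\<^sup>2) \<partial>M) \<le> ennreal (\<eta> / 4)"
    using pick[OF I(2)] by blast
  let ?x\<^sub>1 = "elementary_process n \<tau> \<xi>" and ?x\<^sub>2 = "elementary_process m \<sigma> \<zeta>"
  let ?S = "\<lambda>v \<omega>. stopped_integral B\<^sub>1 n \<tau> \<xi> v \<omega> + stopped_integral B\<^sub>2 m \<sigma> \<zeta> v \<omega>"
  note sw1 = mean_square_distance_swap[OF int(1) 1] and sw2 = mean_square_distance_swap[OF int(2) 2]
  have meas: "?x\<^sub>1 v \<in> borel_measurable M" "?x\<^sub>2 v \<in> borel_measurable M"
    "stopped_integral B\<^sub>1 n \<tau> \<xi> v \<in> borel_measurable M" "stopped_integral B\<^sub>2 m \<sigma> \<zeta> v \<in> borel_measurable M"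
    if "0 \<le> v" for v
    using elementary_measurable[OF 1 that B_measurable_F(1)] elementary_measurable[OF 2 that B_measurable_F(2)]
    by (auto intro: measurable_F_M)
  have split: "sq_dist ?x\<^sub>1 ?x\<^sub>2 t * indicator {0..T} t
      = (\<integral>\<^sup>+\<omega>. ennreal ((X\<^sub>1 t \<omega> - ?x\<^sub>1 t \<omega>)\<^sup>2) \<partial>M) * indicator {0..T} t
        + (\<integral>\<^sup>+\<omega>. ennreal ((X\<^sub>2 t \<omega> - ?x\<^sub>2 t \<omega>)\<^sup>2) \<partial>M) * indicator {0..T} t" for t
  proof (cases "t \<in> {0..T}")
    case True
    then have "0 \<le> t" by simp
    note [measurable] = meas(1,2)[OF this] X_measurable[OF this]
    have "sq_dist ?x\<^sub>1 ?x\<^sub>2 t = (\<integral>\<^sup>+\<omega>. ennreal ((X\<^sub>1 t \<omega> - ?x\<^sub>1 t \<omega>)\<^sup>2) + ennreal ((X\<^sub>2 t \<omega> - ?x\<^sub>2 t \<omega>)\<^sup>2) \<partial>M)"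
      by (simp add: sq_dist_def)
    also have "\<dots> = (\<integral>\<^sup>+\<omega>. ennreal ((X\<^sub>1 t \<omega> - ?x\<^sub>1 t \<omega>)\<^sup>2) \<partial>M) + (\<integral>\<^sup>+\<omega>. ennreal ((X\<^sub>2 t \<omega> - ?x\<^sub>2 t \<omega>)\<^sup>2) \<partial>M)"
      by (intro nn_integral_add) auto
    finally show ?thesis using True by simp
  qed simp
  have quarter: "ennreal (\<eta> / 4) + ennreal (\<eta> / 4) \<le> ennreal \<eta>"
    "2 * ennreal (\<eta> / 4) + 2 * ennreal (\<eta> / 4) = ennreal \<eta>"
  proof -
    have half: "2 * ennreal (\<eta> / 4) = ennreal (\<eta> / 2)"
      using \<eta> ennreal_mult[of 2 "\<eta> / 4"] by simp
    show "ennreal (\<eta> / 4) + ennreal (\<eta> / 4) \<le> ennreal \<eta>"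
      unfolding mult_2[symmetric] half using \<eta> by (intro ennreal_leI) simp
    show "2 * ennreal (\<eta> / 4) + 2 * ennreal (\<eta> / 4) = ennreal \<eta>"
      unfolding half using \<eta> ennreal_plus[of "\<eta> / 2" "\<eta> / 2"] by simp
  qed
  have "(\<integral>\<^sup>+t\<in>{0..T}. sq_dist ?x\<^sub>1 ?x\<^sub>2 t \<partial>lborel) \<le> ennreal (\<eta> / 4) + ennreal (\<eta> / 4)"
    unfolding split using sw1 sw2 11 21 by (subst nn_integral_add) (auto intro: add_mono)
  then have near: "(\<integral>\<^sup>+t\<in>{0..T}. sq_dist ?x\<^sub>1 ?x\<^sub>2 t \<partial>lborel) \<le> ennreal \<eta>"
    using quarter(1) by (rule order_trans)
  note [measurable] = meas(3,4)[OF T] Y_measurable[OF T]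
  have "(\<integral>\<^sup>+\<omega>. ennreal ((?S T \<omega> - Y T \<omega>)\<^sup>2) \<partial>M)
     \<le> (\<integral>\<^sup>+\<omega>. 2 * ennreal ((I\<^sub>1 \<omega> - stopped_integral B\<^sub>1 n \<tau> \<xi> T \<omega>)\<^sup>2) + 2 * ennreal ((I\<^sub>2 \<omega> - stopped_integral B\<^sub>2 m \<sigma> \<zeta> T \<omega>)\<^sup>2) \<partial>M)"
  proof (intro nn_integral_mono_AE)
    show "AE \<omega> in M. ennreal ((?S T \<omega> - Y T \<omega>)\<^sup>2)
      \<le> 2 * ennreal ((I\<^sub>1 \<omega> - stopped_integral B\<^sub>1 n \<tau> \<xi> T \<omega>)\<^sup>2) + 2 * ennreal ((I\<^sub>2 \<omega> - stopped_integral B\<^sub>2 m \<sigma> \<zeta> T \<omega>)\<^sup>2)"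
      using Y
    proof eventually_elim
      case (elim \<omega>)
      have "(?S T \<omega> - Y T \<omega>)\<^sup>2 = ((I\<^sub>1 \<omega> - stopped_integral B\<^sub>1 n \<tau> \<xi> T \<omega>) - (- (I\<^sub>2 \<omega> - stopped_integral B\<^sub>2 m \<sigma> \<zeta> T \<omega>)))\<^sup>2"
        unfolding elim by (simp add: power2_eq_square algebra_simps)
      then show ?case
        using ennreal_square_diff_le[of "I\<^sub>1 \<omega> - stopped_integral B\<^sub>1 n \<tau> \<xi> T \<omega>"
            "- (I\<^sub>2 \<omega> - stopped_integral B\<^sub>2 m \<sigma> \<zeta> T \<omega>)" 0] by simp
    qed
  qed
  also have "\<dots> = 2 * (\<integral>\<^sup>+\<omega>. ennreal ((I\<^sub>1 \<omega> - stopped_integral B\<^sub>1 n \<tau> \<xi> T \<omega>)\<^sup>2) \<partial>M)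
      + 2 * (\<integral>\<^sup>+\<omega>. ennreal ((I\<^sub>2 \<omega> - stopped_integral B\<^sub>2 m \<sigma> \<zeta> T \<omega>)\<^sup>2) \<partial>M)"
    by (subst nn_integral_add) (auto simp: nn_integral_cmult)
  also have "\<dots> \<le> 2 * ennreal (\<eta> / 4) + 2 * ennreal (\<eta> / 4)"
    using 12 22 unfolding stopped_integral_final[OF 1] stopped_integral_final[OF 2]
    by (intro add_mono mult_left_mono) auto
  also note quarter(2)
  finally have "(\<integral>\<^sup>+\<omega>. ennreal ((?S T \<omega> - Y T \<omega>)\<^sup>2) \<partial>M) \<le> ennreal \<eta>" .
  moreover have "(\<lambda>t. sq_dist ?x\<^sub>1 ?x\<^sub>2 t * indicator {0..T} t) \<in> borel_measurable borel"
    unfolding split using sw1(1) sw2(1) by (rule borel_measurable_add)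
  ultimately show ?thesis
    unfolding approximates_def using near elementary_simple_integral[OF 1 2] by blast
qed

text \<open>A step integral that is close to \<open>Y\<close> at time \<open>T\<close> is close to it at all earlier times. By the isometry
it is close to any step integral that approximates \<open>Y v\<close>, as both integrands are close to the same
limit on \<open>[0, v]\<close>. The constant is \<open>10 = 2 (2 + 2) + 2\<close>.\<close>

lemma approximation_uniform:
  assumes A: "approximates T \<eta> P S x\<^sub>1 x\<^sub>2" and \<eta>: "0 < \<eta>" and v: "0 \<le> v" "v \<le> T"
  shows "(\<integral>\<^sup>+\<omega>. ennreal ((S v \<omega> - Y v \<omega>)\<^sup>2) \<partial>M) \<le> ennreal (10 * \<eta>)"
proof -
  obtain Q R y\<^sub>1 y\<^sub>2 where R: "approximates v \<eta> Q R y\<^sub>1 y\<^sub>2"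
    using approximation_exists[OF v(1) \<eta>] by blast
  have S': "simple_integral P S x\<^sub>1 x\<^sub>2" and R': "simple_integral Q R y\<^sub>1 y\<^sub>2"
    using A R by (auto simp: approximates_def)
  note mS = simple_integralD(2-4)[OF S', THEN measurable_F_M] and mR = simple_integralD(2-4)[OF R', THEN measurable_F_M]
  have "(\<integral>\<^sup>+\<omega>. ennreal ((S v \<omega> - R v \<omega>)\<^sup>2) \<partial>M)
    = (\<integral>\<^sup>+t. (\<integral>\<^sup>+\<omega>. ennreal ((x\<^sub>1 t \<omega> - y\<^sub>1 t \<omega>)\<^sup>2 + (x\<^sub>2 t \<omega> - y\<^sub>2 t \<omega>)\<^sup>2) \<partial>M) * indicator {0..<v} t \<partial>lborel)"
    by (rule simple_integral_isometry[OF simple_integral_diff[OF S' R'] v(1)])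
  also have "\<dots> \<le> (\<integral>\<^sup>+t. 2 * (sq_dist x\<^sub>1 x\<^sub>2 t * indicator {0..T} t) + 2 * (sq_dist y\<^sub>1 y\<^sub>2 t * indicator {0..v} t) \<partial>lborel)"
  proof (intro nn_integral_mono)
    fix t :: real
    show "(\<integral>\<^sup>+\<omega>. ennreal ((x\<^sub>1 t \<omega> - y\<^sub>1 t \<omega>)\<^sup>2 + (x\<^sub>2 t \<omega> - y\<^sub>2 t \<omega>)\<^sup>2) \<partial>M) * indicator {0..<v} t
      \<le> 2 * (sq_dist x\<^sub>1 x\<^sub>2 t * indicator {0..T} t) + 2 * (sq_dist y\<^sub>1 y\<^sub>2 t * indicator {0..v} t)"
    proof (cases "t \<in> {0..<v}")
      case True
      then have t: "0 \<le> t" by simp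
      note [measurable] = mS[OF t] mR[OF t] X_measurable[OF t]
      have "(\<integral>\<^sup>+\<omega>. ennreal ((x\<^sub>1 t \<omega> - y\<^sub>1 t \<omega>)\<^sup>2 + (x\<^sub>2 t \<omega> - y\<^sub>2 t \<omega>)\<^sup>2) \<partial>M)
        \<le> (\<integral>\<^sup>+\<omega>. 2 * ennreal ((X\<^sub>1 t \<omega> - x\<^sub>1 t \<omega>)\<^sup>2 + (X\<^sub>2 t \<omega> - x\<^sub>2 t \<omega>)\<^sup>2)
            + 2 * ennreal ((X\<^sub>1 t \<omega> - y\<^sub>1 t \<omega>)\<^sup>2 + (X\<^sub>2 t \<omega> - y\<^sub>2 t \<omega>)\<^sup>2) \<partial>M)"
      proof (intro nn_integral_mono)
        fix \<omega>
        have "ennreal ((x\<^sub>1 t \<omega> - y\<^sub>1 t \<omega>)\<^sup>2) \<le> 2 * ennreal ((X\<^sub>1 t \<omega> - x\<^sub>1 t \<omega>)\<^sup>2) + 2 * ennreal ((X\<^sub>1 t \<omega> - y\<^sub>1 t \<omega>)\<^sup>2)"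
          "ennreal ((x\<^sub>2 t \<omega> - y\<^sub>2 t \<omega>)\<^sup>2) \<le> 2 * ennreal ((X\<^sub>2 t \<omega> - x\<^sub>2 t \<omega>)\<^sup>2) + 2 * ennreal ((X\<^sub>2 t \<omega> - y\<^sub>2 t \<omega>)\<^sup>2)"
          using ennreal_square_diff_le[of "x\<^sub>1 t \<omega>" "y\<^sub>1 t \<omega>" "X\<^sub>1 t \<omega>"] ennreal_square_diff_le[of "x\<^sub>2 t \<omega>" "y\<^sub>2 t \<omega>" "X\<^sub>2 t \<omega>"]
          by (simp_all add: power2_commute)
        from add_mono[OF this]
        show "ennreal ((x\<^sub>1 t \<omega> - y\<^sub>1 t \<omega>)\<^sup>2 + (x\<^sub>2 t \<omega> - y\<^sub>2 t \<omega>)\<^sup>2)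
          \<le> 2 * ennreal ((X\<^sub>1 t \<omega> - x\<^sub>1 t \<omega>)\<^sup>2 + (X\<^sub>2 t \<omega> - x\<^sub>2 t \<omega>)\<^sup>2)
            + 2 * ennreal ((X\<^sub>1 t \<omega> - y\<^sub>1 t \<omega>)\<^sup>2 + (X\<^sub>2 t \<omega> - y\<^sub>2 t \<omega>)\<^sup>2)"
          by (simp add: distrib_left ac_simps)
      qed
      also have "\<dots> = 2 * sq_dist x\<^sub>1 x\<^sub>2 t + 2 * sq_dist y\<^sub>1 y\<^sub>2 t"
        unfolding sq_dist_def by (simp add: nn_integral_add nn_integral_cmult del: ennreal_plus)
      finally show ?thesis using True v by simp
    qed simp
  qed
  also have "\<dots> = 2 * (\<integral>\<^sup>+t\<in>{0..T}. sq_dist x\<^sub>1 x\<^sub>2 t \<partial>lborel) + 2 * (\<integral>\<^sup>+t\<in>{0..v}. sq_dist y\<^sub>1 y\<^sub>2 t \<partial>lborel)"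
    using A R unfolding approximates_def by (subst nn_integral_add) (auto simp: nn_integral_cmult)
  also have "\<dots> \<le> 2 * ennreal \<eta> + 2 * ennreal \<eta>"
    using A R unfolding approximates_def by (intro add_mono mult_left_mono) auto
  finally have SR: "(\<integral>\<^sup>+\<omega>. ennreal ((S v \<omega> - R v \<omega>)\<^sup>2) \<partial>M) \<le> 2 * ennreal \<eta> + 2 * ennreal \<eta>" .
  note [measurable] = mS[OF v(1)] mR[OF v(1)] Y_measurable[OF v(1)]
  have "(\<integral>\<^sup>+\<omega>. ennreal ((S v \<omega> - Y v \<omega>)\<^sup>2) \<partial>M)
    \<le> (\<integral>\<^sup>+\<omega>. 2 * ennreal ((S v \<omega> - R v \<omega>)\<^sup>2) + 2 * ennreal ((R v \<omega> - Y v \<omega>)\<^sup>2) \<partial>M)"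
    by (intro nn_integral_mono ennreal_square_diff_le)
  also have "\<dots> = 2 * (\<integral>\<^sup>+\<omega>. ennreal ((S v \<omega> - R v \<omega>)\<^sup>2) \<partial>M) + 2 * (\<integral>\<^sup>+\<omega>. ennreal ((R v \<omega> - Y v \<omega>)\<^sup>2) \<partial>M)"
    by (subst nn_integral_add) (auto simp: nn_integral_cmult)
  also have "\<dots> \<le> 2 * (2 * ennreal \<eta> + 2 * ennreal \<eta>) + 2 * ennreal \<eta>"
    using R SR unfolding approximates_def by (intro add_mono mult_left_mono) auto
  also have "\<dots> = ennreal (10 * \<eta>)"
  proof -
    have "2 * (2 * ennreal \<eta> + 2 * ennreal \<eta>) + 2 * ennreal \<eta> = 10 * ennreal \<eta>"
      by (simp flip: distrib_right mult.assoc mult_2)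
    then show ?thesis using \<eta> ennreal_mult[of 10 \<eta>] by simp
  qed
  finally show ?thesis .
qed

text \<open>Ito's formula for \<open>exp (\<i> \<mu> Y)\<close>, in expectation. It passes to the limit from step integrands because all
terms are controlled by mean square distances, uniformly in time. The integrand on the right is bounded,
so an estimate in mean square suffices also for the quadratic factor.\<close>

theorem exponential_formula:
  fixes \<mu> :: real
  assumes ab: "0 \<le> a" "a < b"
  defines "h \<equiv> \<lambda>v. \<integral>\<omega>. ((X\<^sub>1 v \<omega>)\<^sup>2 + (X\<^sub>2 v \<omega>)\<^sup>2) *\<^sub>R cis (\<mu> * Y v \<omega>) \<partial>M"
  assumes h: "h integrable_on {a..b}"
  shows "((\<integral>\<omega>. cis (\<mu> * Y b \<omega>) \<partial>M) - (\<integral>\<omega>. cis (\<mu> * Y a \<omega>) \<partial>M)) = - (\<mu>\<^sup>2 / 2) *\<^sub>R integral {a..b} h"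
proof -
  let ?\<phi> = "\<lambda>v. \<integral>\<omega>. cis (\<mu> * Y v \<omega>) \<partial>M"
  let ?\<Delta> = "(?\<phi> b - ?\<phi> a) - (- (\<mu>\<^sup>2 / 2) *\<^sub>R integral {a..b} h)"
  \<comment> \<open>\<open>W\<close> collects the errors \<open>11 \<bar>\<mu>\<bar> \<epsilon>\<close> at both ends and the error of the time integral\<close>
  define W where "W = 22 * \<bar>\<mu>\<bar> + \<mu>\<^sup>2 / 2 * ((2 + 22 * K\<^sup>2 * \<bar>\<mu>\<bar>) * (b - a) + 1 + K\<^sup>2)"
  have bound: "norm ?\<Delta> \<le> W * \<epsilon>" if \<epsilon>: "0 < \<epsilon>" "\<epsilon> \<le> 1" for \<epsilon>
  proof -
    \<comment> \<open>precision \<open>\<epsilon>\<^sup>2\<close> in mean square makes every term of order \<open>\<epsilon>\<close>, also those that are divided by \<open>\<epsilon>\<close>\<close>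
    have \<eta>: "0 < \<epsilon>\<^sup>2" using \<epsilon> by simp
    have b0: "0 \<le> b" using ab by simp
    obtain P S x\<^sub>1 x\<^sub>2 where A: "approximates b (\<epsilon>\<^sup>2) P S x\<^sub>1 x\<^sub>2"
      using approximation_exists[OF b0 \<eta>] by blast
    then have S: "simple_integral P S x\<^sub>1 x\<^sub>2"
      and sd_meas: "(\<lambda>t. sq_dist x\<^sub>1 x\<^sub>2 t * indicator {0..b} t) \<in> borel_measurable borel"
      and sd: "(\<integral>\<^sup>+t\<in>{0..b}. sq_dist x\<^sub>1 x\<^sub>2 t \<partial>lborel) \<le> ennreal (\<epsilon>\<^sup>2)"
      by (auto simp: approximates_def)
    obtain C where C: "\<And>v \<omega>. \<omega> \<in> space M \<Longrightarrow> \<bar>x\<^sub>1 v \<omega>\<bar> \<le> C \<and> \<bar>x\<^sub>2 v \<omega>\<bar> \<le> C"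
      using S unfolding simple_integral_def by auto
    note mS = simple_integralD(2-4)[OF S, THEN measurable_F_M]
    let ?\<psi> = "\<lambda>v. \<integral>\<omega>. cis (\<mu> * S v \<omega>) \<partial>M"
    let ?G = "\<lambda>v. \<integral>\<omega>. ((x\<^sub>1 v \<omega>)\<^sup>2 + (x\<^sub>2 v \<omega>)\<^sup>2) *\<^sub>R cis (\<mu> * S v \<omega>) \<partial>M"
    have close: "integrable M (\<lambda>\<omega>. \<bar>S v \<omega> - Y v \<omega>\<bar>)" "(\<integral>\<omega>. \<bar>S v \<omega> - Y v \<omega>\<bar> \<partial>M) \<le> 11 * \<epsilon>"
      if v: "0 \<le> v" "v \<le> b" for v
    proof -
      note * = abs_expectation_from_square[OF mS(1)[OF v(1)] Y_measurable[OF v(1)]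
        approximation_uniform[OF A \<eta> v] _ \<epsilon>(1)]
      show "integrable M (\<lambda>\<omega>. \<bar>S v \<omega> - Y v \<omega>\<bar>)" using * by simp
      have "\<epsilon> + 10 * \<epsilon>\<^sup>2 / \<epsilon> = 11 * \<epsilon>" using \<epsilon> by (simp add: power2_eq_square)
      with *(2) show "(\<integral>\<omega>. \<bar>S v \<omega> - Y v \<omega>\<bar> \<partial>M) \<le> 11 * \<epsilon>" by simp
    qed
    have \<psi>: "norm (?\<psi> v - ?\<phi> v) \<le> 11 * \<bar>\<mu>\<bar> * \<epsilon>" if v: "0 \<le> v" "v \<le> b" for v
    proof -
      note [measurable] = mS[OF v(1)] Y_measurable[OF v(1)]
      have "norm (?\<psi> v - ?\<phi> v) \<le> (\<integral>\<omega>. \<bar>\<mu>\<bar> * \<bar>S v \<omega> - Y v \<omega>\<bar> \<partial>M)"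
      proof (rule norm_expectation_diff_le)
        show "integrable M (\<lambda>\<omega>. cis (\<mu> * S v \<omega>))" "integrable M (\<lambda>\<omega>. cis (\<mu> * Y v \<omega>))"
          by (intro integrable_const_bound[where B=1]; simp)+
        show "integrable M (\<lambda>\<omega>. \<bar>\<mu>\<bar> * \<bar>S v \<omega> - Y v \<omega>\<bar>)" using close(1)[OF v] by simp
        show "norm (cis (\<mu> * S v \<omega>) - cis (\<mu> * Y v \<omega>)) \<le> \<bar>\<mu>\<bar> * \<bar>S v \<omega> - Y v \<omega>\<bar>" for \<omega>
          using norm_cis_diff_le[of "\<mu> * S v \<omega>" "\<mu> * Y v \<omega>"] by (simp add: abs_mult flip: right_diff_distrib)
      qed
      also have "\<dots> = \<bar>\<mu>\<bar> * (\<integral>\<omega>. \<bar>S v \<omega> - Y v \<omega>\<bar> \<partial>M)" by simp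
      also have "\<dots> \<le> \<bar>\<mu>\<bar> * (11 * \<epsilon>)" by (intro mult_left_mono close v) auto
      finally show ?thesis by (simp add: ac_simps)
    qed
    define f where "f v = enn2real (sq_dist x\<^sub>1 x\<^sub>2 v * indicator {0..b} v)" for v
    have d: "integrable M (\<lambda>\<omega>. (X\<^sub>1 v \<omega> - x\<^sub>1 v \<omega>)\<^sup>2 + (X\<^sub>2 v \<omega> - x\<^sub>2 v \<omega>)\<^sup>2)"
      "sq_dist x\<^sub>1 x\<^sub>2 v = ennreal (f v)"
      "(\<integral>\<omega>. (X\<^sub>1 v \<omega> - x\<^sub>1 v \<omega>)\<^sup>2 + (X\<^sub>2 v \<omega> - x\<^sub>2 v \<omega>)\<^sup>2 \<partial>M) = f v" if v: "0 \<le> v" "v \<le> b" for v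
    proof -
      note [measurable] = mS[OF v(1)] X_measurable[OF v(1)]
      have sq: "(x - y)\<^sup>2 \<le> (K + C)\<^sup>2" if "\<bar>x\<bar> \<le> K" "\<bar>y\<bar> \<le> C" for x y :: real
        using that power_mono[of "\<bar>x - y\<bar>" "K + C" 2] by simp
      show i: "integrable M (\<lambda>\<omega>. (X\<^sub>1 v \<omega> - x\<^sub>1 v \<omega>)\<^sup>2 + (X\<^sub>2 v \<omega> - x\<^sub>2 v \<omega>)\<^sup>2)"
      proof (rule integrable_const_bound[where B="(K + C)\<^sup>2 + (K + C)\<^sup>2"])
        have "(X\<^sub>1 v \<omega> - x\<^sub>1 v \<omega>)\<^sup>2 + (X\<^sub>2 v \<omega> - x\<^sub>2 v \<omega>)\<^sup>2 \<le> (K + C)\<^sup>2 + (K + C)\<^sup>2" if "\<omega> \<in> space M" for \<omega>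
          using X_bounded C[OF that] by (intro add_mono sq) auto
        then show "AE \<omega> in M. norm ((X\<^sub>1 v \<omega> - x\<^sub>1 v \<omega>)\<^sup>2 + (X\<^sub>2 v \<omega> - x\<^sub>2 v \<omega>)\<^sup>2) \<le> (K + C)\<^sup>2 + (K + C)\<^sup>2"
          by (intro AE_I2) simp
      qed measurable
      from nn_integral_eq_integral[OF i]
      have e: "sq_dist x\<^sub>1 x\<^sub>2 v = ennreal (\<integral>\<omega>. (X\<^sub>1 v \<omega> - x\<^sub>1 v \<omega>)\<^sup>2 + (X\<^sub>2 v \<omega> - x\<^sub>2 v \<omega>)\<^sup>2 \<partial>M)"
        by (simp add: sq_dist_def)
      with v show "(\<integral>\<omega>. (X\<^sub>1 v \<omega> - x\<^sub>1 v \<omega>)\<^sup>2 + (X\<^sub>2 v \<omega> - x\<^sub>2 v \<omega>)\<^sup>2 \<partial>M) = f v"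
        by (simp add: f_def)
      with e show "sq_dist x\<^sub>1 x\<^sub>2 v = ennreal (f v)" by simp
    qed
    have f0: "0 \<le> f v" for v by (simp add: f_def)
    have f_meas: "f \<in> borel_measurable borel" unfolding f_def using sd_meas by simp
    have "ennreal (f v) = sq_dist x\<^sub>1 x\<^sub>2 v * indicator {0..b} v" for v
      using d(2)[of v] by (cases "v \<in> {0..b}") (auto simp: f_def)
    then have nnf: "(\<integral>\<^sup>+v. ennreal (f v) \<partial>lborel) \<le> ennreal (\<epsilon>\<^sup>2)" using sd by simp
    have f_int: "f integrable_on UNIV"
      using le_less_trans[OF nnf ennreal_less_top] by (intro nn_integral_integrable_on f_meas f0) simp
    have "ennreal (integral UNIV f) \<le> ennreal (\<epsilon>\<^sup>2)"
      using nnf nn_integral_has_integral_lborel[OF f_meas f0 integrable_integral[OF f_int]] by simp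
    then have "integral UNIV f \<le> \<epsilon>\<^sup>2" by (simp add: ennreal_le_iff)
    moreover have f_ab: "f integrable_on {a..b}"
      using f_int integrable_on_subinterval by blast
    ultimately have f_le: "integral {a..b} f \<le> \<epsilon>\<^sup>2"
      using integral_subset_le[OF subset_UNIV f_ab f_int] f0 by simp
    have G: "norm (?G v - h v) \<le> (2 + 22 * K\<^sup>2 * \<bar>\<mu>\<bar>) * \<epsilon> + (1 + K\<^sup>2 / \<epsilon>) * f v" if v: "0 \<le> v" "v \<le> b" for v
    proof -
      note [measurable] = mS[OF v(1)] X_measurable[OF v(1)] Y_measurable[OF v(1)]
      let ?x = "\<lambda>\<omega>. (x\<^sub>1 v \<omega>)\<^sup>2 + (x\<^sub>2 v \<omega>)\<^sup>2" and ?X = "\<lambda>\<omega>. (X\<^sub>1 v \<omega>)\<^sup>2 + (X\<^sub>2 v \<omega>)\<^sup>2"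
      let ?d = "\<lambda>\<omega>. (X\<^sub>1 v \<omega> - x\<^sub>1 v \<omega>)\<^sup>2 + (X\<^sub>2 v \<omega> - x\<^sub>2 v \<omega>)\<^sup>2"
      have sq: "x\<^sup>2 \<le> R\<^sup>2" if "\<bar>x\<bar> \<le> R" for x R :: real
        using power_mono[OF that, of 2] by simp
      have X2: "?X \<omega> \<le> 2 * K\<^sup>2" for \<omega> using sq[OF X_bounded(1)[of v \<omega>]] sq[OF X_bounded(2)[of v \<omega>]] by simp
      have x2: "?x \<omega> \<le> 2 * C\<^sup>2" if "\<omega> \<in> space M" for \<omega> using sq[of "x\<^sub>1 v \<omega>" C] sq[of "x\<^sub>2 v \<omega>" C] C[OF that, of v] by auto
      have i1: "integrable M (\<lambda>\<omega>. ?x \<omega> *\<^sub>R cis (\<mu> * S v \<omega>))"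
        using x2 by (intro integrable_const_bound[where B="2 * C\<^sup>2"]) auto
      have i2: "integrable M (\<lambda>\<omega>. ?X \<omega> *\<^sub>R cis (\<mu> * Y v \<omega>))"
        using X2 by (intro integrable_const_bound[where B="2 * K\<^sup>2"]) auto
      have "norm (?G v - h v) \<le> (\<integral>\<omega>. (2 * \<epsilon> + (1 + K\<^sup>2 / \<epsilon>) * ?d \<omega>) + 2 * K\<^sup>2 * \<bar>\<mu>\<bar> * \<bar>S v \<omega> - Y v \<omega>\<bar> \<partial>M)"
        unfolding h_def
      proof (rule norm_expectation_diff_le[OF i1 i2])
        show "integrable M (\<lambda>\<omega>. (2 * \<epsilon> + (1 + K\<^sup>2 / \<epsilon>) * ?d \<omega>) + 2 * K\<^sup>2 * \<bar>\<mu>\<bar> * \<bar>S v \<omega> - Y v \<omega>\<bar>)"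
          by (rule Bochner_Integration.integrable_add[OF Bochner_Integration.integrable_add[OF integrable_const
              integrable_mult_right[OF d(1)[OF v]]] integrable_mult_right[OF close(1)[OF v]]])
        fix \<omega> assume "\<omega> \<in> space M"
        have "?x \<omega> *\<^sub>R cis (\<mu> * S v \<omega>) - ?X \<omega> *\<^sub>R cis (\<mu> * Y v \<omega>)
          = (?x \<omega> - ?X \<omega>) *\<^sub>R cis (\<mu> * S v \<omega>) + ?X \<omega> *\<^sub>R (cis (\<mu> * S v \<omega>) - cis (\<mu> * Y v \<omega>))"
          by (simp add: algebra_simps)
        also have "norm \<dots> \<le> \<bar>?x \<omega> - ?X \<omega>\<bar> + ?X \<omega> * norm (cis (\<mu> * S v \<omega>) - cis (\<mu> * Y v \<omega>))"
          by (rule order_trans[OF norm_triangle_ineq]) simp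
        also have "\<dots> \<le> (2 * \<epsilon> + (1 + K\<^sup>2 / \<epsilon>) * ?d \<omega>) + 2 * K\<^sup>2 * (\<bar>\<mu>\<bar> * \<bar>S v \<omega> - Y v \<omega>\<bar>)"
        proof (intro add_mono mult_mono X2)
          have "\<bar>?x \<omega> - ?X \<omega>\<bar> \<le> \<bar>(x\<^sub>1 v \<omega>)\<^sup>2 - (X\<^sub>1 v \<omega>)\<^sup>2\<bar> + \<bar>(x\<^sub>2 v \<omega>)\<^sup>2 - (X\<^sub>2 v \<omega>)\<^sup>2\<bar>" by linarith
          also have "\<dots> \<le> (\<epsilon> + (1 + K\<^sup>2 / \<epsilon>) * (X\<^sub>1 v \<omega> - x\<^sub>1 v \<omega>)\<^sup>2) + (\<epsilon> + (1 + K\<^sup>2 / \<epsilon>) * (X\<^sub>2 v \<omega> - x\<^sub>2 v \<omega>)\<^sup>2)"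
            by (intro add_mono abs_square_diff_le X_bounded \<epsilon>)
          finally show "\<bar>?x \<omega> - ?X \<omega>\<bar> \<le> 2 * \<epsilon> + (1 + K\<^sup>2 / \<epsilon>) * ?d \<omega>" by (simp add: distrib_left)
          show "norm (cis (\<mu> * S v \<omega>) - cis (\<mu> * Y v \<omega>)) \<le> \<bar>\<mu>\<bar> * \<bar>S v \<omega> - Y v \<omega>\<bar>"
            using norm_cis_diff_le[of "\<mu> * S v \<omega>" "\<mu> * Y v \<omega>"] by (simp add: abs_mult flip: right_diff_distrib)
        qed auto
        finally show "norm (?x \<omega> *\<^sub>R cis (\<mu> * S v \<omega>) - ?X \<omega> *\<^sub>R cis (\<mu> * Y v \<omega>))
          \<le> (2 * \<epsilon> + (1 + K\<^sup>2 / \<epsilon>) * ?d \<omega>) + 2 * K\<^sup>2 * \<bar>\<mu>\<bar> * \<bar>S v \<omega> - Y v \<omega>\<bar>" by (simp add: mult.assoc)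
      qed
      also have "\<dots> = 2 * \<epsilon> + (1 + K\<^sup>2 / \<epsilon>) * (\<integral>\<omega>. ?d \<omega> \<partial>M) + 2 * K\<^sup>2 * \<bar>\<mu>\<bar> * (\<integral>\<omega>. \<bar>S v \<omega> - Y v \<omega>\<bar> \<partial>M)"
      proof -
        have j: "integrable M (\<lambda>\<omega>. (1 + K\<^sup>2 / \<epsilon>) * ?d \<omega>)" "integrable M (\<lambda>\<omega>. 2 * K\<^sup>2 * \<bar>\<mu>\<bar> * \<bar>S v \<omega> - Y v \<omega>\<bar>)"
          by (rule integrable_mult_right[OF d(1)[OF v]], rule integrable_mult_right[OF close(1)[OF v]])
        show ?thesis
          unfolding Bochner_Integration.integral_add[OF Bochner_Integration.integrable_add[OF integrable_const j(1)] j(2)]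
            Bochner_Integration.integral_add[OF integrable_const j(1)]
          by (simp add: prob_space)
      qed
      also have "\<dots> \<le> 2 * \<epsilon> + (1 + K\<^sup>2 / \<epsilon>) * f v + 2 * K\<^sup>2 * \<bar>\<mu>\<bar> * (11 * \<epsilon>)"
        unfolding d(3)[OF v] by (intro add_left_mono mult_left_mono close v) auto
      finally show ?thesis by (simp add: algebra_simps)
    qed
    let ?D = "\<lambda>v. - (\<mu>\<^sup>2 / 2) *\<^sub>R ?G v - (- (\<mu>\<^sup>2 / 2) *\<^sub>R h v)"
    let ?g = "\<lambda>v. \<mu>\<^sup>2 / 2 * ((2 + 22 * K\<^sup>2 * \<bar>\<mu>\<bar>) * \<epsilon> + (1 + K\<^sup>2 / \<epsilon>) * f v)"
    have D: "(?D has_integral (?\<psi> b - ?\<psi> a) - (- (\<mu>\<^sup>2 / 2) *\<^sub>R integral {a..b} h)) {a..b}"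
      by (intro has_integral_diff has_integral_cmul simple_integral_exponential[OF S ab] integrable_integral h)
    have g: "(?g has_integral \<mu>\<^sup>2 / 2 * ((2 + 22 * K\<^sup>2 * \<bar>\<mu>\<bar>) * \<epsilon> * (b - a) + (1 + K\<^sup>2 / \<epsilon>) * integral {a..b} f)) {a..b}"
      using has_integral_const_real[of "(2 + 22 * K\<^sup>2 * \<bar>\<mu>\<bar>) * \<epsilon>" a b] ab
      by (intro has_integral_mult_right has_integral_add integrable_integral f_ab) (simp add: mult.commute)
    have "norm (integral {a..b} ?D) \<le> integral {a..b} ?g"
    proof (rule integral_norm_bound_integral)
      show "?D integrable_on {a..b}" "?g integrable_on {a..b}" using D g by blast+
      fix v assume "v \<in> {a..b}"
      then have v: "0 \<le> v" "v \<le> b" using ab by auto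
      have "?D v = - (\<mu>\<^sup>2 / 2) *\<^sub>R (?G v - h v)" by (simp add: scaleR_diff_right)
      then have "norm (?D v) = \<mu>\<^sup>2 / 2 * norm (?G v - h v)" by simp
      also have "\<dots> \<le> ?g v" using G[OF v] by (intro mult_left_mono) auto
      finally show "norm (?D v) \<le> ?g v" .
    qed
    then have "norm ((?\<psi> b - ?\<psi> a) - (- (\<mu>\<^sup>2 / 2) *\<^sub>R integral {a..b} h))
        \<le> \<mu>\<^sup>2 / 2 * ((2 + 22 * K\<^sup>2 * \<bar>\<mu>\<bar>) * \<epsilon> * (b - a) + (1 + K\<^sup>2 / \<epsilon>) * integral {a..b} f)"
      unfolding integral_unique[OF D] integral_unique[OF g] .
    also have "\<dots> \<le> \<mu>\<^sup>2 / 2 * (((2 + 22 * K\<^sup>2 * \<bar>\<mu>\<bar>) * (b - a) + 1 + K\<^sup>2) * \<epsilon>)"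
    proof (intro mult_left_mono)
      have "(1 + K\<^sup>2 / \<epsilon>) * integral {a..b} f \<le> (1 + K\<^sup>2 / \<epsilon>) * \<epsilon>\<^sup>2"
        using f_le \<epsilon> by (intro mult_left_mono) auto
      also have "\<dots> = \<epsilon> * \<epsilon> + K\<^sup>2 * \<epsilon>" using \<epsilon> by (simp add: field_simps power2_eq_square)
      also have "\<dots> \<le> 1 * \<epsilon> + K\<^sup>2 * \<epsilon>" using \<epsilon> by (intro add_right_mono mult_right_mono) auto
      finally show "(2 + 22 * K\<^sup>2 * \<bar>\<mu>\<bar>) * \<epsilon> * (b - a) + (1 + K\<^sup>2 / \<epsilon>) * integral {a..b} f
          \<le> ((2 + 22 * K\<^sup>2 * \<bar>\<mu>\<bar>) * (b - a) + 1 + K\<^sup>2) * \<epsilon>"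
        by (simp add: algebra_simps)
    qed auto
    finally have main: "norm ((?\<psi> b - ?\<psi> a) - (- (\<mu>\<^sup>2 / 2) *\<^sub>R integral {a..b} h))
        \<le> \<mu>\<^sup>2 / 2 * (((2 + 22 * K\<^sup>2 * \<bar>\<mu>\<bar>) * (b - a) + 1 + K\<^sup>2) * \<epsilon>)" .
    have "?\<Delta> = ((?\<psi> b - ?\<psi> a) - (- (\<mu>\<^sup>2 / 2) *\<^sub>R integral {a..b} h)) - (?\<psi> b - ?\<phi> b) + (?\<psi> a - ?\<phi> a)"
      by simp
    then have "norm ?\<Delta> \<le> norm ((?\<psi> b - ?\<psi> a) - (- (\<mu>\<^sup>2 / 2) *\<^sub>R integral {a..b} h))
        + norm (?\<psi> b - ?\<phi> b) + norm (?\<psi> a - ?\<phi> a)"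
      by (metis (no_types, lifting) norm_triangle_mono norm_triangle_ineq4 order_refl)
    also have "\<dots> \<le> \<mu>\<^sup>2 / 2 * (((2 + 22 * K\<^sup>2 * \<bar>\<mu>\<bar>) * (b - a) + 1 + K\<^sup>2) * \<epsilon>) + 11 * \<bar>\<mu>\<bar> * \<epsilon> + 11 * \<bar>\<mu>\<bar> * \<epsilon>"
      using ab by (intro add_mono main \<psi>) auto
    also have "\<dots> = W * \<epsilon>" by (simp add: W_def distrib_right)
    finally show ?thesis .
  qed
  have "norm ?\<Delta> \<le> 0"
  proof (rule tendsto_lowerbound)
    have "((\<lambda>\<epsilon>. W * \<epsilon>) \<longlongrightarrow> W * 0) (at_right 0)" by (intro tendsto_intros)
    then show "((\<lambda>\<epsilon>. W * \<epsilon>) \<longlongrightarrow> 0) (at_right 0)" by simp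
    show "\<forall>\<^sub>F \<epsilon> in at_right 0. norm ?\<Delta> \<le> W * \<epsilon>"
      using bound unfolding eventually_at_right_field by (intro exI[of _ 1]) auto
  qed simp
  then have "?\<Delta> = 0" by (simp only: norm_le_zero_iff)
  then show ?thesis by (simp only: right_minus_eq)
qed

end

section \<open>The hierarchy of exponential moments of the phase\<close>

lemma cis_mult_cos:
  "cis (\<mu> * a) * (2 * complex_of_real (cos a)) = cis ((\<mu> + 1) * a) + cis ((\<mu> - 1) * a)"
proof -
  have "2 * complex_of_real (cos a) = cis a + cis (- a)" by (simp add: complex_eq_iff)
  then show ?thesis by (simp only: distrib_left cis_mult) (simp add: algebra_simps)
qed

locale sine_diffusion = brownian_pair M F B\<^sub>1 B\<^sub>2
  for M :: "'a measure" and F B\<^sub>1 B\<^sub>2 +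
  fixes \<beta> l :: real and \<alpha> :: "real \<Rightarrow> 'a \<Rightarrow> real"
  assumes \<beta>: "0 < \<beta>" and solution: "sine_sde_solution \<beta> M F B\<^sub>1 B\<^sub>2 l \<alpha>"
begin

definition rate :: "real \<Rightarrow> real" where "rate t = l * (\<beta> / 4) * exp (- (\<beta> / 4) * t)"

text \<open>The integral of the rate over \<open>[0, t]\<close>.\<close>

definition drift :: "real \<Rightarrow> real" where "drift t = l * (1 - exp (- (\<beta> / 4) * t))"

definition moment :: "real \<Rightarrow> real \<Rightarrow> complex" where "moment \<mu> t = (\<integral>\<omega>. cis (\<mu> * \<alpha> t \<omega>) \<partial>M)"

lemma drift_derivative: "(drift has_vector_derivative rate t) (at t within S)"
  unfolding drift_def[abs_def] rate_def has_real_derivative_iff_has_vector_derivative[symmetric]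
  by (auto intro!: derivative_eq_intros)

lemma continuous_drift: "continuous_on S drift"
  by (auto simp: drift_def[abs_def] intro!: continuous_intros)

lemma cis_drift_derivative:
  "((\<lambda>v. cis (a * drift v)) has_vector_derivative (\<i> * of_real (a * rate t)) * cis (a * drift t)) (at t)"
proof -
  have "((\<lambda>v. \<i> * of_real (a * drift v)) has_vector_derivative \<i> * of_real (a * rate t)) (at t)"
    by (intro has_vector_derivative_mult_right has_vector_derivative_of_real
        DERIV_cmult drift_derivative[unfolded has_real_derivative_iff_has_vector_derivative[symmetric]])
  from field_vector_diff_chain_at[OF this DERIV_exp] show ?thesis
    by (simp only: comp_def cis_conv_exp)
qed

lemma drift_0: "drift 0 = 0" by (simp add: drift_def)

lemma rate_integral: "0 \<le> t \<Longrightarrow> integral {0..t} (\<lambda>s. l * (\<beta> / 4) * exp (- (\<beta> / 4) * s)) = drift t"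
  unfolding rate_def[symmetric]
  using fundamental_theorem_of_calculus[of 0 t drift rate] drift_derivative drift_0
  by (simp add: integral_unique)

lemma \<alpha>_measurable: "0 \<le> t \<Longrightarrow> \<alpha> t \<in> borel_measurable M"
  using solution measurable_F_M[of "\<alpha> t" t borel] by (simp add: sine_sde_solution_def adapted_def)

lemma cis_\<alpha>_integrable: "0 \<le> t \<Longrightarrow> integrable M (\<lambda>\<omega>. cis (\<mu> * \<alpha> t \<omega>))"
  using \<alpha>_measurable by (intro integrable_const_bound[where B=1]) auto

lemma norm_moment_le: "norm (moment \<mu> t) \<le> 1"
proof -
  have "norm (moment \<mu> t) \<le> (\<integral>\<omega>. norm (cis (\<mu> * \<alpha> t \<omega>)) \<partial>M)"
    unfolding moment_def by (rule integral_norm_bound)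
  then show ?thesis by (simp add: prob_space)
qed

lemma moment_0: "moment \<mu> 0 = 1"
proof -
  have "AE \<omega> in M. \<alpha> 0 \<omega> = 0" using solution by (simp add: sine_sde_solution_def)
  then have "moment \<mu> 0 = (\<integral>\<omega>. 1 \<partial>M)"
    unfolding moment_def using \<alpha>_measurable[of 0] by (intro integral_cong_AE) auto
  then show ?thesis by (simp add: prob_space)
qed

lemma continuous_moment: "continuous_on {0..} (moment \<mu>)"
  unfolding continuous_on_sequentially
proof (intro allI ballI impI)
  fix x :: "nat \<Rightarrow> real" and a assume x: "a \<in> {0..}" "(\<forall>n. x n \<in> {0..}) \<and> x \<longlonglongrightarrow> a"
  have cont: "AE \<omega> in M. continuous_on {0..} (\<lambda>t. \<alpha> t \<omega>)"
    using solution by (simp add: sine_sde_solution_def)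
  have "(\<lambda>n. \<integral>\<omega>. cis (\<mu> * \<alpha> (x n) \<omega>) \<partial>M) \<longlonglongrightarrow> (\<integral>\<omega>. cis (\<mu> * \<alpha> a \<omega>) \<partial>M)"
  proof (rule integral_dominated_convergence[where w="\<lambda>_. 1"])
    show "(\<lambda>\<omega>. cis (\<mu> * \<alpha> a \<omega>)) \<in> borel_measurable M" "\<And>n. (\<lambda>\<omega>. cis (\<mu> * \<alpha> (x n) \<omega>)) \<in> borel_measurable M"
      using \<alpha>_measurable x by auto
    show "AE \<omega> in M. (\<lambda>n. cis (\<mu> * \<alpha> (x n) \<omega>)) \<longlonglongrightarrow> cis (\<mu> * \<alpha> a \<omega>)"
      using cont
    proof eventually_elim
      case (elim \<omega>)
      then have "(\<lambda>n. \<alpha> (x n) \<omega>) \<longlonglongrightarrow> \<alpha> a \<omega>"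
        using x unfolding continuous_on_sequentially by (auto simp: comp_def)
      then show ?case by (intro tendsto_intros)
    qed
  qed auto
  then show "(moment \<mu> \<circ> x) \<longlonglongrightarrow> moment \<mu> a" by (simp add: comp_def moment_def)
qed

text \<open>This is the exponential formula for the martingale part of the phase, whose bracket has density
\<open>(cos \<alpha> - 1)\<^sup>2 + sin\<^sup>2 \<alpha> = 2 - 2 cos \<alpha>\<close>. Multiplying an exponential by \<open>2 cos \<alpha>\<close> gives its two neighbours, so
the right-hand side consists of moments again. They are continuous in time because the paths are, and
this turns the integral equation into a differential equation.\<close>

lemma moment_derivative:
  assumes t: "0 < t"
  shows "(moment \<mu> has_vector_derivative
     (\<i> * of_real (\<mu> * rate t) * moment \<mu> t + of_real (\<mu>\<^sup>2 / 2) * (moment (\<mu> + 1) t - 2 * moment \<mu> t + moment (\<mu> - 1) t))) (at t)"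
proof -
  let ?Y = "\<lambda>t \<omega>. \<alpha> t \<omega> - drift t"
  let ?X\<^sub>1 = "\<lambda>s \<omega>. Re (cis (- \<alpha> s \<omega>) - 1)" and ?X\<^sub>2 = "\<lambda>s \<omega>. - Im (cis (- \<alpha> s \<omega>) - 1)"
  interpret Y: ito_pair M F B\<^sub>1 B\<^sub>2 ?X\<^sub>1 ?X\<^sub>2 ?Y 2
  proof
    show "?Y v \<in> borel_measurable M" if "0 \<le> v" for v using \<alpha>_measurable[OF that] by simp
    show "\<bar>?X\<^sub>1 v \<omega>\<bar> \<le> 2" for v \<omega>
      using abs_cos_le_one[of "\<alpha> v \<omega>"] by (simp add: abs_le_iff)
    show "\<bar>?X\<^sub>2 v \<omega>\<bar> \<le> 2" for v \<omega>
      using order_trans[OF abs_sin_le_one[of "\<alpha> v \<omega>"], of 2] by simp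
    fix t :: real assume t: "0 \<le> t"
    then obtain I\<^sub>1 I\<^sub>2 where I: "has_ito_integral M F B\<^sub>1 t ?X\<^sub>1 I\<^sub>1" "has_ito_integral M F B\<^sub>2 t ?X\<^sub>2 I\<^sub>2"
      and \<alpha>: "AE \<omega> in M. \<alpha> t \<omega> = integral {0..t} (\<lambda>s. l * (\<beta> / 4) * exp (- (\<beta> / 4) * s)) + I\<^sub>1 \<omega> + I\<^sub>2 \<omega>"
      using solution unfolding sine_sde_solution_def by blast
    have "AE \<omega> in M. ?Y t \<omega> = I\<^sub>1 \<omega> + I\<^sub>2 \<omega>"
      using \<alpha> unfolding rate_integral[OF t] by eventually_elim simp
    with I show "\<exists>I\<^sub>1 I\<^sub>2. has_ito_integral M F B\<^sub>1 t ?X\<^sub>1 I\<^sub>1 \<and> has_ito_integral M F B\<^sub>2 t ?X\<^sub>2 I\<^sub>2 \<and>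
      (AE \<omega> in M. ?Y t \<omega> = I\<^sub>1 \<omega> + I\<^sub>2 \<omega>)" by blast
  qed
  let ?q = "\<lambda>v. cis (- \<mu> * drift v) * moment \<mu> v"
  let ?h = "\<lambda>v. cis (- \<mu> * drift v) * (2 * moment \<mu> v - moment (\<mu> + 1) v - moment (\<mu> - 1) v)"
  have q: "(\<integral>\<omega>. cis (\<mu> * ?Y v \<omega>) \<partial>M) = ?q v" for v
    unfolding moment_def integral_mult_right_zero[symmetric] cis_mult
    by (simp add: algebra_simps)
  have h: "(\<integral>\<omega>. ((?X\<^sub>1 v \<omega>)\<^sup>2 + (?X\<^sub>2 v \<omega>)\<^sup>2) *\<^sub>R cis (\<mu> * ?Y v \<omega>) \<partial>M) = ?h v" if v: "0 \<le> v" for v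
  proof -
    note i = cis_\<alpha>_integrable[OF v]
    have "?h v = cis (- \<mu> * drift v) *
        (\<integral>\<omega>. 2 * cis (\<mu> * \<alpha> v \<omega>) - cis ((\<mu> + 1) * \<alpha> v \<omega>) - cis ((\<mu> - 1) * \<alpha> v \<omega>) \<partial>M)"
      unfolding moment_def using i[of \<mu>] i[of "\<mu> + 1"] i[of "\<mu> - 1"] by simp
    also have "\<dots> = (\<integral>\<omega>. cis (- \<mu> * drift v) *
        (2 * cis (\<mu> * \<alpha> v \<omega>) - cis ((\<mu> + 1) * \<alpha> v \<omega>) - cis ((\<mu> - 1) * \<alpha> v \<omega>)) \<partial>M)"
      by (rule integral_mult_right_zero[symmetric])
    also have "\<dots> = (\<integral>\<omega>. ((?X\<^sub>1 v \<omega>)\<^sup>2 + (?X\<^sub>2 v \<omega>)\<^sup>2) *\<^sub>R cis (\<mu> * ?Y v \<omega>) \<partial>M)"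
    proof (intro Bochner_Integration.integral_cong refl)
      fix \<omega>
      let ?a = "\<alpha> v \<omega>"
      have 1: "(?X\<^sub>1 v \<omega>)\<^sup>2 + (?X\<^sub>2 v \<omega>)\<^sup>2 = 2 - 2 * cos ?a"
        using sin_cos_squared_add[of ?a] by (simp add: power2_diff)
      have 2: "cis (\<mu> * ?Y v \<omega>) = cis (- \<mu> * drift v) * cis (\<mu> * ?a)"
        by (simp add: cis_mult right_diff_distrib)
      show "cis (- \<mu> * drift v) * (2 * cis (\<mu> * ?a) - cis ((\<mu> + 1) * ?a) - cis ((\<mu> - 1) * ?a))
        = ((?X\<^sub>1 v \<omega>)\<^sup>2 + (?X\<^sub>2 v \<omega>)\<^sup>2) *\<^sub>R cis (\<mu> * ?Y v \<omega>)"
        unfolding 1 2 scaleR_conv_of_real diff_diff_eq cis_mult_cos[of \<mu> ?a, symmetric] by (simp add: algebra_simps)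
    qed
    finally show ?thesis by simp
  qed
  have ch: "continuous_on {0..} ?h"
    by (intro continuous_intros continuous_moment continuous_drift)
  have qt: "?q u = 1 + (- (\<mu>\<^sup>2 / 2)) *\<^sub>R integral {0..u} ?h" if u: "0 \<le> u" for u
  proof (cases "u = 0")
    case False
    with u have u: "0 < u" by simp
    have hi: "?h integrable_on {0..u}"
      by (intro integrable_continuous_interval continuous_on_subset[OF ch]) auto
    have eq: "((\<lambda>v. \<integral>\<omega>. ((?X\<^sub>1 v \<omega>)\<^sup>2 + (?X\<^sub>2 v \<omega>)\<^sup>2) *\<^sub>R cis (\<mu> * ?Y v \<omega>) \<partial>M) has_integral integral {0..u} ?h) {0..u}"
      by (rule has_integral_eq[OF _ integrable_integral[OF hi]]) (rule h[symmetric], simp)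
    have "?q u - ?q 0 = - (\<mu>\<^sup>2 / 2) *\<^sub>R integral {0..u} ?h"
      using Y.exponential_formula[OF order_refl u has_integral_integrable[OF eq]]
      unfolding q integral_unique[OF eq] .
    then have "?q u = ?q 0 + - (\<mu>\<^sup>2 / 2) *\<^sub>R integral {0..u} ?h" by (simp only: diff_eq_eq add.commute)
    also have "?q 0 = 1" by (simp add: moment_0 drift_0)
    finally show ?thesis .
  qed (simp add: moment_0 drift_0)
  have sub: "{0..t + 1} \<subseteq> {0..}" and mem: "t \<in> {0..t + 1}" and int: "t \<in> interior {0..t + 1}"
    using t by auto
  have dI: "((\<lambda>u. integral {0..u} ?h) has_vector_derivative ?h t) (at t)"
    using integral_has_vector_derivative[OF continuous_on_subset[OF ch sub] mem]
    unfolding at_within_interior[OF int] .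
  have "((\<lambda>u. 1 + (- (\<mu>\<^sup>2 / 2)) *\<^sub>R integral {0..u} ?h) has_vector_derivative 0 + - (\<mu>\<^sup>2 / 2) *\<^sub>R ?h t) (at t)"
    by (rule has_vector_derivative_add[OF has_vector_derivative_const
          bounded_linear.has_vector_derivative[OF bounded_linear_scaleR_right dI]])
  then have "((\<lambda>u. 1 + (- (\<mu>\<^sup>2 / 2)) *\<^sub>R integral {0..u} ?h) has_vector_derivative - (\<mu>\<^sup>2 / 2) *\<^sub>R ?h t) (at t)"
    unfolding add_0_left .
  then have dq: "(?q has_vector_derivative - (\<mu>\<^sup>2 / 2) *\<^sub>R ?h t) (at t)"
  proof (rule has_vector_derivative_transform_within_open[where S="{0<..}"])
    show "1 + (- (\<mu>\<^sup>2 / 2)) *\<^sub>R integral {0..u} ?h = ?q u" if "u \<in> {0<..}" for u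
      using qt[of u, symmetric] that by simp
  qed (use t in auto)
  have cancel: "cis (\<mu> * drift v) * (cis (- \<mu> * drift v) * z) = z" for v z
    by (simp add: cis_mult flip: mult.assoc)
  have "((\<lambda>v. cis (\<mu> * drift v) * ?q v) has_vector_derivative
      (cis (\<mu> * drift t) * (- (\<mu>\<^sup>2 / 2) *\<^sub>R ?h t) + (\<i> * of_real (\<mu> * rate t)) * cis (\<mu> * drift t) * ?q t)) (at t)"
    by (rule has_vector_derivative_mult[OF cis_drift_derivative dq])
  also have "(\<lambda>v. cis (\<mu> * drift v) * ?q v) = moment \<mu>"
    unfolding cancel ..
  also have "cis (\<mu> * drift t) * (- (\<mu>\<^sup>2 / 2) *\<^sub>R ?h t) + (\<i> * of_real (\<mu> * rate t)) * cis (\<mu> * drift t) * ?q t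
    = - (\<mu>\<^sup>2 / 2) *\<^sub>R (2 * moment \<mu> t - moment (\<mu> + 1) t - moment (\<mu> - 1) t) + (\<i> * of_real (\<mu> * rate t)) * moment \<mu> t"
    unfolding mult_scaleR_right mult.assoc[of _ "cis (\<mu> * drift t)"] cancel ..
  also have "\<dots> = \<i> * of_real (\<mu> * rate t) * moment \<mu> t + of_real (\<mu>\<^sup>2 / 2) * (moment (\<mu> + 1) t - 2 * moment \<mu> t + moment (\<mu> - 1) t)"
    by (simp add: scaleR_conv_of_real field_simps)
  finally show ?thesis .
qed

end

section \<open>The late phase: bounded fluctuation\<close>

lemma geometric_tail_bound:
  fixes f :: "nat \<Rightarrow> complex"
  assumes "f sums s" "\<And>n. norm (f n) \<le> \<rho> ^ n" "0 \<le> \<rho>" "\<rho> < 1"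
  shows "norm (s - (\<Sum>n<N. f n)) \<le> \<rho> ^ N / (1 - \<rho>)"
proof -
  have "(\<lambda>n. f (n + N)) sums (s - (\<Sum>n<N. f n))"
    using sums_split_initial_segment[OF assms(1)] by simp
  moreover have "(\<lambda>n. \<rho> ^ N * \<rho> ^ n) sums (\<rho> ^ N * (1 / (1 - \<rho>)))"
    using assms by (intro sums_mult geometric_sums) auto
  moreover have "norm (f (n + N)) \<le> \<rho> ^ N * \<rho> ^ n" for n
    using assms(2)[of "n + N"] by (simp add: power_add mult.commute)
  ultimately show ?thesis using norm_sums_le by fastforce
qed

text \<open>The weights \<open>c k = \<rho>\<^sup>k\<^sup>+\<^sup>1\<close>, with \<open>\<rho>\<close> close to one and \<open>K\<close> large, approximate \<open>c k = 1\<close>. With unit weights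
and \<open>\<bar>z\<bar> = 1\<close> the first sum is formally \<open>(z - 1)\<^sup>2/(2 (1 - z)) = (1 - z)/2\<close>, and the second is
\<open>- Ln (1 - z)\<close>, whose imaginary part is a sawtooth between \<open>- \<pi>/2\<close> and \<open>\<pi>/2\<close>. Damping by \<open>\<rho>\<close> makes the
first approximation uniform in \<open>z\<close>, because \<open>\<bar>1 - z\<bar> \<le> 2 \<bar>1 - \<rho> z\<bar>\<close>.\<close>

lemma sawtooth_weights:
  fixes \<delta> :: real
  assumes \<delta>: "0 < \<delta>"
  shows "\<exists>K c. (\<forall>k. 0 \<le> c k \<and> c k \<le> 1) \<and> (\<forall>z. norm z = 1 \<longrightarrow>
      (1 - Re z) / 2 - \<delta> \<le> Re ((z - 1)\<^sup>2 / 2 * (\<Sum>k<K. of_real (c k) * z ^ k)) \<and>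
      \<bar>Im (\<Sum>k<K. of_real (c k) * z ^ Suc k / of_nat (Suc k))\<bar> \<le> 3)"
proof -
  define \<rho> where "\<rho> = max (1 / 2) (1 - \<delta> / 2)"
  have \<rho>: "0 < \<rho>" "\<rho> < 1" "1 - \<rho> \<le> \<delta> / 2" using \<delta> by (auto simp: \<rho>_def max_def)
  have "(\<lambda>K. 2 * (\<rho> ^ K / (1 - \<rho>))) \<longlonglongrightarrow> 2 * (0 / (1 - \<rho>))"
    using \<rho> by (intro tendsto_intros LIMSEQ_realpow_zero) auto
  then have "\<forall>\<^sub>F K in sequentially. 2 * (\<rho> ^ K / (1 - \<rho>)) < min (\<delta> / 2) (1 / 5)"
    using \<delta> by (intro order_tendstoD(2)) auto
  then obtain K where K: "2 * (\<rho> ^ K / (1 - \<rho>)) < \<delta> / 2" "\<rho> ^ K / (1 - \<rho>) < 1 / 5"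
    using eventually_happens'[OF sequentially_bot] by force
  have tail: "\<rho> ^ Suc K / (1 - \<rho>) \<le> \<rho> ^ K / (1 - \<rho>)"
    using \<rho> by (intro divide_right_mono) (auto intro: mult_left_le_one_le)
  have "(1 - Re z) / 2 - \<delta> \<le> Re ((z - 1)\<^sup>2 / 2 * (\<Sum>k<K. of_real (\<rho> ^ Suc k) * z ^ k)) \<and>
      \<bar>Im (\<Sum>k<K. of_real (\<rho> ^ Suc k) * z ^ Suc k / of_nat (Suc k))\<bar> \<le> 3" if z: "norm z = 1" for z
  proof
    let ?w = "of_real \<rho> * z"
    have w: "norm ?w = \<rho>" using z \<rho> by (simp add: norm_mult)
    have lower: "1 - \<rho> \<le> norm (1 - ?w)" using norm_triangle_ineq2[of 1 ?w] w by simp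
    have w1: "1 - ?w \<noteq> 0" using lower \<rho> by auto
    have "norm (1 - z) \<le> norm (1 - ?w) + norm (?w - z)"
      using norm_triangle_ineq[of "1 - ?w" "?w - z"] by simp
    also have "norm (?w - z) = 1 - \<rho>"
    proof -
      have "?w - z = of_real (\<rho> - 1) * z" by (simp add: algebra_simps)
      then show ?thesis using z \<rho> by (simp only: norm_mult norm_of_real) simp
    qed
    finally have z1: "norm (1 - z) \<le> 2 * norm (1 - ?w)" using lower by simp
    let ?Q = "(z - 1)\<^sup>2 / 2 * (of_real \<rho> / (1 - ?w))"
    have "(\<lambda>k. ?w ^ k) sums (1 / (1 - ?w))" using w \<rho> by (intro geometric_sums) simp
    then have geom: "norm (1 / (1 - ?w) - (\<Sum>k<K. ?w ^ k)) \<le> \<rho> ^ K / (1 - \<rho>)"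
      using w \<rho> by (intro geometric_tail_bound) (auto simp: norm_power)
    have "norm ((z - 1)\<^sup>2 / 2 * of_real \<rho> * (1 / (1 - ?w) - (\<Sum>k<K. ?w ^ k))) \<le> 2 * (\<rho> ^ K / (1 - \<rho>))"
    proof -
      have "norm (z - 1) \<le> 2" using norm_triangle_ineq4[of z 1] z by simp
      then have "norm ((z - 1)\<^sup>2 / 2) \<le> 2"
        using power_mono[of "norm (z - 1)" 2 2] by (simp add: norm_power norm_divide)
      then have "norm ((z - 1)\<^sup>2 / 2 * of_real \<rho>) \<le> 2 * 1"
        unfolding norm_mult using \<rho> by (intro mult_mono) auto
      then show ?thesis
        unfolding norm_mult[of "(z - 1)\<^sup>2 / 2 * of_real \<rho>"] using geom by (intro mult_mono) auto
    qed
    also have "(z - 1)\<^sup>2 / 2 * of_real \<rho> * (1 / (1 - ?w) - (\<Sum>k<K. ?w ^ k))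
        = ?Q - (z - 1)\<^sup>2 / 2 * (\<Sum>k<K. of_real (\<rho> ^ Suc k) * z ^ k)"
      by (simp add: right_diff_distrib sum_distrib_left power_mult_distrib mult.assoc)
    finally have 1: "norm (?Q - (z - 1)\<^sup>2 / 2 * (\<Sum>k<K. of_real (\<rho> ^ Suc k) * z ^ k)) \<le> \<delta> / 2"
      using K(1) by simp
    \<comment> \<open>the damping costs \<open>(1 - \<rho>) \<bar>1 - z\<bar>/(2 \<bar>1 - \<rho> z\<bar>) \<le> 1 - \<rho>\<close>\<close>
    have "(1 - z) / 2 - ?Q = (1 - z) * (of_real (1 - \<rho>)) / (2 * (1 - ?w))"
      using w1 by (simp add: field_simps power2_eq_square)
    then have "norm ((1 - z) / 2 - ?Q) = norm (1 - z) * (1 - \<rho>) / (2 * norm (1 - ?w))"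
      using \<rho> by (simp only: norm_mult norm_divide norm_of_real) simp
    also have "\<dots> \<le> 2 * norm (1 - ?w) * (1 - \<rho>) / (2 * norm (1 - ?w))"
      using z1 \<rho> by (intro divide_right_mono mult_right_mono) auto
    also have "\<dots> = 1 - \<rho>" using w1 by simp
    finally have 2: "norm ((1 - z) / 2 - ?Q) \<le> \<delta> / 2" using \<rho> by simp
    have "norm ((1 - z) / 2 - (z - 1)\<^sup>2 / 2 * (\<Sum>k<K. of_real (\<rho> ^ Suc k) * z ^ k)) \<le> \<delta>"
      using norm_triangle_mono[OF 2 1] by simp
    then have *: "Re ((1 - z) / 2 - (z - 1)\<^sup>2 / 2 * (\<Sum>k<K. of_real (\<rho> ^ Suc k) * z ^ k)) \<le> \<delta>"
      using complex_Re_le_cmod order_trans by blast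
    show "(1 - Re z) / 2 - \<delta> \<le> Re ((z - 1)\<^sup>2 / 2 * (\<Sum>k<K. of_real (\<rho> ^ Suc k) * z ^ k))"
    proof -
      have "Re ((1 - z) / 2 - X) = (1 - Re z) / 2 - Re X" for X by simp
      from *[unfolded this] show ?thesis by linarith
    qed
  next
    let ?w = "of_real \<rho> * z"
    have w: "norm ?w = \<rho>" using z \<rho> by (simp add: norm_mult)
    have "Re ?w \<le> \<rho>" using complex_Re_le_cmod[of ?w] unfolding w .
    then have Rew: "0 < Re (1 - ?w)" using \<rho>(2) unfolding minus_complex.sel(1) one_complex.sel(1) by linarith
    have "(\<lambda>n. - ((- (- ?w)) ^ n) / of_nat n) sums ln (1 + (- ?w))"
      using w \<rho> by (intro Ln_series') simp
    then have "(\<lambda>n. - (?w ^ n) / of_nat n) sums ln (1 - ?w)" by simp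
    moreover have "norm (- (?w ^ n) / of_nat n) \<le> \<rho> ^ n" for n
      using \<rho> by (cases "n = 0") (auto simp: norm_divide norm_power w divide_le_eq mult_le_cancel_left1)
    ultimately have "norm (ln (1 - ?w) - (\<Sum>n<Suc K. - (?w ^ n) / of_nat n)) \<le> \<rho> ^ Suc K / (1 - \<rho>)"
      using \<rho> by (intro geometric_tail_bound) auto
    also have "\<dots> < 1 / 5" by (rule order_le_less_trans[OF tail K(2)])
    also have "(\<Sum>n<Suc K. - (?w ^ n) / of_nat n) = - (\<Sum>k<K. of_real (\<rho> ^ Suc k) * z ^ Suc k / of_nat (Suc k))"
      unfolding sum.lessThan_Suc_shift by (simp add: power_mult_distrib sum_negf mult_ac)
    finally have "norm (ln (1 - ?w) + (\<Sum>k<K. of_real (\<rho> ^ Suc k) * z ^ Suc k / of_nat (Suc k))) < 1 / 5" by simp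
    then have "\<bar>Im (ln (1 - ?w) + (\<Sum>k<K. of_real (\<rho> ^ Suc k) * z ^ Suc k / of_nat (Suc k)))\<bar> < 1 / 5"
      using abs_Im_le_cmod order_le_less_trans by blast
    moreover have "\<bar>Im (ln (1 - ?w))\<bar> < pi / 2"
    proof -
      have "1 - ?w \<noteq> 0" using Rew by (metis less_irrefl zero_complex.sel(1))
      with Rew show ?thesis using Re_Ln_pos_lt by blast
    qed
    moreover note pi_half_less_two
    ultimately show "\<bar>Im (\<Sum>k<K. of_real (\<rho> ^ Suc k) * z ^ Suc k / of_nat (Suc k))\<bar> \<le> 3"
      unfolding plus_complex.sel(2) by linarith
  qed
  then show ?thesis
    using \<rho> by (intro exI[of _ K] exI[of _ "\<lambda>k. \<rho> ^ Suc k"]) (auto intro!: mult_le_one power_le_one simp: zero_le_mult_iff)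
qed

context sine_diffusion
begin

lemma cos_moment:
  assumes t: "0 \<le> t"
  shows "integrable M (\<lambda>\<omega>. cos (\<alpha> t \<omega>))" "(\<integral>\<omega>. cos (\<alpha> t \<omega>) \<partial>M) = Re (moment 1 t)"
proof -
  note [measurable] = \<alpha>_measurable[OF t]
  show "integrable M (\<lambda>\<omega>. cos (\<alpha> t \<omega>))"
    by (rule integrable_const_bound[where B=1]) auto
  show "(\<integral>\<omega>. cos (\<alpha> t \<omega>) \<partial>M) = Re (moment 1 t)"
    unfolding moment_def using cis_\<alpha>_integrable[OF t, of 1] by (simp flip: integral_Re)
qed

text \<open>The second difference is \<open>E ((2 cos \<alpha> - 2) exp (\<i> \<mu> \<alpha>))\<close>, and \<open>2 - 2 cos \<alpha>\<close> is nonnegative.\<close>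

lemma norm_second_difference_le:
  assumes t: "0 \<le> t"
  shows "norm (moment (\<mu> + 1) t - 2 * moment \<mu> t + moment (\<mu> - 1) t) \<le> 2 - 2 * Re (moment 1 t)"
proof -
  note i = cis_\<alpha>_integrable[OF t]
  have "moment (\<mu> + 1) t - 2 * moment \<mu> t + moment (\<mu> - 1) t
    = (\<integral>\<omega>. cis ((\<mu> + 1) * \<alpha> t \<omega>) - 2 * cis (\<mu> * \<alpha> t \<omega>) + cis ((\<mu> - 1) * \<alpha> t \<omega>) \<partial>M)"
    unfolding moment_def using i[of \<mu>] i[of "\<mu> + 1"] i[of "\<mu> - 1"] by simp
  also have "\<dots> = (\<integral>\<omega>. (2 * cos (\<alpha> t \<omega>) - 2) *\<^sub>R cis (\<mu> * \<alpha> t \<omega>) \<partial>M)"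
  proof (intro Bochner_Integration.integral_cong refl)
    fix \<omega>
    let ?a = "\<alpha> t \<omega>"
    show "cis ((\<mu> + 1) * ?a) - 2 * cis (\<mu> * ?a) + cis ((\<mu> - 1) * ?a) = (2 * cos ?a - 2) *\<^sub>R cis (\<mu> * ?a)"
      using cis_mult_cos[of \<mu> ?a] by (simp add: scaleR_conv_of_real left_diff_distrib) (simp add: ac_simps)
  qed
  also have "norm \<dots> \<le> (\<integral>\<omega>. norm ((2 * cos (\<alpha> t \<omega>) - 2) *\<^sub>R cis (\<mu> * \<alpha> t \<omega>)) \<partial>M)"
    by (rule integral_norm_bound)
  also have "\<dots> = (\<integral>\<omega>. 2 - 2 * cos (\<alpha> t \<omega>) \<partial>M)"
  proof (intro Bochner_Integration.integral_cong refl)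
    show "norm ((2 * cos (\<alpha> t \<omega>) - 2) *\<^sub>R cis (\<mu> * \<alpha> t \<omega>)) = 2 - 2 * cos (\<alpha> t \<omega>)" for \<omega>
    proof -
      have "2 * cos (\<alpha> t \<omega>) - 2 \<le> 0" by simp
      from abs_of_nonpos[OF this] show ?thesis by simp
    qed
  qed
  also have "\<dots> = 2 - 2 * Re (moment 1 t)"
    using cos_moment[OF t] by (simp add: prob_space)
  finally show ?thesis .
qed

text \<open>A Lyapunov function for the late phase: \<open>G\<close> is the expectation of a regularised
\<open>\<Sum>\<^sub>k cos (k \<alpha>)/k\<^sup>2\<close>. In the hierarchy, the factor \<open>k\<^sup>2/2\<close> of the second difference cancels the weight
\<open>1/k\<^sup>2\<close>, and the sum of the remaining second differences telescopes to \<open>(1 - cos \<alpha>)/2\<close> up to the error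
\<open>\<delta>\<close>. The rotation contributes \<open>r\<close> times the sawtooth. Since \<open>G\<close> is bounded uniformly in \<open>\<delta>\<close>, integration bounds
the time integral of \<open>E (1 - cos \<alpha>)\<close>.\<close>

lemma sawtooth_moment_derivative:
  assumes \<delta>: "0 < \<delta>" and l: "0 \<le> l"
  shows "\<exists>G G'. (\<forall>t\<ge>0. \<bar>G t\<bar> \<le> (2::real)) \<and> continuous_on {0..} G \<and>
    (\<forall>t>0. (G has_vector_derivative G' t) (at t) \<and> (1 - Re (moment 1 t)) / 2 \<le> G' t + \<delta> + 3 * rate t)"
proof -
  obtain K c where c: "\<And>k. 0 \<le> c k \<and> c k \<le> 1"
    and Q: "\<And>z. norm z = 1 \<Longrightarrow> (1 - Re z) / 2 - \<delta> \<le> Re ((z - 1)\<^sup>2 / 2 * (\<Sum>k<K. of_real (c k) * z ^ k))"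
    and L: "\<And>z. norm z = 1 \<Longrightarrow> \<bar>Im (\<Sum>k<K. of_real (c k) * z ^ Suc k / of_nat (Suc k))\<bar> \<le> 3"
    using sawtooth_weights[OF \<delta>] by blast
  let ?n = "\<lambda>k. real (Suc k)"
  define G where "G t = (\<Sum>k<K. of_real (c k / (?n k)\<^sup>2) * moment (?n k) t)" for t
  define G' where "G' t = (\<Sum>k<K. of_real (c k / (?n k)\<^sup>2) *
    (\<i> * of_real (?n k * rate t) * moment (?n k) t + of_real ((?n k)\<^sup>2 / 2) * (moment (?n k + 1) t - 2 * moment (?n k) t + moment (?n k - 1) t)))" for t
  have bound: "norm (G t) \<le> 2" for t
  proof -
    \<comment> \<open>comparison of \<open>1/(N + 2)\<^sup>2\<close> with the telescoping terms \<open>1/((N + 1) (N + 2))\<close>\<close>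
    have s: "(\<Sum>k<Suc N. 1 / (?n k)\<^sup>2) \<le> 2 - 1 / ?n N" for N
    proof (induction N)
      case (Suc N)
      have "1 / (?n (Suc N))\<^sup>2 \<le> 1 / (?n N * ?n (Suc N))"
        unfolding power2_eq_square by (intro divide_left_mono mult_right_mono) auto
      also have "\<dots> = 1 / ?n N - 1 / ?n (Suc N)" by (simp add: field_simps)
      finally show ?case using Suc by simp
    qed simp
    have "norm (G t) \<le> (\<Sum>k<K. 1 / (?n k)\<^sup>2)"
      unfolding G_def
    proof (rule sum_norm_le)
      fix k
      have "norm (of_real (c k / (?n k)\<^sup>2) * moment (?n k) t) = c k / (?n k)\<^sup>2 * norm (moment (?n k) t)"
        using c[of k] by (simp only: norm_mult norm_of_real) simp
      also have "\<dots> \<le> 1 / (?n k)\<^sup>2 * 1"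
        using c[of k] norm_moment_le by (intro mult_mono divide_right_mono) auto
      finally show "norm (of_real (c k / (?n k)\<^sup>2) * moment (?n k) t) \<le> 1 / (?n k)\<^sup>2" by simp
    qed
    also have "\<dots> \<le> 2"
    proof (cases K)
      case (Suc N)
      have "2 - 1 / ?n N \<le> 2" by simp
      with s[of N] show ?thesis unfolding Suc by (rule order_trans)
    qed simp
    finally show ?thesis .
  qed
  have cont: "continuous_on {0..} G"
    unfolding G_def by (intro continuous_intros continuous_moment)
  have der: "(G has_vector_derivative G' t) (at t)" if "0 < t" for t
    unfolding G_def G'_def
    by (intro has_vector_derivative_sum has_vector_derivative_mult_right moment_derivative that)
  have low: "(1 - Re (moment 1 t)) / 2 \<le> Re (G' t) + \<delta> + 3 * rate t" if "0 < t" for t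
  proof -
    have t: "0 \<le> t" using that by simp
    note [measurable] = \<alpha>_measurable[OF t] and i = cis_\<alpha>_integrable[OF t]
    have r: "0 \<le> rate t" using l \<beta> by (simp add: rate_def)
    let ?T = "\<lambda>k \<omega>. of_real (c k / (?n k)\<^sup>2) * (\<i> * of_real (?n k * rate t) * cis (?n k * \<alpha> t \<omega>)
      + of_real ((?n k)\<^sup>2 / 2) * (cis ((?n k + 1) * \<alpha> t \<omega>) - 2 * cis (?n k * \<alpha> t \<omega>) + cis ((?n k - 1) * \<alpha> t \<omega>)))"
    have iT: "integrable M (?T k)" for k
      by (intro integrable_mult_right Bochner_Integration.integrable_add Bochner_Integration.integrable_diff i)
    have "G' t = (\<integral>\<omega>. (\<Sum>k<K. ?T k \<omega>) \<partial>M)"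
    proof -
      have eq: "(\<integral>\<omega>. ?T k \<omega> \<partial>M) = of_real (c k / (?n k)\<^sup>2) *
        (\<i> * of_real (?n k * rate t) * moment (?n k) t + of_real ((?n k)\<^sup>2 / 2) * (moment (?n k + 1) t - 2 * moment (?n k) t + moment (?n k - 1) t))" for k
        unfolding moment_def using i[of "?n k"] i[of "?n k + 1"] i[of "?n k - 1"] by simp
      have "G' t = (\<Sum>k<K. \<integral>\<omega>. ?T k \<omega> \<partial>M)" unfolding G'_def eq ..
      also have "\<dots> = (\<integral>\<omega>. (\<Sum>k<K. ?T k \<omega>) \<partial>M)"
        by (rule Bochner_Integration.integral_sum[OF iT, symmetric])
      finally show ?thesis .
    qed
    then have ReG: "Re (G' t) = (\<integral>\<omega>. Re (\<Sum>k<K. ?T k \<omega>) \<partial>M)"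
      using iT by (simp only: integral_Re Bochner_Integration.integrable_sum)
    have pt: "(1 - cos (\<alpha> t \<omega>)) / 2 - \<delta> - 3 * rate t \<le> Re (\<Sum>k<K. ?T k \<omega>)" for \<omega>
    proof -
      define z where "z = cis (\<alpha> t \<omega>)"
      have z: "norm z = 1" "z \<noteq> 0" "Re z = cos (\<alpha> t \<omega>)" by (auto simp: z_def)
      have zk: "cis (?n k * \<alpha> t \<omega>) = z ^ Suc k" "cis ((?n k + 1) * \<alpha> t \<omega>) = z ^ Suc (Suc k)"
        "cis ((?n k - 1) * \<alpha> t \<omega>) = z ^ k" for k
        unfolding z_def Complex.DeMoivre by (simp_all add: algebra_simps)
      have "?T k \<omega> = \<i> * rate t * (of_real (c k) * z ^ Suc k / of_nat (Suc k))
          + (z - 1)\<^sup>2 / 2 * (of_real (c k) * z ^ k)" for k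
      proof -
        have "complex_of_nat (Suc k) \<noteq> 0" by (simp del: of_nat_Suc)
        then show ?thesis
          unfolding zk by (simp add: power2_eq_square field_simps del: of_nat_Suc)
      qed
      then have eq: "(\<Sum>k<K. ?T k \<omega>) = \<i> * rate t * (\<Sum>k<K. of_real (c k) * z ^ Suc k / of_nat (Suc k))
          + (z - 1)\<^sup>2 / 2 * (\<Sum>k<K. of_real (c k) * z ^ k)"
        by (simp only: sum.distrib sum_distrib_left)
      have "- 3 * rate t \<le> Re (\<i> * rate t * (\<Sum>k<K. of_real (c k) * z ^ Suc k / of_nat (Suc k)))"
      proof -
        define Z where "Z = (\<Sum>k<K. of_real (c k) * z ^ Suc k / of_nat (Suc k))"
        have "\<bar>Im Z\<bar> \<le> 3" using L[OF z(1)] by (simp add: Z_def)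
        then have "rate t * Im Z \<le> rate t * 3" using r by (intro mult_left_mono) auto
        then show ?thesis unfolding Z_def[symmetric] by simp
      qed
      with Q[OF z(1)] show ?thesis
        unfolding eq z(3) plus_complex.sel(1) by linarith
    qed
    have "(1 - Re (moment 1 t)) / 2 - \<delta> - 3 * rate t = (\<integral>\<omega>. (1 - cos (\<alpha> t \<omega>)) / 2 - \<delta> - 3 * rate t \<partial>M)"
      using cos_moment[OF t] by (simp add: prob_space)
    also have "\<dots> \<le> Re (G' t)"
      unfolding ReG using pt iT cos_moment(1)[OF t]
      by (intro integral_mono) (auto simp del: Re_sum)
    finally show ?thesis by linarith
  qed
  show ?thesis
  proof (intro exI conjI allI impI)
    show "\<bar>Re (G t)\<bar> \<le> 2" for t using abs_Re_le_cmod[of "G t"] bound[of t] by linarith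
    show "continuous_on {0..} (\<lambda>t. Re (G t))" by (intro continuous_intros cont)
    show "((\<lambda>t. Re (G t)) has_vector_derivative Re (G' t)) (at t)" if "0 < t" for t
      by (rule bounded_linear.has_vector_derivative[OF bounded_linear_Re der[OF that]])
    show "(1 - Re (moment 1 t)) / 2 \<le> Re (G' t) + \<delta> + 3 * rate t" if "0 < t" for t by (rule low[OF that])
  qed
qed

definition centred_moment :: "real \<Rightarrow> real \<Rightarrow> complex" where "centred_moment \<mu> t = cis (- \<mu> * drift t) * moment \<mu> t"

lemma continuous_centred_moment: "continuous_on {0..} (centred_moment \<mu>)"
  unfolding centred_moment_def[abs_def] by (intro continuous_intros continuous_moment continuous_drift)

lemma centred_moment_derivative:
  assumes t: "0 < t"
  shows "(centred_moment \<mu> has_vector_derivative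
    cis (- \<mu> * drift t) * (of_real (\<mu>\<^sup>2 / 2) * (moment (\<mu> + 1) t - 2 * moment \<mu> t + moment (\<mu> - 1) t))) (at t)"
  unfolding centred_moment_def[abs_def]
  by (rule has_vector_derivative_eq_rhs[OF has_vector_derivative_mult[OF cis_drift_derivative moment_derivative[OF t]]])
    (simp add: algebra_simps)

text \<open>The speed of the centred moment is at most \<open>\<mu>\<^sup>2 E (1 - cos \<alpha>)\<close>, and \<open>E (1 - cos \<alpha>)/2\<close> exceeds the
derivative of the Lyapunov function by at most \<open>\<delta> + 3 r\<close>. The bound is integrated for fixed \<open>\<delta>\<close>; afterwards \<open>\<delta>\<close> tends to
zero, so that the length of the time interval does not enter.\<close>

theorem late_fluctuation:
  assumes l: "0 \<le> l" and st: "0 \<le> s" "s < t"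
  shows "norm (centred_moment \<mu> t - centred_moment \<mu> s) \<le> 2 * \<mu>\<^sup>2 * (4 + 3 * (drift t - drift s))"
proof -
  have "norm (centred_moment \<mu> t - centred_moment \<mu> s) \<le> 2 * \<mu>\<^sup>2 * (4 + 3 * (drift t - drift s)) + 2 * \<mu>\<^sup>2 * (t - s) * \<delta>" if \<delta>: "0 < \<delta>" for \<delta>
  proof -
    obtain G G' where G: "\<And>t. 0 \<le> t \<Longrightarrow> \<bar>G t\<bar> \<le> (2::real)" "continuous_on {0..} G"
      and G': "\<And>t. 0 < t \<Longrightarrow> (G has_vector_derivative G' t) (at t)"
        "\<And>t. 0 < t \<Longrightarrow> (1 - Re (moment 1 t)) / 2 \<le> G' t + \<delta> + 3 * rate t"
      using sawtooth_moment_derivative[OF \<delta> l] by blast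
    let ?\<phi> = "\<lambda>v. 2 * \<mu>\<^sup>2 * (G v + \<delta> * v + 3 * drift v)"
    have "norm (centred_moment \<mu> t - centred_moment \<mu> s) \<le> ?\<phi> t - ?\<phi> s"
    proof (rule differentiable_bound_general[OF st(2)])
      show "continuous_on {s..t} (centred_moment \<mu>)" using st by (intro continuous_on_subset[OF continuous_centred_moment]) auto
      have "continuous_on {s..t} G" using st by (intro continuous_on_subset[OF G(2)]) auto
      then show "continuous_on {s..t} ?\<phi>" by (intro continuous_intros continuous_drift)
      fix v assume "s < v" "v < t"
      then have v: "0 < v" using st by simp
      show "(centred_moment \<mu> has_vector_derivative cis (- \<mu> * drift v) *
          (of_real (\<mu>\<^sup>2 / 2) * (moment (\<mu> + 1) v - 2 * moment \<mu> v + moment (\<mu> - 1) v))) (at v)"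
        by (rule centred_moment_derivative[OF v])
      show "(?\<phi> has_vector_derivative 2 * \<mu>\<^sup>2 * (G' v + \<delta> + 3 * rate v)) (at v)"
        using G'(1)[OF v] drift_derivative[of v UNIV]
        unfolding has_real_derivative_iff_has_vector_derivative[symmetric]
        by (auto intro!: derivative_eq_intros)
      have "norm (cis (- \<mu> * drift v) * (of_real (\<mu>\<^sup>2 / 2) * (moment (\<mu> + 1) v - 2 * moment \<mu> v + moment (\<mu> - 1) v)))
        = \<mu>\<^sup>2 / 2 * norm (moment (\<mu> + 1) v - 2 * moment \<mu> v + moment (\<mu> - 1) v)"
        by (simp add: norm_mult norm_divide norm_power)
      also have "\<dots> \<le> \<mu>\<^sup>2 / 2 * (2 - 2 * Re (moment 1 v))"
        using v by (intro mult_left_mono norm_second_difference_le) auto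
      also have "\<dots> = 2 * \<mu>\<^sup>2 * ((1 - Re (moment 1 v)) / 2)" by (simp add: field_simps)
      also have "\<dots> \<le> 2 * \<mu>\<^sup>2 * (G' v + \<delta> + 3 * rate v)"
        using G'(2)[OF v] by (intro mult_left_mono) auto
      finally show "norm (cis (- \<mu> * drift v) * (of_real (\<mu>\<^sup>2 / 2) * (moment (\<mu> + 1) v - 2 * moment \<mu> v + moment (\<mu> - 1) v)))
        \<le> 2 * \<mu>\<^sup>2 * (G' v + \<delta> + 3 * rate v)" .
    qed
    also have "\<dots> = 2 * \<mu>\<^sup>2 * ((G t - G s) + 3 * (drift t - drift s)) + 2 * \<mu>\<^sup>2 * (t - s) * \<delta>"
      by (simp add: algebra_simps)
    also have "\<dots> \<le> 2 * \<mu>\<^sup>2 * (4 + 3 * (drift t - drift s)) + 2 * \<mu>\<^sup>2 * (t - s) * \<delta>"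
      using G(1)[of t] G(1)[of s] st by (intro add_right_mono mult_left_mono) auto
    finally show ?thesis .
  qed
  moreover have "((\<lambda>\<delta>. 2 * \<mu>\<^sup>2 * (4 + 3 * (drift t - drift s)) + 2 * \<mu>\<^sup>2 * (t - s) * \<delta>)
      \<longlongrightarrow> 2 * \<mu>\<^sup>2 * (4 + 3 * (drift t - drift s)) + 2 * \<mu>\<^sup>2 * (t - s) * 0) (at_right 0)"
    by (intro tendsto_intros)
  ultimately show ?thesis
    by (intro tendsto_lowerbound[where F="at_right (0::real)"])
      (auto simp: eventually_at_right_field intro: exI[of _ 1])
qed

end

section \<open>The early phase: averaging of the fast rotation\<close>

context sine_diffusion
begin

lemma rate_pos: "0 < l \<Longrightarrow> 0 < rate t"
  using \<beta> by (simp add: rate_def)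

lemma inverse_rate_derivative:
  assumes l: "0 < l"
  shows "((\<lambda>t. 1 / rate t) has_real_derivative (\<beta> / 4) / rate t) (at t)"
proof -
  have eq: "1 / rate t = exp (\<beta> / 4 * t) / (l * (\<beta> / 4))" for t
    using l \<beta> by (simp add: rate_def exp_minus field_simps)
  have "((\<lambda>t. exp (\<beta> / 4 * t) / (l * (\<beta> / 4))) has_real_derivative
      (\<beta> / 4) * (exp (\<beta> / 4 * t) / (l * (\<beta> / 4)))) (at t)"
    using l \<beta> by (auto intro!: derivative_eq_intros)
  then show ?thesis unfolding eq[symmetric] by simp
qed

text \<open>Write \<open>e = exp (\<mu>\<^sup>2 t - \<i> \<mu> drift)\<close>. Then \<open>y = e m(\<mu>)\<close> satisfies \<open>y' = (\<mu>\<^sup>2/2) e (m(\<mu> + 1) + m(\<mu> - 1))\<close>. The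
functions \<open>A(\<mu> \<plusminus> 1) = e m(\<mu> \<plusminus> 1)/r\<close> have derivatives \<open>\<plusminus> \<i> e m(\<mu> \<plusminus> 1)\<close> up to remainders \<open>R\<close> of size
\<open>exp (\<mu>\<^sup>2 T)/r\<close>. Hence the correction \<open>H = y + (\<mu>\<^sup>2/2) \<i> (A(\<mu> + 1) - A(\<mu> - 1))\<close> removes the driving terms and
leaves a derivative of order \<open>\<mu>\<^sup>2 exp (\<mu>\<^sup>2 T)/r\<close>. As \<open>1/r\<close> grows exponentially, its integral is dominated by
its final value \<open>1/r(T) = 4/\<beta>\<close>, and the same is true of the correction itself. The factor
\<open>exp (\<mu>\<^sup>2 T)\<close> is compensated when \<open>y\<close> is translated back.\<close>

theorem early_gaussian:
  assumes l: "1 < l" and \<mu>: "\<bar>\<mu>\<bar> \<le> 1"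
  defines "T \<equiv> 4 / \<beta> * ln l"
  shows "norm (centred_moment \<mu> T - of_real (exp (- (\<mu>\<^sup>2 * T)))) \<le> ((9 + \<beta> / 4) * (16 / \<beta>\<^sup>2) + 8 / \<beta>) * \<mu>\<^sup>2"
proof -
  have l0: "0 < l" using l by simp
  have T: "0 < T" using l \<beta> by (simp add: T_def)
  have rT: "rate T = \<beta> / 4" using l \<beta> by (simp add: rate_def T_def exp_minus)
  have r0: "rate 0 = l * (\<beta> / 4)" by (simp add: rate_def)
  define a where "a t = exp (\<mu>\<^sup>2 * t) / rate t" for t
  define D where "D \<nu> t = moment (\<nu> + 1) t - 2 * moment \<nu> t + moment (\<nu> - 1) t" for \<nu> t
  define A where "A \<nu> t = of_real (a t) * (cis (- \<mu> * drift t) * moment \<nu> t)" for \<nu> t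
  define R where "R \<nu> t = of_real (a t) * (cis (- \<mu> * drift t) *
    (of_real (\<mu>\<^sup>2 + \<beta> / 4) * moment \<nu> t + of_real (\<nu>\<^sup>2 / 2) * D \<nu> t))" for \<nu> t
  define e where "e t = of_real (exp (\<mu>\<^sup>2 * t)) * cis (- \<mu> * drift t)" for t
  have a_pos: "0 < a t" for t using rate_pos[OF l0] by (simp add: a_def)
  have a_le: "a t \<le> exp (\<mu>\<^sup>2 * T) / rate t" if "t \<le> T" for t
    unfolding a_def using rate_pos[OF l0, of t] that by (intro divide_right_mono) (auto intro: mult_left_mono)
  have a_deriv: "(a has_real_derivative (\<mu>\<^sup>2 + \<beta> / 4) * a t) (at t)" for t
  proof -
    have "((\<lambda>t. exp (\<mu>\<^sup>2 * t) * (1 / rate t)) has_real_derivative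
        (exp (\<mu>\<^sup>2 * t) * \<mu>\<^sup>2) * (1 / rate t) + (\<beta> / 4) / rate t * exp (\<mu>\<^sup>2 * t)) (at t)"
      by (rule DERIV_mult[OF _ inverse_rate_derivative[OF l0]]) (auto intro!: derivative_eq_intros)
    moreover have "(exp (\<mu>\<^sup>2 * t) * \<mu>\<^sup>2) * (1 / rate t) + (\<beta> / 4) / rate t * exp (\<mu>\<^sup>2 * t) = (\<mu>\<^sup>2 + \<beta> / 4) * a t"
      using rate_pos[OF l0, of t] by (simp add: a_def field_simps)
    moreover have "(\<lambda>t. exp (\<mu>\<^sup>2 * t) * (1 / rate t)) = a" by (simp add: a_def fun_eq_iff)
    ultimately show ?thesis by simp
  qed
  have A_deriv: "(A \<nu> has_vector_derivative \<i> * of_real (\<nu> - \<mu>) * (e t * moment \<nu> t) + R \<nu> t) (at t)" if t: "0 < t" for \<nu> t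
  proof -
    have "((\<lambda>v. of_real (a v) * (cis (- \<mu> * drift v) * moment \<nu> v)) has_vector_derivative
      of_real (a t) * (cis (- \<mu> * drift t) * (\<i> * of_real (\<nu> * rate t) * moment \<nu> t + of_real (\<nu>\<^sup>2 / 2) * D \<nu> t)
        + (\<i> * of_real (- \<mu> * rate t)) * cis (- \<mu> * drift t) * moment \<nu> t)
      + of_real ((\<mu>\<^sup>2 + \<beta> / 4) * a t) * (cis (- \<mu> * drift t) * moment \<nu> t)) (at t)"
      unfolding D_def
      by (intro has_vector_derivative_mult has_vector_derivative_of_real a_deriv cis_drift_derivative moment_derivative t)
    moreover have "of_real (a t) * (cis (- \<mu> * drift t) * (\<i> * of_real (\<nu> * rate t) * moment \<nu> t + of_real (\<nu>\<^sup>2 / 2) * D \<nu> t)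
        + (\<i> * of_real (- \<mu> * rate t)) * cis (- \<mu> * drift t) * moment \<nu> t)
      + of_real ((\<mu>\<^sup>2 + \<beta> / 4) * a t) * (cis (- \<mu> * drift t) * moment \<nu> t)
      = \<i> * of_real (\<nu> - \<mu>) * (of_real (a t * rate t) * cis (- \<mu> * drift t) * moment \<nu> t) + R \<nu> t"
      unfolding R_def by (simp add: algebra_simps)
    moreover have "a t * rate t = exp (\<mu>\<^sup>2 * t)" using rate_pos[OF l0, of t] by (simp add: a_def)
    ultimately show ?thesis unfolding A_def[abs_def] e_def by simp
  qed
  define y where "y t = of_real (exp (\<mu>\<^sup>2 * t)) * centred_moment \<mu> t" for t
  have y_deriv: "(y has_vector_derivative of_real (\<mu>\<^sup>2 / 2) * (e t * (moment (\<mu> + 1) t + moment (\<mu> - 1) t))) (at t)" if t: "0 < t" for t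
  proof -
    have "((\<lambda>t. exp (\<mu>\<^sup>2 * t)) has_real_derivative exp (\<mu>\<^sup>2 * t) * \<mu>\<^sup>2) (at t)"
      by (auto intro!: derivative_eq_intros)
    from has_vector_derivative_mult[OF has_vector_derivative_of_real[OF this] centred_moment_derivative[OF t]]
    show ?thesis
      unfolding y_def[abs_def] by (rule has_vector_derivative_eq_rhs) (simp add: centred_moment_def e_def algebra_simps)
  qed
  define H where "H t = y t + of_real (\<mu>\<^sup>2 / 2) * (\<i> * (A (\<mu> + 1) t - A (\<mu> - 1) t))" for t
  have H_deriv: "(H has_vector_derivative of_real (\<mu>\<^sup>2 / 2) * (\<i> * (R (\<mu> + 1) t - R (\<mu> - 1) t))) (at t)" if t: "0 < t" for t
  proof -
    have "(H has_vector_derivative of_real (\<mu>\<^sup>2 / 2) * (e t * (moment (\<mu> + 1) t + moment (\<mu> - 1) t))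
       + of_real (\<mu>\<^sup>2 / 2) * (\<i> * ((\<i> * of_real (\<mu> + 1 - \<mu>) * (e t * moment (\<mu> + 1) t) + R (\<mu> + 1) t)
          - (\<i> * of_real (\<mu> - 1 - \<mu>) * (e t * moment (\<mu> - 1) t) + R (\<mu> - 1) t)))) (at t)"
      unfolding H_def[abs_def]
      by (intro has_vector_derivative_add has_vector_derivative_mult_right has_vector_derivative_diff y_deriv A_deriv t)
    then show ?thesis
      by (rule has_vector_derivative_eq_rhs) (simp add: algebra_simps)
  qed
  have R_bound: "norm (R \<nu> t) \<le> exp (\<mu>\<^sup>2 * T) * (9 + \<beta> / 4) / rate t" if t: "0 \<le> t" "t \<le> T" and \<nu>: "\<bar>\<nu>\<bar> \<le> 2" for \<nu> t
  proof -
    have "norm (D \<nu> t) \<le> 1 + 2 * 1 + 1"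
    proof -
      have "norm (D \<nu> t) \<le> norm (moment (\<nu> + 1) t) + 2 * norm (moment \<nu> t) + norm (moment (\<nu> - 1) t)"
        unfolding D_def
        using norm_triangle_ineq[of "moment (\<nu> + 1) t - 2 * moment \<nu> t" "moment (\<nu> - 1) t"]
          norm_triangle_ineq4[of "moment (\<nu> + 1) t" "2 * moment \<nu> t"] by (simp add: norm_mult)
      also have "\<dots> \<le> 1 + 2 * 1 + 1" by (intro add_mono mult_left_mono norm_moment_le) auto
      finally show ?thesis .
    qed
    moreover have "\<nu>\<^sup>2 \<le> 2\<^sup>2" using \<nu> abs_le_square_iff[of \<nu> 2] by simp
    moreover have "\<mu>\<^sup>2 \<le> 1" using \<mu> abs_le_square_iff[of \<mu> 1] by simp
    ultimately have "norm (of_real (\<mu>\<^sup>2 + \<beta> / 4) * moment \<nu> t + of_real (\<nu>\<^sup>2 / 2) * D \<nu> t) \<le> (1 + \<beta> / 4) * 1 + (2\<^sup>2 / 2) * 4"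
      using \<beta> norm_moment_le[of \<nu> t]
      by (intro norm_triangle_mono; simp only: norm_mult norm_of_real; intro mult_mono) auto
    then have "norm (of_real (\<mu>\<^sup>2 + \<beta> / 4) * moment \<nu> t + of_real (\<nu>\<^sup>2 / 2) * D \<nu> t) \<le> 9 + \<beta> / 4" by simp
    then have "a t * norm (of_real (\<mu>\<^sup>2 + \<beta> / 4) * moment \<nu> t + of_real (\<nu>\<^sup>2 / 2) * D \<nu> t)
        \<le> exp (\<mu>\<^sup>2 * T) / rate t * (9 + \<beta> / 4)"
      using a_le[OF t(2)] a_pos[of t] rate_pos[OF l0, of t] by (intro mult_mono) (auto intro: less_imp_le)
    then show ?thesis
      unfolding R_def norm_mult[of "of_real (a t)"] norm_mult[of "cis _"] norm_cis norm_of_real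
      using a_pos[of t] by (simp add: field_simps)
  qed
  define C where "C = \<mu>\<^sup>2 * exp (\<mu>\<^sup>2 * T) * (9 + \<beta> / 4)"
  have "norm (H T - H 0) \<le> C * (4 / \<beta>) * (1 / rate T) - C * (4 / \<beta>) * (1 / rate 0)"
  proof (rule differentiable_bound_general[OF T])
    have ca: "continuous_on {0..T} a"
      using a_deriv by (intro continuous_at_imp_continuous_on) (blast intro: DERIV_isCont)
    have cp: "continuous_on {0..T} (moment \<nu>)" for \<nu> by (rule continuous_on_subset[OF continuous_moment]) auto
    have cq: "continuous_on {0..T} (centred_moment \<nu>)" for \<nu> by (rule continuous_on_subset[OF continuous_centred_moment]) auto
    show "continuous_on {0..T} H"
      unfolding H_def[abs_def] y_def[abs_def] A_def[abs_def] by (intro continuous_intros ca cp cq continuous_drift)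
    show "continuous_on {0..T} (\<lambda>t. C * (4 / \<beta>) * (1 / rate t))"
      using inverse_rate_derivative[OF l0]
      by (intro continuous_on_mult continuous_on_const continuous_at_imp_continuous_on) (blast intro: DERIV_isCont)
    fix t assume t: "0 < t" "t < T"
    show "(H has_vector_derivative of_real (\<mu>\<^sup>2 / 2) * (\<i> * (R (\<mu> + 1) t - R (\<mu> - 1) t))) (at t)"
      by (rule H_deriv[OF t(1)])
    show "((\<lambda>t. C * (4 / \<beta>) * (1 / rate t)) has_vector_derivative C * (4 / \<beta>) * ((\<beta> / 4) / rate t)) (at t)"
      by (intro has_vector_derivative_mult_right
          inverse_rate_derivative[OF l0, unfolded has_real_derivative_iff_has_vector_derivative])
    have "norm (R (\<mu> + 1) t - R (\<mu> - 1) t) \<le> norm (R (\<mu> + 1) t) + norm (R (\<mu> - 1) t)"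
      by (rule norm_triangle_ineq4)
    also have "\<dots> \<le> exp (\<mu>\<^sup>2 * T) * (9 + \<beta> / 4) / rate t + exp (\<mu>\<^sup>2 * T) * (9 + \<beta> / 4) / rate t"
      using t \<mu> by (intro add_mono R_bound) auto
    finally have "\<mu>\<^sup>2 / 2 * norm (R (\<mu> + 1) t - R (\<mu> - 1) t) \<le> \<mu>\<^sup>2 / 2 * (2 * (exp (\<mu>\<^sup>2 * T) * (9 + \<beta> / 4) / rate t))"
      by (intro mult_left_mono) auto
    \<comment> \<open>\<open>1/r\<close> is, up to the factor \<open>4/\<beta>\<close>, its own primitive\<close>
    also have "\<dots> = C * (4 / \<beta>) * ((\<beta> / 4) / rate t)" using \<beta> by (simp add: C_def)
    finally show "norm (of_real (\<mu>\<^sup>2 / 2) * (\<i> * (R (\<mu> + 1) t - R (\<mu> - 1) t))) \<le> C * (4 / \<beta>) * ((\<beta> / 4) / rate t)"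
      by (simp add: norm_mult norm_divide norm_power)
  qed
  also have "\<dots> \<le> C * (4 / \<beta>) * (1 / rate T)"
    using rate_pos[OF l0, of 0] \<beta> by (simp add: C_def)
  also have "\<dots> = \<mu>\<^sup>2 * exp (\<mu>\<^sup>2 * T) * ((9 + \<beta> / 4) * (16 / \<beta>\<^sup>2))"
    unfolding rT C_def using \<beta> by (simp add: field_simps power2_eq_square)
  finally have main: "norm (H T - H 0) \<le> \<mu>\<^sup>2 * exp (\<mu>\<^sup>2 * T) * ((9 + \<beta> / 4) * (16 / \<beta>\<^sup>2))" .
  have A_bound: "norm (A \<nu> t) \<le> exp (\<mu>\<^sup>2 * T) * (4 / \<beta>)" if "t = 0 \<or> t = T" for \<nu> t
  proof -
    have "\<beta> / 4 \<le> rate t" using that l \<beta> by (auto simp: rT r0)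
    then have "exp (\<mu>\<^sup>2 * T) / rate t \<le> exp (\<mu>\<^sup>2 * T) / (\<beta> / 4)"
      using \<beta> by (intro divide_left_mono mult_pos_pos rate_pos[OF l0]) auto
    then have at: "a t \<le> exp (\<mu>\<^sup>2 * T) * (4 / \<beta>)" using a_le[of t] that T by auto
    have "norm (A \<nu> t) = a t * norm (moment \<nu> t)" using a_pos[of t] by (simp add: A_def norm_mult)
    also have "\<dots> \<le> a t * 1" using a_pos[of t] by (intro mult_left_mono norm_moment_le) auto
    finally show ?thesis using at by simp
  qed
  have "y T - 1 = (H T - H 0) - of_real (\<mu>\<^sup>2 / 2) * (\<i> * ((A (\<mu> + 1) T - A (\<mu> - 1) T) - (A (\<mu> + 1) 0 - A (\<mu> - 1) 0)))"
    by (simp add: H_def y_def centred_moment_def moment_0 drift_0 algebra_simps)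
  then have "norm (y T - 1) \<le> norm (H T - H 0) + norm (of_real (\<mu>\<^sup>2 / 2) * (\<i> * ((A (\<mu> + 1) T - A (\<mu> - 1) T) - (A (\<mu> + 1) 0 - A (\<mu> - 1) 0))))"
    by (simp only: norm_triangle_ineq4)
  also have "norm (of_real (\<mu>\<^sup>2 / 2) * (\<i> * ((A (\<mu> + 1) T - A (\<mu> - 1) T) - (A (\<mu> + 1) 0 - A (\<mu> - 1) 0))))
    = \<mu>\<^sup>2 / 2 * norm ((A (\<mu> + 1) T - A (\<mu> - 1) T) - (A (\<mu> + 1) 0 - A (\<mu> - 1) 0))"
    by (simp add: norm_mult norm_divide norm_power)
  also have "\<dots> \<le> \<mu>\<^sup>2 / 2 * ((exp (\<mu>\<^sup>2 * T) * (4 / \<beta>) + exp (\<mu>\<^sup>2 * T) * (4 / \<beta>)) + (exp (\<mu>\<^sup>2 * T) * (4 / \<beta>) + exp (\<mu>\<^sup>2 * T) * (4 / \<beta>)))"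
    by (intro mult_left_mono order_trans[OF norm_triangle_ineq4] add_mono A_bound) auto
  also have "\<dots> = \<mu>\<^sup>2 * exp (\<mu>\<^sup>2 * T) * (8 / \<beta>)" by (simp add: field_simps)
  finally have "norm (y T - 1) \<le> \<mu>\<^sup>2 * exp (\<mu>\<^sup>2 * T) * ((9 + \<beta> / 4) * (16 / \<beta>\<^sup>2)) + \<mu>\<^sup>2 * exp (\<mu>\<^sup>2 * T) * (8 / \<beta>)"
    using main by linarith
  then have yT: "norm (y T - 1) \<le> exp (\<mu>\<^sup>2 * T) * (((9 + \<beta> / 4) * (16 / \<beta>\<^sup>2) + 8 / \<beta>) * \<mu>\<^sup>2)"
    by (simp add: algebra_simps)
  have "of_real (exp (- (\<mu>\<^sup>2 * T))) * of_real (exp (\<mu>\<^sup>2 * T)) = (1 :: complex)"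
    by (simp only: of_real_mult[symmetric] mult_exp_exp) simp
  then have "centred_moment \<mu> T - of_real (exp (- (\<mu>\<^sup>2 * T))) = of_real (exp (- (\<mu>\<^sup>2 * T))) * (y T - 1)"
    by (simp only: y_def right_diff_distrib mult.assoc[symmetric]) simp
  then have "norm (centred_moment \<mu> T - of_real (exp (- (\<mu>\<^sup>2 * T)))) = exp (- (\<mu>\<^sup>2 * T)) * norm (y T - 1)"
    by (simp only: norm_mult norm_of_real) simp
  also have "\<dots> \<le> exp (- (\<mu>\<^sup>2 * T)) * (exp (\<mu>\<^sup>2 * T) * (((9 + \<beta> / 4) * (16 / \<beta>\<^sup>2) + 8 / \<beta>) * \<mu>\<^sup>2))"
    by (intro mult_left_mono yT) simp
  also have "\<dots> = ((9 + \<beta> / 4) * (16 / \<beta>\<^sup>2) + 8 / \<beta>) * \<mu>\<^sup>2"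
    unfolding mult.assoc[symmetric, of "exp (- (\<mu>\<^sup>2 * T))"] mult_exp_exp by simp
  finally show ?thesis .
qed

end

section \<open>The central limit theorem\<close>

context sine_diffusion
begin

text \<open>The time \<open>(4/\<beta>) ln l\<close> is the one after which the drift still has mass \<open>l exp (- ln l) = 1\<close>.\<close>

lemma drift_remaining:
  assumes l: "1 < l" and t: "4 / \<beta> * ln l \<le> t"
  shows "drift t - drift (4 / \<beta> * ln l) \<le> 1"
proof -
  have "drift t - drift (4 / \<beta> * ln l) = l * exp (- ln l) - l * exp (- (\<beta> / 4) * t)"
    using \<beta> by (simp add: drift_def algebra_simps)
  also have "\<dots> \<le> l * exp (- ln l)" using l by simp
  also have "\<dots> = 1" using l by (simp add: exp_minus)
  finally show ?thesis .
qed

text \<open>The early and the late estimate meet at \<open>T = (4/\<beta>) ln l\<close>; the late one contributes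
\<open>2 \<mu>\<^sup>2 (4 + 3) = 14 \<mu>\<^sup>2\<close>. The bound does not depend on the final time, which may therefore tend to
infinity.\<close>

lemma limit_characteristic_function:
  assumes l: "1 < l" and \<mu>: "\<bar>\<mu>\<bar> \<le> 1"
    and c: "c \<in> borel_measurable M" and lim: "AE \<omega> in M. ((\<lambda>t. 1 / (2 * pi) * \<alpha> t \<omega>) \<longlongrightarrow> c \<omega>) at_top"
  shows "norm ((\<integral>\<omega>. cis (\<mu> * (2 * pi * c \<omega> - l)) \<partial>M) - of_real (exp (- (\<mu>\<^sup>2 * (4 / \<beta> * ln l)))))
    \<le> ((9 + \<beta> / 4) * (16 / \<beta>\<^sup>2) + 8 / \<beta> + 14) * \<mu>\<^sup>2"
proof -
  define T where "T = 4 / \<beta> * ln l"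
  have T: "0 < T" using l \<beta> by (simp add: T_def)
  define s where "s n = T + 1 + real n" for n
  have s: "filterlim s at_top sequentially"
    unfolding s_def by (rule filterlim_tendsto_add_at_top[OF tendsto_const filterlim_real_sequentially])
  have drift_lim: "(\<lambda>n. drift (s n)) \<longlonglongrightarrow> l * (1 - 0)"
  proof -
    have "filterlim (\<lambda>n. - (\<beta> / 4) * s n) at_bot sequentially"
      using \<beta> by (intro filterlim_tendsto_neg_mult_at_bot[OF tendsto_const _ s]) auto
    then show ?thesis
      unfolding drift_def by (intro tendsto_intros filterlim_compose[OF exp_at_bot])
  qed
  have q_eq: "centred_moment \<mu> t = (\<integral>\<omega>. cis (\<mu> * (\<alpha> t \<omega> - drift t)) \<partial>M)" for t
    unfolding centred_moment_def moment_def integral_mult_right_zero[symmetric] cis_mult by (simp add: algebra_simps)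
  have "(\<lambda>n. \<integral>\<omega>. cis (\<mu> * (\<alpha> (s n) \<omega> - drift (s n))) \<partial>M) \<longlonglongrightarrow> (\<integral>\<omega>. cis (\<mu> * (2 * pi * c \<omega> - l)) \<partial>M)"
  proof (rule integral_dominated_convergence[where w="\<lambda>_. 1"])
    show "(\<lambda>\<omega>. cis (\<mu> * (2 * pi * c \<omega> - l))) \<in> borel_measurable M" using c by measurable
    show "(\<lambda>\<omega>. cis (\<mu> * (\<alpha> (s n) \<omega> - drift (s n)))) \<in> borel_measurable M" for n
      using \<alpha>_measurable[of "s n"] T by (simp add: s_def)
    show "AE \<omega> in M. (\<lambda>n. cis (\<mu> * (\<alpha> (s n) \<omega> - drift (s n)))) \<longlonglongrightarrow> cis (\<mu> * (2 * pi * c \<omega> - l))"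
      using lim
    proof eventually_elim
      case (elim \<omega>)
      have "(\<lambda>n. 2 * pi * (1 / (2 * pi) * \<alpha> (s n) \<omega>)) \<longlonglongrightarrow> 2 * pi * c \<omega>"
        by (intro tendsto_intros filterlim_compose[OF elim s])
      then have "(\<lambda>n. \<alpha> (s n) \<omega>) \<longlonglongrightarrow> 2 * pi * c \<omega>" by simp
      then show ?case using drift_lim by (intro tendsto_intros) auto
    qed
  qed auto
  then have q_lim: "(\<lambda>n. centred_moment \<mu> (s n)) \<longlonglongrightarrow> (\<integral>\<omega>. cis (\<mu> * (2 * pi * c \<omega> - l)) \<partial>M)"
    unfolding q_eq .
  have "norm (centred_moment \<mu> (s n) - of_real (exp (- (\<mu>\<^sup>2 * T)))) \<le> ((9 + \<beta> / 4) * (16 / \<beta>\<^sup>2) + 8 / \<beta> + 14) * \<mu>\<^sup>2" for n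
  proof -
    have "norm (centred_moment \<mu> (s n) - centred_moment \<mu> T) \<le> 2 * \<mu>\<^sup>2 * (4 + 3 * (drift (s n) - drift T))"
      using l T by (intro late_fluctuation) (auto simp: s_def)
    also have "\<dots> \<le> 2 * \<mu>\<^sup>2 * (4 + 3 * 1)"
      using drift_remaining[OF l, of "s n"] by (intro mult_left_mono) (auto simp: s_def T_def)
    finally have "norm (centred_moment \<mu> (s n) - centred_moment \<mu> T) \<le> 14 * \<mu>\<^sup>2" by simp
    from norm_triangle_mono[OF this early_gaussian[OF l \<mu>, folded T_def]]
    show ?thesis by (simp add: algebra_simps)
  qed
  then show ?thesis
    unfolding T_def[symmetric]
    by (intro tendsto_upperbound[OF tendsto_norm[OF tendsto_diff[OF q_lim tendsto_const]]]) auto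
qed

end

lemma point_process_measurable:
  assumes "point_process M N" "A \<in> sets borel"
  shows "(\<lambda>\<omega>. measure (N \<omega>) A) \<in> borel_measurable M"
  using assms unfolding point_process_def measure_def by (intro borel_measurable_enn2real) auto

lemma point_process_interval:
  assumes N: "point_process M N" and \<omega>: "\<omega> \<in> space M" and l: "0 \<le> l"
  shows "measure (N \<omega>) {0..l} = measure (N \<omega>) {0} + measure (N \<omega>) {0<..l}"
proof -
  have fin: "emeasure (N \<omega>) A \<noteq> \<infinity>" if "A \<in> sets borel" "bounded A" for A
  proof -
    have "emeasure (N \<omega>) A \<in> \<nat>" using N \<omega> that unfolding point_process_def by blast
    then show ?thesis by (auto elim!: Nats_cases)
  qed
  have sets: "sets (N \<omega>) = sets borel" using N \<omega> by (simp add: point_process_def)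
  have "bounded {0<..l}" by (rule bounded_subset[OF bounded_closed_interval[of 0 l]]) auto
  then have "measure (N \<omega>) ({0} \<union> {0<..l}) = measure (N \<omega>) {0} + measure (N \<omega>) {0<..l}"
    using fin sets by (intro measure_Union) auto
  moreover have "{0} \<union> {0<..l} = {0..l}" using l by auto
  ultimately show ?thesis by simp
qed

lemma char_distr:
  assumes "X \<in> borel_measurable M"
  shows "char (distr M borel X) t = (\<integral>\<omega>. cis (t * X \<omega>) \<partial>M)"
  unfolding char_def using assms by (simp add: integral_distr cis_conv_exp)

theorem theorem17:
  fixes \<beta> :: real and M :: "'a measure" and N :: "'a \<Rightarrow> real measure"
  assumes "\<beta> > 0" and "sine_process \<beta> M N"
  shows "weak_conv_along at_top
    (\<lambda>l::real. distr M borel (\<lambda>\<omega>. 1 / sqrt (ln l) * (measure (N \<omega>) {0..l} - l / (2 * pi))))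
    (normal_distribution 0 (2 / (\<beta> * pi\<^sup>2)))"
proof -
  obtain F B\<^sub>1 B\<^sub>2 \<alpha> where N: "point_process M N" and F: "filtered_prob_space M F"
    and B: "independent_brownian_motions M F B\<^sub>1 B\<^sub>2"
    and sol: "\<And>l. sine_sde_solution \<beta> M F B\<^sub>1 B\<^sub>2 l (\<alpha> l)"
    and lim: "\<And>l. AE \<omega> in M. ((\<lambda>t. 1 / (2 * pi) * \<alpha> l t \<omega>) \<longlongrightarrow> counting_function (N \<omega>) l) at_top"
    using assms(2) unfolding sine_process_def by blast
  interpret prob_space M using F by (simp add: filtered_prob_space_def)
  define W where "W l \<omega> = 1 / sqrt (ln l) * (measure (N \<omega>) {0..l} - l / (2 * pi))" for l \<omega>
  define C where "C = (9 + \<beta> / 4) * (16 / \<beta>\<^sup>2) + 8 / \<beta> + 14"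
  note meas = point_process_measurable[OF N]
  have W_meas [measurable]: "W l \<in> borel_measurable M" for l
    unfolding W_def[abs_def] using meas[of "{0..l}"] by simp
  have v: "0 < 2 / (\<beta> * pi\<^sup>2)" using assms(1) by simp
  \<comment> \<open>the closed interval contains the point \<open>0\<close>, which the counting function leaves out; its multiplicity is finite and vanishes after scaling\<close>
  have zero_lim: "(\<lambda>n. \<integral>\<omega>. norm (cis (a n * measure (N \<omega>) {0}) - 1) \<partial>M) \<longlonglongrightarrow> 0" if a: "a \<longlonglongrightarrow> 0" for a :: "nat \<Rightarrow> real"
  proof -
    have "(\<lambda>n. \<integral>\<omega>. norm (cis (a n * measure (N \<omega>) {0}) - 1) \<partial>M) \<longlonglongrightarrow> (\<integral>\<omega>. norm (cis (0 * measure (N \<omega>) {0}) - 1) \<partial>M)"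
    proof (rule integral_dominated_convergence[where w="\<lambda>_. 2"])
      show "AE \<omega> in M. (\<lambda>n. norm (cis (a n * measure (N \<omega>) {0}) - 1)) \<longlonglongrightarrow> norm (cis (0 * measure (N \<omega>) {0}) - 1)"
        by (intro AE_I2 tendsto_intros a)
      show "AE \<omega> in M. norm (norm (cis (a n * measure (N \<omega>) {0}) - 1)) \<le> 2" for n
        using norm_triangle_ineq4[of "cis (a n * measure (N _) {0})" 1] by (intro AE_I2) simp
    qed (use meas[of "{0}"] in auto)
    then show ?thesis by simp
  qed
  have char_bound: "norm (char (distr M borel (W l)) \<theta> - char (normal_distribution 0 (2 / (\<beta> * pi\<^sup>2))) \<theta>)
      \<le> (\<integral>\<omega>. norm (cis (\<theta> / sqrt (ln l) * measure (N \<omega>) {0}) - 1) \<partial>M) + C * (\<theta> / (2 * pi * sqrt (ln l)))\<^sup>2"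
    if l: "1 < l" and small: "\<bar>\<theta> / (2 * pi * sqrt (ln l))\<bar> \<le> 1" for l \<theta>
  proof -
    interpret sine_diffusion M F B\<^sub>1 B\<^sub>2 \<beta> l "\<alpha> l"
      by unfold_locales (use F B sol assms(1) in auto)
    \<comment> \<open>the frequency at which the phase has to be observed, as \<open>\<alpha> - l\<close> is divided by \<open>2\<pi> sqrt (ln l)\<close>\<close>
    define \<mu> where "\<mu> = \<theta> / (2 * pi * sqrt (ln l))"
    define c where "c \<omega> = measure (N \<omega>) {0<..l}" for \<omega>
    have ln: "0 < ln l" using l by simp
    have [measurable]: "c \<in> borel_measurable M" "(\<lambda>\<omega>. measure (N \<omega>) {0}) \<in> borel_measurable M"
      unfolding c_def[abs_def] using meas by simp_all
    have "AE \<omega> in M. ((\<lambda>t. 1 / (2 * pi) * \<alpha> l t \<omega>) \<longlongrightarrow> c \<omega>) at_top"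
      using lim[of l] l by (simp add: counting_function_def c_def)
    from limit_characteristic_function[OF l small[folded \<mu>_def] _ this]
    have 1: "norm ((\<integral>\<omega>. cis (\<mu> * (2 * pi * c \<omega> - l)) \<partial>M) - of_real (exp (- (\<mu>\<^sup>2 * (4 / \<beta> * ln l))))) \<le> C * \<mu>\<^sup>2"
      by (simp add: C_def)
    have "\<mu>\<^sup>2 * (4 / \<beta> * ln l) = 2 / (\<beta> * pi\<^sup>2) * \<theta>\<^sup>2 / 2"
      using ln assms(1) by (simp add: \<mu>_def power_divide power_mult_distrib field_simps)
    then have 2: "of_real (exp (- (\<mu>\<^sup>2 * (4 / \<beta> * ln l)))) = char (normal_distribution 0 (2 / (\<beta> * pi\<^sup>2))) \<theta>"
      unfolding char_normal_distribution[OF v] by simp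
    have W: "cis (\<theta> * W l \<omega>) = cis (\<theta> / sqrt (ln l) * measure (N \<omega>) {0}) * cis (\<mu> * (2 * pi * c \<omega> - l))"
      if "\<omega> \<in> space M" for \<omega>
    proof -
      have "\<theta> * W l \<omega> = \<theta> / sqrt (ln l) * measure (N \<omega>) {0} + \<mu> * (2 * pi * c \<omega> - l)"
        using point_process_interval[OF N that, of l] l ln
        by (simp add: W_def \<mu>_def c_def field_simps)
      then show ?thesis by (simp add: cis_mult)
    qed
    have "norm ((\<integral>\<omega>. cis (\<theta> * W l \<omega>) \<partial>M) - (\<integral>\<omega>. cis (\<mu> * (2 * pi * c \<omega> - l)) \<partial>M))
      \<le> (\<integral>\<omega>. norm (cis (\<theta> / sqrt (ln l) * measure (N \<omega>) {0}) - 1) \<partial>M)"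
    proof (rule norm_expectation_diff_le)
      show "integrable M (\<lambda>\<omega>. cis (\<theta> * W l \<omega>))" "integrable M (\<lambda>\<omega>. cis (\<mu> * (2 * pi * c \<omega> - l)))"
        by (intro integrable_const_bound[where B=1]; simp)+
      show "integrable M (\<lambda>\<omega>. norm (cis (\<theta> / sqrt (ln l) * measure (N \<omega>) {0}) - 1))"
        by (intro integrable_norm Bochner_Integration.integrable_diff integrable_const
            integrable_const_bound[where B=1]) auto
      fix \<omega> assume "\<omega> \<in> space M"
      from W[OF this] have "cis (\<theta> * W l \<omega>) - cis (\<mu> * (2 * pi * c \<omega> - l))
        = (cis (\<theta> / sqrt (ln l) * measure (N \<omega>) {0}) - 1) * cis (\<mu> * (2 * pi * c \<omega> - l))"
        by (simp only: left_diff_distrib mult_1)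
      then show "norm (cis (\<theta> * W l \<omega>) - cis (\<mu> * (2 * pi * c \<omega> - l)))
          \<le> norm (cis (\<theta> / sqrt (ln l) * measure (N \<omega>) {0}) - 1)"
        by (simp only: norm_mult norm_cis mult_1_right order_refl)
    qed
    from norm_triangle_mono[OF this 1[unfolded 2]] show ?thesis
      unfolding char_distr[OF W_meas] by (simp add: \<mu>_def)
  qed
  show ?thesis
    unfolding weak_conv_along_def W_def[symmetric]
  proof (intro allI impI tendsto_at_topI_sequentially)
    fix x and X :: "nat \<Rightarrow> real"
    assume cont: "isCont (cdf (normal_distribution 0 (2 / (\<beta> * pi\<^sup>2)))) x" and X: "filterlim X at_top sequentially"
    have "filterlim (\<lambda>n. sqrt (ln (X n))) at_top sequentially"
      by (intro filterlim_compose[OF sqrt_at_top] filterlim_compose[OF ln_at_top] X)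
    then have inv: "(\<lambda>n. \<theta> / sqrt (ln (X n))) \<longlonglongrightarrow> 0" for \<theta> :: real
      by (intro tendsto_divide_0[OF tendsto_const] filterlim_at_top_imp_at_infinity)
    have inv2: "(\<lambda>n. \<theta> / (2 * pi * sqrt (ln (X n)))) \<longlonglongrightarrow> 0" for \<theta> :: real
      using inv[of "\<theta> / (2 * pi)"] by simp
    have "weak_conv_m (\<lambda>n. distr M borel (W (X n))) (normal_distribution 0 (2 / (\<beta> * pi\<^sup>2)))"
    proof (rule levy_continuity)
      show "real_distribution (distr M borel (W (X n)))" for n by simp
      show "real_distribution (normal_distribution 0 (2 / (\<beta> * pi\<^sup>2)))"
        using prob_space_normal_distribution[OF v]
        by (simp add: real_distribution_def real_distribution_axioms_def)
      fix \<theta> :: real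
      have big: "\<forall>\<^sub>F n in sequentially. 1 < X n"
        using X by (simp add: filterlim_at_top_dense)
      have small: "\<forall>\<^sub>F n in sequentially. \<bar>\<theta> / (2 * pi * sqrt (ln (X n)))\<bar> < 1"
        using order_tendstoD(2)[OF tendsto_rabs[OF inv2[of \<theta>]], of 1] by simp
      have "(\<lambda>n. (\<integral>\<omega>. norm (cis (\<theta> / sqrt (ln (X n)) * measure (N \<omega>) {0}) - 1) \<partial>M)
          + C * (\<theta> / (2 * pi * sqrt (ln (X n))))\<^sup>2) \<longlonglongrightarrow> 0 + C * 0\<^sup>2"
        by (intro tendsto_intros zero_lim inv inv2)
      then have to0: "(\<lambda>n. (\<integral>\<omega>. norm (cis (\<theta> / sqrt (ln (X n)) * measure (N \<omega>) {0}) - 1) \<partial>M)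
          + C * (\<theta> / (2 * pi * sqrt (ln (X n))))\<^sup>2) \<longlonglongrightarrow> 0" by simp
      have "(\<lambda>n. char (distr M borel (W (X n))) \<theta> - char (normal_distribution 0 (2 / (\<beta> * pi\<^sup>2))) \<theta>) \<longlonglongrightarrow> 0"
      proof (rule Lim_null_comparison[OF _ to0])
        show "\<forall>\<^sub>F n in sequentially. norm (char (distr M borel (W (X n))) \<theta> - char (normal_distribution 0 (2 / (\<beta> * pi\<^sup>2))) \<theta>)
          \<le> (\<integral>\<omega>. norm (cis (\<theta> / sqrt (ln (X n)) * measure (N \<omega>) {0}) - 1) \<partial>M)
            + C * (\<theta> / (2 * pi * sqrt (ln (X n))))\<^sup>2"
          using big small by eventually_elim (intro char_bound less_imp_le)
      qed
      then show "(\<lambda>n. char (distr M borel (W (X n))) \<theta>) \<longlonglongrightarrow> char (normal_distribution 0 (2 / (\<beta> * pi\<^sup>2))) \<theta>"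
        by (rule LIM_zero_cancel)
    qed
    then show "(\<lambda>n. cdf (distr M borel (W (X n))) x) \<longlonglongrightarrow> cdf (normal_distribution 0 (2 / (\<beta> * pi\<^sup>2))) x"
      using cont by (simp add: weak_conv_m_def weak_conv_def)
  qed
qed

end
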